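(* (i) The functor $\mathfrak Q$ which associates to an object $(X,\theta)$ of the category $\mathfrak{Arc}$ of archimedean sets the abstract circle $X/\theta$ is an equivalence of categories from $\mathfrak{Arc}$ to the category of abstract circles. (ii) At the level of points of the topoi $\hat\Delta=\mathrm{Sets}^{\Delta^{\rm op}}$ and $\hat\Lambda=\mathrm{Sets}^{\Lambda^{\rm op}}$, the geometric morphism $\hat\Delta\to\hat\Lambda$ associated to the inclusion $j:\Delta\subset\Lambda$ induces the functor which associates to an interval $I$ the archimedean set $X_I=(\mathbb Z\times I)/\sim$. That is, the composite of the point $p_I$ of $\hat\Delta$ with this geometric morphism is the point of $\hat\Lambda$ corresponding to $X_I$, naturally in $I$; equivalently, the functors $\Lambda\to\mathrm{Sets}$, $[n]\mapsto \mathrm{Hom}_\Lambda(j(\cdot),[n])\otimes_\Delta\mathcal F_I$ and $\mathcal P_{X_I}$ are isomorphic, naturally in $I$.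
   Context: An archimedean set is a pair $(X,\theta)$ with $X$ a non-empty totally ordered set and $\theta$ an order automorphism of $X$ with $\theta(x)>x$ for all $x$ and such that for all $x,y\in X$ there is $n\in\mathbb N$ with $y\le\theta^n(x)$. In $\mathfrak{Arc}$, morphisms $(X,\theta)\to(X',\theta')$ are classes of non-decreasing maps $f:X\to X'$ with $f\circ\theta=\theta'\circ f$, where $f$ and $g$ are identified if $g=\theta'^m\circ f$ for some $m\in\mathbb Z$. An abstract circle is $(P,S,\partial_0,\partial_1,0,1,*,\cup)$ with $P,S$ sets, maps $\partial_0,\partial_1:S\to P$, maps $x\mapsto0_x$ and $x\mapsto1_x$ from $P$ to $S$, an involution $*:S\to S$, and a partially defined map $\cup$ from a subset of $S\times S$ to $S$, such that: 1. $P\ne\emptyset$; for any $x,y\in P$ there is $a\in S$ with $\partial_0a=x$, $\partial_1a=y$; $0_x\ne1_x$ for all $x$. 2. $a^{**}=a$, $\partial_0(a^* )=\partial_1(a)$, $\partial_0(0_x)=x=\partial_1(0_x)$, $0_x^*=1_x$; if $\partial_0a=\partial_1a=x$ then $a=0_x$ or $a=1_x$. 3. (a) $a\cup b$ exists only if $\partial_1a=\partial_0b$, and then $\partial_1(a\cup b)=\partial_1b$, $\partial_0(a\cup b)=\partial_0a$. (b) $a\cup b=c\iff c^*\cup a=b^*$. (c) If $a\cup b$ and $(a\cup b)\cup c$ exist then so do $b\cup c$ and $a\cup(b\cup c)$, and $(a\cup b)\cup c=a\cup(b\cup c)$. (d) $a\cup b=0_x\Rightarrow a=0_x$. (e) If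 $\partial_0a=x$ then $0_x\cup a=a$. (f) If $\partial_1a=\partial_0b$ then at least one of $a\cup b$, $b^*\cup a^*$ exists. A morphism of abstract circles is a pair of maps $P\to P'$, $S\to S'$ compatible with $\partial_0,\partial_1,0,1,*$ and such that whenever $a\cup b$ exists, the union of the images exists and is the image of $a\cup b$. The abstract circle $X/\theta$: $P=X/\theta^{\mathbb Z}$; $S$ is the set of orbits of the diagonal action of $\theta^{\mathbb Z}$ on $\{(x,y)\in X^2: x\le y\le\theta(x)\}$; $\partial_0(x,y)=x$, $\partial_1(x,y)=y$, $0_x=(x,x)$, $1_x=(x,\theta(x))$, $(x,y)^*=(y,\theta(x))$, and $(x,y)\cup(y,z)=(x,z)$ provided $x\le y\le z\le\theta(x)$. A morphism $f$ of $\mathfrak{Arc}$ induces $\mathfrak Q(f)$ by $x\mapsto f(x)$, $(x,y)\mapsto(f(x),f(y))$. $\Delta$ has objects $[n]=\{0,\dots,n\}$, $n\ge0$, and non-decreasing maps as morphisms. The cyclic category $\Lambda$ has objects $[n]$, $n\ge0$, and $\mathrm{Hom}_\Lambda([n],[m])$ is the set of non-decreasing $f:\mathbb Z\to\mathbb Z$ with $f(x+n+1)=f(x)+m+1$, modulo $f\sim f+k(m+1)$, $k\in\mathbb Z$. Thus $\Lambda$ is the full subcategory of $\mathfrak{Arc}$ on the objects $(\mathbb Z,x\mapsto x+n+1)$, denoted $[n]$. The inclusion $j$ is the identity on objects with $j(f)(x+k(n+1))=f(x)+k(m+1)$ for $f\in\mathrm{Hom}_\Delta([n],[m])$, $x\in[n]$,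 $k\in\mathbb Z$. For $f\in\mathrm{Hom}_\Lambda([n],[m])$ the transpose $f^t\in\mathrm{Hom}_\Lambda([m],[n])$ is defined by $f(x)\ge y\iff x\ge f^t(y)$ for all $x,y\in\mathbb Z$. Points of $\hat{\mathcal C}$ correspond to flat (filtering) covariant functors $\mathcal C\to\mathrm{Sets}$, a point $p$ corresponding to $p^*$ composed with the Yoneda embedding, and to a flat functor $\mathcal F$ corresponds the inverse image functor $R\mapsto R\otimes_{\mathcal C}\mathcal F$. The point of $\hat\Lambda$ corresponding to an archimedean set $X$ is given by $\mathcal P_X:\Lambda\to\mathrm{Sets}$, $\mathcal P_X([n])=\mathrm{Hom}_{\mathfrak{Arc}}([n],X)$, with $f\in\mathrm{Hom}_\Lambda([n],[m])$ acting by $u\mapsto u\circ f^t$. An interval is a totally ordered set $I$ with smallest element $b$ and largest element $t>b$; morphisms of intervals are non-decreasing maps preserving both endpoints. The point $p_I$ of $\hat\Delta$ is given by $\mathcal F_I([n])=$ the set of morphisms of intervals $\{0,\dots,n+1\}\to I$, with $f\in\mathrm{Hom}_\Delta([n],[m])$ acting by precomposition with $j\mapsto\min\{i\in[n]:f(i)\ge j\}$ (value $n+1$ if no such $i$). The inverse image part of $\hat\Delta\to\hat\Lambda$ is restriction along $j$. $X_I$ is the quotient of $\mathbb Z\times I$ by $(n,t)\sim(n+1,b)$ with the order induced by the lexicographic order and $\theta(n,u)=(n+1,u)$. *)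

theory Defs
  imports "HOL-Library.FuncSet" "HOL-Library.Equipollence"
begin

section \<open>Categories, functors, equivalences\<close>

text \<open>Morphisms do not carry their domain and codomain, so composition and the morphism part of a
  functor take the objects as arguments: \<open>Cmp C a b c g f\<close> is the composite of \<open>f : a \<rightarrow> b\<close> and
  \<open>g : b \<rightarrow> c\<close>, and \<open>fmor F a b f\<close> is the image of \<open>f : a \<rightarrow> b\<close>.\<close>

record ('o, 'm) category =
  Ob :: "'o set"
  Hom :: "'o \<Rightarrow> 'o \<Rightarrow> 'm set"
  Idn :: "'o \<Rightarrow> 'm"
  Cmp :: "'o \<Rightarrow> 'o \<Rightarrow> 'o \<Rightarrow> 'm \<Rightarrow> 'm \<Rightarrow> 'm"

definition is_category :: "('o, 'm) category \<Rightarrow> bool" where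
  "is_category C \<longleftrightarrow>
     (\<forall>a\<in>Ob C. Idn C a \<in> Hom C a a) \<and>
     (\<forall>a\<in>Ob C. \<forall>b\<in>Ob C. \<forall>c\<in>Ob C. \<forall>f\<in>Hom C a b. \<forall>g\<in>Hom C b c.
        Cmp C a b c g f \<in> Hom C a c) \<and>
     (\<forall>a\<in>Ob C. \<forall>b\<in>Ob C. \<forall>f\<in>Hom C a b.
        Cmp C a a b f (Idn C a) = f \<and> Cmp C a b b (Idn C b) f = f) \<and>
     (\<forall>a\<in>Ob C. \<forall>b\<in>Ob C. \<forall>c\<in>Ob C. \<forall>d\<in>Ob C. \<forall>f\<in>Hom C a b. \<forall>g\<in>Hom C b c. \<forall>h\<in>Hom C c d.
        Cmp C a c d h (Cmp C a b c g f) = Cmp C a b d (Cmp C b c d h g) f)"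

record ('o, 'm, 'p, 'n) cfunctor =
  fobj :: "'o \<Rightarrow> 'p"
  fmor :: "'o \<Rightarrow> 'o \<Rightarrow> 'm \<Rightarrow> 'n"

definition is_functor ::
  "('o, 'm) category \<Rightarrow> ('p, 'n) category \<Rightarrow> ('o, 'm, 'p, 'n) cfunctor \<Rightarrow> bool" where
  "is_functor C D F \<longleftrightarrow>
     (\<forall>a\<in>Ob C. fobj F a \<in> Ob D) \<and>
     (\<forall>a\<in>Ob C. \<forall>b\<in>Ob C. \<forall>f\<in>Hom C a b. fmor F a b f \<in> Hom D (fobj F a) (fobj F b)) \<and>
     (\<forall>a\<in>Ob C. fmor F a a (Idn C a) = Idn D (fobj F a)) \<and>
     (\<forall>a\<in>Ob C. \<forall>b\<in>Ob C. \<forall>c\<in>Ob C. \<forall>f\<in>Hom C a b. \<forall>g\<in>Hom C b c.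
        fmor F a c (Cmp C a b c g f) =
          Cmp D (fobj F a) (fobj F b) (fobj F c) (fmor F b c g) (fmor F a b f))"

definition id_functor :: "('o, 'm, 'o, 'm) cfunctor" where
  "id_functor = \<lparr>fobj = \<lambda>a. a, fmor = \<lambda>a b f. f\<rparr>"

definition comp_functor ::
  "('p, 'n, 'q, 'k) cfunctor \<Rightarrow> ('o, 'm, 'p, 'n) cfunctor \<Rightarrow> ('o, 'm, 'q, 'k) cfunctor" where
  "comp_functor G F =
     \<lparr>fobj = \<lambda>a. fobj G (fobj F a),
      fmor = \<lambda>a b f. fmor G (fobj F a) (fobj F b) (fmor F a b f)\<rparr>"

definition nat_trans ::
  "('o, 'm) category \<Rightarrow> ('p, 'n) category \<Rightarrow>
   ('o, 'm, 'p, 'n) cfunctor \<Rightarrow> ('o, 'm, 'p, 'n) cfunctor \<Rightarrow> ('o \<Rightarrow> 'n) \<Rightarrow> bool" where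
  "nat_trans C D F G \<eta> \<longleftrightarrow>
     (\<forall>a\<in>Ob C. \<eta> a \<in> Hom D (fobj F a) (fobj G a)) \<and>
     (\<forall>a\<in>Ob C. \<forall>b\<in>Ob C. \<forall>f\<in>Hom C a b.
        Cmp D (fobj F a) (fobj F b) (fobj G b) (\<eta> b) (fmor F a b f) =
        Cmp D (fobj F a) (fobj G a) (fobj G b) (fmor G a b f) (\<eta> a))"

definition is_iso :: "('o, 'm) category \<Rightarrow> 'o \<Rightarrow> 'o \<Rightarrow> 'm \<Rightarrow> bool" where
  "is_iso C a b f \<longleftrightarrow> f \<in> Hom C a b \<and>
     (\<exists>g\<in>Hom C b a. Cmp C a b a g f = Idn C a \<and> Cmp C b a b f g = Idn C b)"

definition naturally_isomorphic ::
  "('o, 'm) category \<Rightarrow> ('p, 'n) category \<Rightarrow>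
   ('o, 'm, 'p, 'n) cfunctor \<Rightarrow> ('o, 'm, 'p, 'n) cfunctor \<Rightarrow> bool" where
  "naturally_isomorphic C D F G \<longleftrightarrow> is_functor C D F \<and> is_functor C D G \<and>
     (\<exists>\<eta>. nat_trans C D F G \<eta> \<and> (\<forall>a\<in>Ob C. is_iso D (fobj F a) (fobj G a) (\<eta> a)))"

definition is_equivalence ::
  "('o, 'm) category \<Rightarrow> ('p, 'n) category \<Rightarrow> ('o, 'm, 'p, 'n) cfunctor \<Rightarrow> bool" where
  "is_equivalence C D F \<longleftrightarrow> is_category C \<and> is_category D \<and> is_functor C D F \<and>
     (\<exists>G. is_functor D C G \<and>
          naturally_isomorphic C C (comp_functor G F) id_functor \<and>
          naturally_isomorphic D D (comp_functor F G) id_functor)"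

definition op_cat :: "('o, 'm) category \<Rightarrow> ('o, 'm) category" where
  "op_cat C = \<lparr>Ob = Ob C, Hom = \<lambda>a b. Hom C b a, Idn = Idn C,
               Cmp = \<lambda>a b c g f. Cmp C c b a f g\<rparr>"

definition op_functor :: "('o, 'm, 'p, 'n) cfunctor \<Rightarrow> ('o, 'm, 'p, 'n) cfunctor" where
  "op_functor F = \<lparr>fobj = fobj F, fmor = \<lambda>a b f. fmor F b a f\<rparr>"

definition prod_cat ::
  "('o, 'm) category \<Rightarrow> ('p, 'n) category \<Rightarrow> ('o \<times> 'p, 'm \<times> 'n) category" where
  "prod_cat C D =
     \<lparr>Ob = Ob C \<times> Ob D,
      Hom = \<lambda>x y. Hom C (fst x) (fst y) \<times> Hom D (snd x) (snd y),
      Idn = \<lambda>x. (Idn C (fst x), Idn D (snd x)),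
      Cmp = \<lambda>x y z g f. (Cmp C (fst x) (fst y) (fst z) (fst g) (fst f),
                          Cmp D (snd x) (snd y) (snd z) (snd g) (snd f))\<rparr>"

definition prod_functor ::
  "('o, 'm, 'p, 'n) cfunctor \<Rightarrow> ('o2, 'm2, 'p2, 'n2) cfunctor \<Rightarrow>
   ('o \<times> 'o2, 'm \<times> 'm2, 'p \<times> 'p2, 'n \<times> 'n2) cfunctor" where
  "prod_functor F G =
     \<lparr>fobj = \<lambda>x. (fobj F (fst x), fobj G (snd x)),
      fmor = \<lambda>x y f. (fmor F (fst x) (fst y) (fst f), fmor G (snd x) (snd y) (snd f))\<rparr>"

text \<open>The sets contained in a type \<open>'x\<close>. As \<open>'x\<close> is arbitrary, a statement about all
  \<open>set_cat\<close>-valued functors for all \<open>'x\<close> covers set-valued functors of any size.\<close>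

definition set_cat :: "('x set, 'x \<Rightarrow> 'x) category" where
  "set_cat = \<lparr>Ob = UNIV, Hom = \<lambda>A B. A \<rightarrow>\<^sub>E B, Idn = \<lambda>A. (\<lambda>x\<in>A. x),
              Cmp = \<lambda>A B C g f. compose A g f\<rparr>"

text \<open>Natural isomorphism between two set-valued functors whose values live in different types,
  so that they do not have a common target \<open>set_cat\<close>.\<close>

definition naturally_bijective ::
  "('o, 'm) category \<Rightarrow> ('o, 'm, 'x set, 'x \<Rightarrow> 'x) cfunctor \<Rightarrow>
   ('o, 'm, 'y set, 'y \<Rightarrow> 'y) cfunctor \<Rightarrow> bool" where
  "naturally_bijective C F G \<longleftrightarrow>
     is_category C \<and> is_functor C set_cat F \<and> is_functor C set_cat G \<and>
     (\<exists>\<eta>. (\<forall>a\<in>Ob C. bij_betw (\<eta> a) (fobj F a) (fobj G a)) \<and>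
          (\<forall>a\<in>Ob C. \<forall>b\<in>Ob C. \<forall>f\<in>Hom C a b. \<forall>x\<in>fobj F a.
             \<eta> b (fmor F a b f x) = fmor G a b f (\<eta> a x)))"

definition functor_cat ::
  "('o, 'm) category \<Rightarrow> ('p, 'n) category \<Rightarrow> (('o, 'm, 'p, 'n) cfunctor, 'o \<Rightarrow> 'n) category" where
  "functor_cat C D =
     \<lparr>Ob = {F. is_functor C D F},
      Hom = \<lambda>F G. {\<eta> \<in> extensional (Ob C). nat_trans C D F G \<eta>},
      Idn = \<lambda>F. (\<lambda>a\<in>Ob C. Idn D (fobj F a)),
      Cmp = \<lambda>F G H \<beta> \<alpha>. (\<lambda>a\<in>Ob C. Cmp D (fobj F a) (fobj G a) (fobj H a) (\<beta> a) (\<alpha> a))\<rparr>"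

abbreviation psh ::
  "('o, 'm) category \<Rightarrow> (('o, 'm, 'x set, 'x \<Rightarrow> 'x) cfunctor, 'o \<Rightarrow> 'x \<Rightarrow> 'x) category" where
  "psh C \<equiv> functor_cat (op_cat C) set_cat"

abbreviation copsh ::
  "('o, 'm) category \<Rightarrow> (('o, 'm, 'x set, 'x \<Rightarrow> 'x) cfunctor, 'o \<Rightarrow> 'x \<Rightarrow> 'x) category" where
  "copsh C \<equiv> functor_cat C set_cat"

definition yoneda ::
  "('o, 'm) category \<Rightarrow> ('o, 'm, ('o, 'm, 'm set, 'm \<Rightarrow> 'm) cfunctor, 'o \<Rightarrow> 'm \<Rightarrow> 'm) cfunctor" where
  "yoneda C =
     \<lparr>fobj = \<lambda>c. \<lparr>fobj = \<lambda>a. Hom C a c,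
                  fmor = \<lambda>a b f. (\<lambda>h\<in>Hom C a c. Cmp C b a c h f)\<rparr>,
      fmor = \<lambda>c d g. (\<lambda>a\<in>Ob C. \<lambda>h\<in>Hom C a c. Cmp C a c d g h)\<rparr>"

text \<open>Restriction of presheaves along \<open>H : E \<rightarrow> C\<close>; this is the inverse image part of the geometric
  morphism of presheaf topoi associated to \<open>H\<close>.\<close>

definition restriction_functor ::
  "('e, 'k) category \<Rightarrow> ('e, 'k, 'o, 'm) cfunctor \<Rightarrow>
   (('o, 'm, 'x set, 'x \<Rightarrow> 'x) cfunctor, 'o \<Rightarrow> 'x \<Rightarrow> 'x,
    ('e, 'k, 'x set, 'x \<Rightarrow> 'x) cfunctor, 'e \<Rightarrow> 'x \<Rightarrow> 'x) cfunctor" where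
  "restriction_functor E H =
     \<lparr>fobj = \<lambda>R. comp_functor R (op_functor H),
      fmor = \<lambda>R R' \<alpha>. (\<lambda>e\<in>Ob E. \<alpha> (fobj H e))\<rparr>"

text \<open>For \<open>K : D \<rightarrow> Sets\<^sup>C\<close>, the functor \<open>(c, d) \<mapsto> K(d)(c)\<close> on \<open>C \<times> D\<close>.\<close>

definition uncurry_functor ::
  "('p, 'n, ('o, 'm, 'x set, 'x \<Rightarrow> 'x) cfunctor, 'o \<Rightarrow> 'x \<Rightarrow> 'x) cfunctor \<Rightarrow>
   ('o \<times> 'p, 'm \<times> 'n, 'x set, 'x \<Rightarrow> 'x) cfunctor" where
  "uncurry_functor K =
     \<lparr>fobj = \<lambda>(c, d). fobj (fobj K d) c,
      fmor = \<lambda>(c, d) (c', d') (f, g).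
        compose (fobj (fobj K d) c) (fmor (fobj K d') c c' f) (fmor K d d' g c)\<rparr>"


section \<open>Tensor product of a presheaf and a covariant functor\<close>

definition gen_equiv :: "'x rel \<Rightarrow> 'x rel" where
  "gen_equiv g = (g \<union> g\<inverse>)\<^sup>*"

text \<open>\<open>R \<otimes>\<^sub>C F\<close> is the quotient of the disjoint union of the \<open>R(c) \<times> F(c)\<close> by the equivalence
  relation generated by \<open>(R(f) r', x) \<sim> (r', F(f) x)\<close> for \<open>f : c \<rightarrow> c'\<close>, \<open>r' \<in> R(c')\<close>, \<open>x \<in> F(c)\<close>.\<close>

definition tensor_equiv ::
  "('o, 'm) category \<Rightarrow> ('o, 'm, 'r set, 'r \<Rightarrow> 'r) cfunctor \<Rightarrow>
   ('o, 'm, 'x set, 'x \<Rightarrow> 'x) cfunctor \<Rightarrow> ('o \<times> 'r \<times> 'x) rel" where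
  "tensor_equiv C R F = gen_equiv
     {((c, fmor R c' c f r', x), (c', r', fmor F c c' f x)) | c c' f r' x.
        c \<in> Ob C \<and> c' \<in> Ob C \<and> f \<in> Hom C c c' \<and> r' \<in> fobj R c' \<and> x \<in> fobj F c}"

definition tensor ::
  "('o, 'm) category \<Rightarrow> ('o, 'm, 'r set, 'r \<Rightarrow> 'r) cfunctor \<Rightarrow>
   ('o, 'm, 'x set, 'x \<Rightarrow> 'x) cfunctor \<Rightarrow> ('o \<times> 'r \<times> 'x) set set" where
  "tensor C R F = (SIGMA c:Ob C. fobj R c \<times> fobj F c) // tensor_equiv C R F"

text \<open>The map \<open>[c, r, x] \<mapsto> [c, \<alpha>\<^sub>c(r), \<beta>\<^sub>c(x)]\<close>.\<close>

definition tensor_map ::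
  "('o, 'm) category \<Rightarrow>
   ('o, 'm, 'r set, 'r \<Rightarrow> 'r) cfunctor \<Rightarrow> ('o, 'm, 'x set, 'x \<Rightarrow> 'x) cfunctor \<Rightarrow>
   ('o, 'm, 'r set, 'r \<Rightarrow> 'r) cfunctor \<Rightarrow> ('o, 'm, 'x set, 'x \<Rightarrow> 'x) cfunctor \<Rightarrow>
   ('o \<Rightarrow> 'r \<Rightarrow> 'r) \<Rightarrow> ('o \<Rightarrow> 'x \<Rightarrow> 'x) \<Rightarrow> ('o \<times> 'r \<times> 'x) set \<Rightarrow> ('o \<times> 'r \<times> 'x) set" where
  "tensor_map C R F R' F' \<alpha> \<beta> =
     (\<lambda>A\<in>tensor C R F. \<Union>(c, r, x)\<in>A. tensor_equiv C R' F' `` {(c, \<alpha> c r, \<beta> c x)})"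

definition tensor_functor ::
  "('o, 'm) category \<Rightarrow>
   (('o, 'm, 'r set, 'r \<Rightarrow> 'r) cfunctor \<times> ('o, 'm, 'x set, 'x \<Rightarrow> 'x) cfunctor,
    ('o \<Rightarrow> 'r \<Rightarrow> 'r) \<times> ('o \<Rightarrow> 'x \<Rightarrow> 'x),
    ('o \<times> 'r \<times> 'x) set set, ('o \<times> 'r \<times> 'x) set \<Rightarrow> ('o \<times> 'r \<times> 'x) set) cfunctor" where
  "tensor_functor C =
     \<lparr>fobj = \<lambda>(R, F). tensor C R F,
      fmor = \<lambda>(R, F) (R', F') (\<alpha>, \<beta>). tensor_map C R F R' F' \<alpha> \<beta>\<rparr>"


section \<open>Archimedean sets\<close>

text \<open>The order is given as a relation, as in \<^theory>\<open>HOL.Order_Relation\<close>; \<open>theta\<close> is only relevant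
  on the carrier.\<close>

record 'a arch =
  acar :: "'a set"
  aord :: "'a rel"
  theta :: "'a \<Rightarrow> 'a"

definition archimedean_set :: "'a arch \<Rightarrow> bool" where
  "archimedean_set X \<longleftrightarrow>
     acar X \<noteq> {} \<and> linear_order_on (acar X) (aord X) \<and>
     bij_betw (theta X) (acar X) (acar X) \<and>
     (\<forall>x\<in>acar X. \<forall>y\<in>acar X. (theta X x, theta X y) \<in> aord X \<longleftrightarrow> (x, y) \<in> aord X) \<and>
     (\<forall>x\<in>acar X. (x, theta X x) \<in> aord X \<and> theta X x \<noteq> x) \<and>
     (\<forall>x\<in>acar X. \<forall>y\<in>acar X. \<exists>n::nat. (y, (theta X ^^ n) x) \<in> aord X)"

definition theta_pow :: "'a arch \<Rightarrow> int \<Rightarrow> 'a \<Rightarrow> 'a" where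
  "theta_pow X m x = (if 0 \<le> m then (theta X ^^ nat m) x
                      else (inv_into (acar X) (theta X) ^^ nat (- m)) x)"

definition arc_maps :: "'a arch \<Rightarrow> 'b arch \<Rightarrow> ('a \<Rightarrow> 'b) set" where
  "arc_maps X Y = {f \<in> acar X \<rightarrow>\<^sub>E acar Y.
     (\<forall>x\<in>acar X. \<forall>y\<in>acar X. (x, y) \<in> aord X \<longrightarrow> (f x, f y) \<in> aord Y) \<and>
     (\<forall>x\<in>acar X. f (theta X x) = theta Y (f x))}"

definition arc_class :: "'a arch \<Rightarrow> 'b arch \<Rightarrow> ('a \<Rightarrow> 'b) \<Rightarrow> ('a \<Rightarrow> 'b) set" where
  "arc_class X Y f = range (\<lambda>m::int. \<lambda>x\<in>acar X. theta_pow Y m (f x))"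

definition arc_hom :: "'a arch \<Rightarrow> 'b arch \<Rightarrow> ('a \<Rightarrow> 'b) set set" where
  "arc_hom X Y = arc_class X Y ` arc_maps X Y"

definition arc_comp :: "'a arch \<Rightarrow> ('b \<Rightarrow> 'c) set \<Rightarrow> ('a \<Rightarrow> 'b) set \<Rightarrow> ('a \<Rightarrow> 'c) set" where
  "arc_comp X G F = {compose (acar X) g f | g f. g \<in> G \<and> f \<in> F}"

definition Arc :: "('a arch, ('a \<Rightarrow> 'a) set) category" where
  "Arc = \<lparr>Ob = {X. archimedean_set X}, Hom = arc_hom,
          Idn = \<lambda>X. arc_class X X (\<lambda>x\<in>acar X. x),
          Cmp = \<lambda>X Y Z G F. arc_comp X G F\<rparr>"


section \<open>Abstract circles\<close>

record ('p, 's) acircle =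
  Pts :: "'p set"
  Segs :: "'s set"
  bd0 :: "'s \<Rightarrow> 'p"
  bd1 :: "'s \<Rightarrow> 'p"
  zero_seg :: "'p \<Rightarrow> 's"
  one_seg :: "'p \<Rightarrow> 's"
  star :: "'s \<Rightarrow> 's"
  cup :: "'s \<Rightarrow> 's \<Rightarrow> 's option"

definition abstract_circle :: "('p, 's) acircle \<Rightarrow> bool" where
  "abstract_circle K \<longleftrightarrow>
     (let P = Pts K; S = Segs K; d0 = bd0 K; d1 = bd1 K; z = zero_seg K; e = one_seg K;
          st = star K; u = cup K in
     \<comment> \<open>the structure maps\<close>
     d0 ` S \<subseteq> P \<and> d1 ` S \<subseteq> P \<and> z ` P \<subseteq> S \<and> e ` P \<subseteq> S \<and> st ` S \<subseteq> S \<and>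
     (\<forall>a b c. u a b = Some c \<longrightarrow> a \<in> S \<and> b \<in> S \<and> c \<in> S) \<and>
     \<comment> \<open>1\<close>
     P \<noteq> {} \<and> (\<forall>x\<in>P. \<forall>y\<in>P. \<exists>a\<in>S. d0 a = x \<and> d1 a = y) \<and> (\<forall>x\<in>P. z x \<noteq> e x) \<and>
     \<comment> \<open>2\<close>
     (\<forall>a\<in>S. st (st a) = a \<and> d0 (st a) = d1 a) \<and>
     (\<forall>x\<in>P. d0 (z x) = x \<and> d1 (z x) = x \<and> st (z x) = e x) \<and>
     (\<forall>a\<in>S. \<forall>x\<in>P. d0 a = x \<and> d1 a = x \<longrightarrow> a = z x \<or> a = e x) \<and>
     \<comment> \<open>3\<close>
     (\<forall>a\<in>S. \<forall>b\<in>S. \<forall>c\<in>S. u a b = Some c \<longrightarrow> d1 a = d0 b \<and> d1 c = d1 b \<and> d0 c = d0 a) \<and>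
     (\<forall>a\<in>S. \<forall>b\<in>S. \<forall>c\<in>S. u a b = Some c \<longleftrightarrow> u (st c) a = Some (st b)) \<and>
     (\<forall>a\<in>S. \<forall>b\<in>S. \<forall>c\<in>S. \<forall>ab\<in>S. \<forall>abc\<in>S. u a b = Some ab \<and> u ab c = Some abc \<longrightarrow>
        (\<exists>bc. u b c = Some bc \<and> u a bc = Some abc)) \<and>
     (\<forall>a\<in>S. \<forall>b\<in>S. \<forall>x\<in>P. u a b = Some (z x) \<longrightarrow> a = z x) \<and>
     (\<forall>a\<in>S. \<forall>x\<in>P. d0 a = x \<longrightarrow> u (z x) a = Some a) \<and>
     (\<forall>a\<in>S. \<forall>b\<in>S. d1 a = d0 b \<longrightarrow> u a b \<noteq> None \<or> u (st b) (st a) \<noteq> None))"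

definition circle_hom ::
  "('p, 's) acircle \<Rightarrow> ('q, 't) acircle \<Rightarrow> (('p \<Rightarrow> 'q) \<times> ('s \<Rightarrow> 't)) set" where
  "circle_hom K L = {(f, g). f \<in> Pts K \<rightarrow>\<^sub>E Pts L \<and> g \<in> Segs K \<rightarrow>\<^sub>E Segs L \<and>
     (\<forall>a\<in>Segs K. bd0 L (g a) = f (bd0 K a) \<and> bd1 L (g a) = f (bd1 K a) \<and>
                 star L (g a) = g (star K a)) \<and>
     (\<forall>x\<in>Pts K. zero_seg L (f x) = g (zero_seg K x) \<and> one_seg L (f x) = g (one_seg K x)) \<and>
     (\<forall>a\<in>Segs K. \<forall>b\<in>Segs K. \<forall>c\<in>Segs K. cup K a b = Some c \<longrightarrow> cup L (g a) (g b) = Some (g c))}"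

text \<open>The circle \<open>X/\<theta>\<close> of an archimedean set \<open>X\<close> with carrier in \<open>'a\<close> has its points in \<open>'a set\<close> and
  its segments in \<open>('a \<times> 'a) set\<close>, and these types may contain more elements than \<open>'a\<close>. The
  category of abstract circles matching the archimedean sets in \<open>'a\<close> is that of the circles that
  are small relative to \<open>'a\<close>. Since \<open>'a\<close> is arbitrary this is no restriction: any circle has an
  isomorphic copy which is small relative to a sufficiently large type.\<close>

definition small_circle :: "('a set, ('a \<times> 'a) set) acircle \<Rightarrow> bool" where
  "small_circle K \<longleftrightarrow> Pts K \<lesssim> (UNIV :: 'a set) \<and> Segs K \<lesssim> (UNIV :: 'a set)"

definition Circ ::
  "(('a set, ('a \<times> 'a) set) acircle,
    ('a set \<Rightarrow> 'a set) \<times> (('a \<times> 'a) set \<Rightarrow> ('a \<times> 'a) set)) category" where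
  "Circ = \<lparr>Ob = {K. abstract_circle K \<and> small_circle K}, Hom = circle_hom,
           Idn = \<lambda>K. (\<lambda>x\<in>Pts K. x, \<lambda>a\<in>Segs K. a),
           Cmp = \<lambda>K L M g f. (compose (Pts K) (fst g) (fst f), compose (Segs K) (snd g) (snd f))\<rparr>"

definition orbit :: "'a arch \<Rightarrow> 'a \<Rightarrow> 'a set" where
  "orbit X x = range (\<lambda>m::int. theta_pow X m x)"

definition orbit2 :: "'a arch \<Rightarrow> 'a \<times> 'a \<Rightarrow> ('a \<times> 'a) set" where
  "orbit2 X p = range (\<lambda>m::int. (theta_pow X m (fst p), theta_pow X m (snd p)))"

definition quot_segs :: "'a arch \<Rightarrow> ('a \<times> 'a) set set" where
  "quot_segs X = orbit2 X ` {(x, y). x \<in> acar X \<and> y \<in> acar X \<and>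
     (x, y) \<in> aord X \<and> (y, theta X x) \<in> aord X}"

text \<open>Since an orbit is a set of representatives, images under equivariant maps compute the structure
  maps. If \<open>A\<close> and \<open>B\<close> are the orbits of \<open>(x, y)\<close> and \<open>(y, z)\<close>, the relational composite \<open>A O B\<close>
  is the orbit of \<open>(x, z)\<close>, because \<open>\<theta>\<close> acts freely.\<close>

definition arc_circle :: "'a arch \<Rightarrow> ('a set, ('a \<times> 'a) set) acircle" where
  "arc_circle X =
     \<lparr>Pts = orbit X ` acar X,
      Segs = quot_segs X,
      bd0 = \<lambda>A. fst ` A,
      bd1 = \<lambda>A. snd ` A,
      zero_seg = \<lambda>p. (\<lambda>x. (x, x)) ` p,
      one_seg = \<lambda>p. (\<lambda>x. (x, theta X x)) ` p,
      star = \<lambda>A. (\<lambda>(x, y). (y, theta X x)) ` A,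
      cup = \<lambda>A B.
        if A \<in> quot_segs X \<and> B \<in> quot_segs X \<and>
           (\<exists>x y z. (x, y) \<in> A \<and> (y, z) \<in> B \<and>
              (x, y) \<in> aord X \<and> (y, z) \<in> aord X \<and> (z, theta X x) \<in> aord X)
        then Some (A O B) else None\<rparr>"

text \<open>The image of an orbit under a representative \<open>f\<close> does not depend on the choice of \<open>f\<close> in its
  class \<open>F\<close>; taking the union over the class avoids choosing one.\<close>

definition Q_functor ::
  "('a arch, ('a \<Rightarrow> 'a) set, ('a set, ('a \<times> 'a) set) acircle,
    ('a set \<Rightarrow> 'a set) \<times> (('a \<times> 'a) set \<Rightarrow> ('a \<times> 'a) set)) cfunctor" where
  "Q_functor =
     \<lparr>fobj = arc_circle,
      fmor = \<lambda>X Y F. (\<lambda>p\<in>Pts (arc_circle X). \<Union>f\<in>F. f ` p,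
                       \<lambda>A\<in>Segs (arc_circle X). \<Union>f\<in>F. map_prod f f ` A)\<rparr>"


section \<open>The simplicial and the cyclic category\<close>

definition Delta :: "(nat, nat \<Rightarrow> nat) category" where
  "Delta = \<lparr>Ob = UNIV,
            Hom = \<lambda>n m. {f \<in> {0..n} \<rightarrow>\<^sub>E {0..m}. mono_on {0..n} f},
            Idn = \<lambda>n. (\<lambda>i\<in>{0..n}. i),
            Cmp = \<lambda>n m k g f. compose {0..n} g f\<rparr>"

definition Zarc :: "nat \<Rightarrow> int arch" where
  "Zarc n = \<lparr>acar = UNIV, aord = {(x, y). x \<le> y}, theta = \<lambda>x. x + int n + 1\<rparr>"

text \<open>The full subcategory of archimedean sets on the objects \<open>Zarc n\<close>.\<close>

definition Lambda :: "(nat, (int \<Rightarrow> int) set) category" where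
  "Lambda = \<lparr>Ob = UNIV,
             Hom = \<lambda>n m. arc_hom (Zarc n) (Zarc m),
             Idn = \<lambda>n. Idn Arc (Zarc n),
             Cmp = \<lambda>n m k. Cmp Arc (Zarc n) (Zarc m) (Zarc k)\<rparr>"

definition j_functor :: "(nat, nat \<Rightarrow> nat, nat, (int \<Rightarrow> int) set) cfunctor" where
  "j_functor =
     \<lparr>fobj = \<lambda>n. n,
      fmor = \<lambda>n m f. arc_class (Zarc n) (Zarc m)
        (\<lambda>x. int (f (nat (x mod (int n + 1)))) + (x div (int n + 1)) * (int m + 1))\<rparr>"

definition transpose_map :: "(int \<Rightarrow> int) \<Rightarrow> (int \<Rightarrow> int)" where
  "transpose_map f = (THE g. \<forall>x y. y \<le> f x \<longleftrightarrow> g y \<le> x)"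

definition transpose :: "(int \<Rightarrow> int) set \<Rightarrow> (int \<Rightarrow> int) set" where
  "transpose F = transpose_map ` F"

text \<open>\<open>X \<mapsto> \<P>\<^sub>X\<close>, from archimedean sets to covariant set-valued functors on \<open>Lambda\<close>.\<close>

definition P_functor ::
  "('a arch, ('a \<Rightarrow> 'a) set,
    (nat, (int \<Rightarrow> int) set, (int \<Rightarrow> 'a) set set, (int \<Rightarrow> 'a) set \<Rightarrow> (int \<Rightarrow> 'a) set) cfunctor,
    nat \<Rightarrow> (int \<Rightarrow> 'a) set \<Rightarrow> (int \<Rightarrow> 'a) set) cfunctor" where
  "P_functor =
     \<lparr>fobj = \<lambda>X.
        \<lparr>fobj = \<lambda>n. arc_hom (Zarc n) X,
         fmor = \<lambda>n m f. (\<lambda>u\<in>arc_hom (Zarc n) X. arc_comp (Zarc m) u (transpose f))\<rparr>,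
      fmor = \<lambda>X Y \<phi>. (\<lambda>n\<in>UNIV. \<lambda>u\<in>arc_hom (Zarc n) X. arc_comp (Zarc n) \<phi> u)\<rparr>"


section \<open>Intervals\<close>

record 'i ivl =
  icar :: "'i set"
  iord :: "'i rel"
  ibot :: 'i
  itop :: 'i

definition is_interval :: "'i ivl \<Rightarrow> bool" where
  "is_interval I \<longleftrightarrow> linear_order_on (icar I) (iord I) \<and>
     ibot I \<in> icar I \<and> itop I \<in> icar I \<and> ibot I \<noteq> itop I \<and>
     (\<forall>x\<in>icar I. (ibot I, x) \<in> iord I \<and> (x, itop I) \<in> iord I)"

definition ivl_hom :: "'i ivl \<Rightarrow> 'k ivl \<Rightarrow> ('i \<Rightarrow> 'k) set" where
  "ivl_hom I J = {f \<in> icar I \<rightarrow>\<^sub>E icar J.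
     (\<forall>x\<in>icar I. \<forall>y\<in>icar I. (x, y) \<in> iord I \<longrightarrow> (f x, f y) \<in> iord J) \<and>
     f (ibot I) = ibot J \<and> f (itop I) = itop J}"

definition Intv :: "('i ivl, 'i \<Rightarrow> 'i) category" where
  "Intv = \<lparr>Ob = {I. is_interval I}, Hom = ivl_hom,
           Idn = \<lambda>I. (\<lambda>x\<in>icar I. x), Cmp = \<lambda>I J K g f. compose (icar I) g f\<rparr>"

text \<open>The interval \<open>{0, \<dots>, k}\<close>, for \<open>k > 0\<close>.\<close>

definition fin_ivl :: "nat \<Rightarrow> nat ivl" where
  "fin_ivl k = \<lparr>icar = {0..k}, iord = {(x, y). x \<le> y \<and> y \<le> k}, ibot = 0, itop = k\<rparr>"

definition dual_map :: "nat \<Rightarrow> nat \<Rightarrow> (nat \<Rightarrow> nat) \<Rightarrow> (nat \<Rightarrow> nat)" where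
  "dual_map n m f = (\<lambda>j\<in>{0..m + 1}.
     if \<exists>i\<in>{0..n}. j \<le> f i then Min {i \<in> {0..n}. j \<le> f i} else n + 1)"

text \<open>\<open>I \<mapsto> \<F>\<^sub>I\<close>, from intervals to covariant set-valued functors on \<open>Delta\<close>.\<close>

definition F_functor ::
  "('i ivl, 'i \<Rightarrow> 'i,
    (nat, nat \<Rightarrow> nat, (nat \<Rightarrow> 'i) set, (nat \<Rightarrow> 'i) \<Rightarrow> (nat \<Rightarrow> 'i)) cfunctor,
    nat \<Rightarrow> (nat \<Rightarrow> 'i) \<Rightarrow> (nat \<Rightarrow> 'i)) cfunctor" where
  "F_functor =
     \<lparr>fobj = \<lambda>I.
        \<lparr>fobj = \<lambda>n. ivl_hom (fin_ivl (n + 1)) I,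
         fmor = \<lambda>n m f. (\<lambda>u\<in>ivl_hom (fin_ivl (n + 1)) I. compose {0..m + 1} u (dual_map n m f))\<rparr>,
      fmor = \<lambda>I J \<phi>. (\<lambda>n\<in>UNIV. \<lambda>u\<in>ivl_hom (fin_ivl (n + 1)) I. compose {0..n + 1} \<phi> u)\<rparr>"

definition glue_equiv :: "'i ivl \<Rightarrow> (int \<times> 'i) rel" where
  "glue_equiv I = gen_equiv {((n, itop I), (n + 1, ibot I)) | n. True}"

definition lex_le :: "'i ivl \<Rightarrow> int \<times> 'i \<Rightarrow> int \<times> 'i \<Rightarrow> bool" where
  "lex_le I p q \<longleftrightarrow> fst p < fst q \<or> fst p = fst q \<and> (snd p, snd q) \<in> iord I"

text \<open>The archimedean set \<open>X\<^sub>I\<close>. A class precedes another one if this holds for some of their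
  representatives.\<close>

definition ivl_arch :: "'i ivl \<Rightarrow> (int \<times> 'i) set arch" where
  "ivl_arch I =
     \<lparr>acar = (UNIV \<times> icar I) // glue_equiv I,
      aord = {(A, B). A \<in> (UNIV \<times> icar I) // glue_equiv I \<and> B \<in> (UNIV \<times> icar I) // glue_equiv I \<and>
                (\<exists>p\<in>A. \<exists>q\<in>B. lex_le I p q)},
      theta = \<lambda>A. \<Union>(n, u)\<in>A. glue_equiv I `` {(n + 1, u)}\<rparr>"

definition X_functor ::
  "('i ivl, 'i \<Rightarrow> 'i, (int \<times> 'i) set arch, ((int \<times> 'i) set \<Rightarrow> (int \<times> 'i) set) set) cfunctor" where
  "X_functor =
     \<lparr>fobj = ivl_arch,
      fmor = \<lambda>I J \<phi>. arc_class (ivl_arch I) (ivl_arch J)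
        (\<lambda>A\<in>acar (ivl_arch I). \<Union>(n, u)\<in>A. glue_equiv J `` {(n, \<phi> u)})\<rparr>"


section \<open>Inverse images along points\<close>

text \<open>A point of a topos is identified with its inverse image functor. For the presheaves \<open>R\<close> on
  \<open>Lambda\<close> and the intervals \<open>I\<close>, the following is the functor \<open>(R, I) \<mapsto> (R \<circ> j) \<otimes> \<F>\<^sub>I\<close>: the
  inverse image along the composite of the point \<open>p\<^sub>I\<close> and the geometric morphism of \<open>j\<close>.\<close>

definition composite_point ::
  "((nat, (int \<Rightarrow> int) set, 'r set, 'r \<Rightarrow> 'r) cfunctor \<times> 'i ivl,
    (nat \<Rightarrow> 'r \<Rightarrow> 'r) \<times> ('i \<Rightarrow> 'i),
    (nat \<times> 'r \<times> (nat \<Rightarrow> 'i)) set set,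
    (nat \<times> 'r \<times> (nat \<Rightarrow> 'i)) set \<Rightarrow> (nat \<times> 'r \<times> (nat \<Rightarrow> 'i)) set) cfunctor" where
  "composite_point =
     comp_functor (tensor_functor Delta)
       (prod_functor (restriction_functor Delta j_functor) F_functor)"

text \<open>The functor \<open>(R, X) \<mapsto> R \<otimes> \<P>\<^sub>X\<close>: the inverse image along the point corresponding to \<open>X\<close>.\<close>

definition arc_point ::
  "((nat, (int \<Rightarrow> int) set, 'r set, 'r \<Rightarrow> 'r) cfunctor \<times> 'a arch,
    (nat \<Rightarrow> 'r \<Rightarrow> 'r) \<times> ('a \<Rightarrow> 'a) set,
    (nat \<times> 'r \<times> (int \<Rightarrow> 'a) set) set set,
    (nat \<times> 'r \<times> (int \<Rightarrow> 'a) set) set \<Rightarrow> (nat \<times> 'r \<times> (int \<Rightarrow> 'a) set) set) cfunctor" where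
  "arc_point = comp_functor (tensor_functor Lambda) (prod_functor id_functor P_functor)"

end

theory Submission
  imports Defs
begin

text \<open>(i) A segment of \<open>X/\<theta>\<close> lifts uniquely to \<open>X\<close> once a lift of its initial point is chosen. So, if
  \<open>x\<^sub>0\<close> and \<open>y\<^sub>0\<close> lie over corresponding points, a morphism \<open>X/\<theta> \<rightarrow> Y/\<theta>\<close> lifts uniquely to the
  interval between \<open>x\<^sub>0\<close> and \<open>\<theta>(x\<^sub>0)\<close>, and then equivariantly to \<open>X\<close>. Conversely, in an abstract circle
  the segments \<open>a \<noteq> 1\<close> with initial point \<open>p\<^sub>0\<close> are totally ordered by \<open>a \<le> a \<union> c\<close>, and
  \<open>\<int>\<close> copies of this order, one after the other, form an archimedean set whose circle is the given one.
  As a segment with distinct ends is determined by its ends, a morphism of circles that is bijective on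
  points is an isomorphism.

  (ii) A morphism of intervals \<open>u : {0, \<dots>, n + 1} \<rightarrow> I\<close> extends to an equivariant map \<open>\<int> \<rightarrow> X\<^sub>I\<close>, also
  denoted by \<open>u\<close>. This is a natural map \<open>\<F>\<^sub>I \<rightarrow> \<P>\<close> over \<open>j\<close>, where \<open>\<P>\<close> belongs to \<open>X\<^sub>I\<close>, and it suffices
  that it exhibits \<open>\<P>\<close> as left Kan extension of \<open>\<F>\<^sub>I\<close>: every \<open>v : [r] \<rightarrow> X\<^sub>I\<close> has to be of the form
  \<open>u \<circ> f\<^sup>t\<close>, uniquely up to the relation defining the tensor product. Let \<open>x\<^sub>0\<close> be the class of \<open>(0, b)\<close>.
  Every \<open>k\<close> with \<open>v(k - 1) \<le> x\<^sub>0 \<le> v(k)\<close> yields a standard pair \<open>(f, u)\<close>, where \<open>u\<close> is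
  \<open>v(k), \<dots>, v(k + r)\<close> with both ends of \<open>I\<close> added; every pair is related by one morphism of \<open>\<Delta>\<close>
  to a standard one, and two consecutive standard pairs are both related to a third pair.\<close>


text \<open>The infinity of \<open>'a\<close> is what keeps part (i) inside one type: as
  \<open>'a \<times> 'a\<close> has the size of \<open>'a\<close>, the orbits of points and of pairs
  form a small circle, and conversely \<int> copies of a small set of segments still fit into
  \<open>'a\<close>. The segment 1 at the base point is left out of a copy because it is the first
  element of the next one. In (ii) both functors act through left adjoints, \<open>dual_map\<close>
  for intervals and transposes for \<int>, and the two match because the transpose of j(f), for f
  from [n] to [m], restricts on {0, ..., m + 1} to the dual of f. A standard pair for [r] lives on
  [r + 1]: the r + 1 values of v and the two ends make r + 3 points, which is the interval attached
  to [r + 1]. The number k is determined by v unless v meets x_0; then the admissible k fill an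
  interval of integers, and consecutive ones have to be linked. Moreover v is only given up to
  powers of \<theta>, an ambiguity that is absorbed by the class of f.\<close>

section \<open>Categories and functors\<close>

lemma cat_id: "is_category C \<Longrightarrow> a \<in> Ob C \<Longrightarrow> Idn C a \<in> Hom C a a"
  by (simp add: is_category_def)

lemma cat_comp:
  "is_category C \<Longrightarrow> a \<in> Ob C \<Longrightarrow> b \<in> Ob C \<Longrightarrow> c \<in> Ob C \<Longrightarrow> f \<in> Hom C a b \<Longrightarrow> g \<in> Hom C b c
    \<Longrightarrow> Cmp C a b c g f \<in> Hom C a c"
  by (simp add: is_category_def)

lemma cat_idr:
  "is_category C \<Longrightarrow> a \<in> Ob C \<Longrightarrow> b \<in> Ob C \<Longrightarrow> f \<in> Hom C a b \<Longrightarrow> Cmp C a a b f (Idn C a) = f"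
  by (simp add: is_category_def)

lemma cat_idl:
  "is_category C \<Longrightarrow> a \<in> Ob C \<Longrightarrow> b \<in> Ob C \<Longrightarrow> f \<in> Hom C a b \<Longrightarrow> Cmp C a b b (Idn C b) f = f"
  by (simp add: is_category_def)

lemma cat_assoc:
  "is_category C \<Longrightarrow> a \<in> Ob C \<Longrightarrow> b \<in> Ob C \<Longrightarrow> c \<in> Ob C \<Longrightarrow> d \<in> Ob C
    \<Longrightarrow> f \<in> Hom C a b \<Longrightarrow> g \<in> Hom C b c \<Longrightarrow> h \<in> Hom C c d
    \<Longrightarrow> Cmp C a b d (Cmp C b c d h g) f = Cmp C a c d h (Cmp C a b c g f)"
  by (simp add: is_category_def)

lemma functor_ob: "is_functor C D F \<Longrightarrow> a \<in> Ob C \<Longrightarrow> fobj F a \<in> Ob D"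
  by (simp add: is_functor_def)

lemma functor_mor:
  "is_functor C D F \<Longrightarrow> a \<in> Ob C \<Longrightarrow> b \<in> Ob C \<Longrightarrow> f \<in> Hom C a b
    \<Longrightarrow> fmor F a b f \<in> Hom D (fobj F a) (fobj F b)"
  by (simp add: is_functor_def)

lemma functor_id: "is_functor C D F \<Longrightarrow> a \<in> Ob C \<Longrightarrow> fmor F a a (Idn C a) = Idn D (fobj F a)"
  by (simp add: is_functor_def)

lemma functor_comp:
  "is_functor C D F \<Longrightarrow> a \<in> Ob C \<Longrightarrow> b \<in> Ob C \<Longrightarrow> c \<in> Ob C \<Longrightarrow> f \<in> Hom C a b \<Longrightarrow> g \<in> Hom C b c
    \<Longrightarrow> fmor F a c (Cmp C a b c g f)
        = Cmp D (fobj F a) (fobj F b) (fobj F c) (fmor F b c g) (fmor F a b f)"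
  by (simp add: is_functor_def)

lemma op_cat_simps [simp]:
  "Ob (op_cat C) = Ob C" "Hom (op_cat C) a b = Hom C b a" "Idn (op_cat C) = Idn C"
  "Cmp (op_cat C) a b c g f = Cmp C c b a f g"
  by (simp_all add: op_cat_def)

lemma prod_cat_simps [simp]:
  "Ob (prod_cat C D) = Ob C \<times> Ob D"
  "Hom (prod_cat C D) x y = Hom C (fst x) (fst y) \<times> Hom D (snd x) (snd y)"
  "Idn (prod_cat C D) x = (Idn C (fst x), Idn D (snd x))"
  "Cmp (prod_cat C D) x y z g f =
     (Cmp C (fst x) (fst y) (fst z) (fst g) (fst f), Cmp D (snd x) (snd y) (snd z) (snd g) (snd f))"
  by (simp_all add: prod_cat_def)

lemma set_cat_simps [simp]:
  "Ob set_cat = UNIV" "Hom set_cat A B = A \<rightarrow>\<^sub>E B" "Idn set_cat A = (\<lambda>x\<in>A. x)"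
  "Cmp set_cat A B D g f = compose A g f"
  by (simp_all add: set_cat_def)

lemma functor_cat_simps [simp]:
  "Ob (functor_cat C D) = {F. is_functor C D F}"
  "Hom (functor_cat C D) F G = {\<eta> \<in> extensional (Ob C). nat_trans C D F G \<eta>}"
  "Idn (functor_cat C D) F = (\<lambda>a\<in>Ob C. Idn D (fobj F a))"
  "Cmp (functor_cat C D) F G H \<beta> \<alpha> =
     (\<lambda>a\<in>Ob C. Cmp D (fobj F a) (fobj G a) (fobj H a) (\<beta> a) (\<alpha> a))"
  by (simp_all add: functor_cat_def)

lemma functor_simps [simp]:
  "fobj id_functor a = a" "fmor id_functor a b f = f"
  "fobj (comp_functor G F) a = fobj G (fobj F a)"
  "fmor (comp_functor G F) a b f = fmor G (fobj F a) (fobj F b) (fmor F a b f)"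
  "fobj (op_functor F) a = fobj F a" "fmor (op_functor F) a b f = fmor F b a f"
  by (simp_all add: id_functor_def comp_functor_def op_functor_def)

lemma prod_functor_simps [simp]:
  "fobj (prod_functor F' G') x = (fobj F' (fst x), fobj G' (snd x))"
  "fmor (prod_functor F' G') x y h = (fmor F' (fst x) (fst y) (fst h), fmor G' (snd x) (snd y) (snd h))"
  by (simp_all add: prod_functor_def)

lemma is_category_op: "is_category C \<Longrightarrow> is_category (op_cat C)"
  by (simp add: is_category_def)

lemma is_category_prod: "is_category C \<Longrightarrow> is_category D \<Longrightarrow> is_category (prod_cat C D)"
  by (auto simp: is_category_def)

lemma compose_PiE: "f \<in> A \<rightarrow>\<^sub>E B \<Longrightarrow> g \<in> B \<rightarrow>\<^sub>E D \<Longrightarrow> compose A g f \<in> A \<rightarrow>\<^sub>E D"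
  by (auto simp: compose_def)

lemma compose_id_PiE:
  "f \<in> A \<rightarrow>\<^sub>E B \<Longrightarrow> compose A f (\<lambda>x\<in>A. x) = f" "f \<in> A \<rightarrow>\<^sub>E B \<Longrightarrow> compose A (\<lambda>x\<in>B. x) f = f"
  by (auto simp: compose_def fun_eq_iff PiE_iff extensional_def)

lemma compose_assoc_PiE:
  "f \<in> A \<rightarrow>\<^sub>E B \<Longrightarrow> compose A h (compose A g f) = compose A (compose B h g) f"
  by (auto simp: compose_def fun_eq_iff PiE_iff)

lemma is_category_set_cat: "is_category set_cat"
  unfolding is_category_def
  by (auto simp: compose_id_PiE compose_PiE compose_assoc_PiE simp del: PiE_restrict)

lemma is_functor_id: "is_functor C C id_functor"
  by (simp add: is_functor_def)

lemma is_functor_comp: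
  "is_functor C D F \<Longrightarrow> is_functor D E G \<Longrightarrow> is_functor C E (comp_functor G F)"
  by (simp add: is_functor_def)

lemma is_functor_op: "is_functor C D F \<Longrightarrow> is_functor (op_cat C) (op_cat D) (op_functor F)"
  by (simp add: is_functor_def)

lemma is_functor_prod:
  "is_functor C D F \<Longrightarrow> is_functor C' D' F' \<Longrightarrow>
    is_functor (prod_cat C C') (prod_cat D D') (prod_functor F F')"
  by (auto simp: is_functor_def)

lemma nat_trans_mor: "nat_trans C D F G \<eta> \<Longrightarrow> a \<in> Ob C \<Longrightarrow> \<eta> a \<in> Hom D (fobj F a) (fobj G a)"
  by (simp add: nat_trans_def)

lemma nat_trans_eq:
  "nat_trans C D F G \<eta> \<Longrightarrow> a \<in> Ob C \<Longrightarrow> b \<in> Ob C \<Longrightarrow> f \<in> Hom C a b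
    \<Longrightarrow> Cmp D (fobj F a) (fobj F b) (fobj G b) (\<eta> b) (fmor F a b f)
      = Cmp D (fobj F a) (fobj G a) (fobj G b) (fmor G a b f) (\<eta> a)"
  by (simp add: nat_trans_def)

lemma nat_trans_comp:
  assumes "is_category C" and D: "is_category D" and FGH: "is_functor C D F" "is_functor C D G" "is_functor C D H"
    and \<alpha>: "nat_trans C D F G \<alpha>" and \<beta>: "nat_trans C D G H \<beta>"
  shows "nat_trans C D F H (\<lambda>a\<in>Ob C. Cmp D (fobj F a) (fobj G a) (fobj H a) (\<beta> a) (\<alpha> a))"
  unfolding nat_trans_def
proof (intro conjI ballI)
  fix a assume a: "a \<in> Ob C"
  then show "(\<lambda>a\<in>Ob C. Cmp D (fobj F a) (fobj G a) (fobj H a) (\<beta> a) (\<alpha> a)) a \<in> Hom D (fobj F a) (fobj H a)"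
    using nat_trans_mor[OF \<alpha> a] nat_trans_mor[OF \<beta> a] FGH by (simp add: cat_comp[OF D] functor_ob)
  fix b f assume b: "b \<in> Ob C" and f: "f \<in> Hom C a b"
  note ob = functor_ob[OF FGH(1) a] functor_ob[OF FGH(1) b] functor_ob[OF FGH(2) a]
    functor_ob[OF FGH(2) b] functor_ob[OF FGH(3) a] functor_ob[OF FGH(3) b]
  note mor = functor_mor[OF FGH(1) a b f] functor_mor[OF FGH(2) a b f] functor_mor[OF FGH(3) a b f]
    nat_trans_mor[OF \<alpha> a] nat_trans_mor[OF \<beta> a] nat_trans_mor[OF \<alpha> b] nat_trans_mor[OF \<beta> b]
  have "Cmp D (fobj F a) (fobj F b) (fobj H b) (Cmp D (fobj F b) (fobj G b) (fobj H b) (\<beta> b) (\<alpha> b)) (fmor F a b f)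
      = Cmp D (fobj F a) (fobj G b) (fobj H b) (\<beta> b) (Cmp D (fobj F a) (fobj F b) (fobj G b) (\<alpha> b) (fmor F a b f))"
    using ob mor by (simp add: cat_assoc[OF D])
  also have "\<dots> = Cmp D (fobj F a) (fobj G b) (fobj H b) (\<beta> b) (Cmp D (fobj F a) (fobj G a) (fobj G b) (fmor G a b f) (\<alpha> a))"
    using nat_trans_eq[OF \<alpha> a b f] by simp
  also have "\<dots> = Cmp D (fobj F a) (fobj G a) (fobj H b) (Cmp D (fobj G a) (fobj G b) (fobj H b) (\<beta> b) (fmor G a b f)) (\<alpha> a)"
    using ob mor by (simp add: cat_assoc[OF D])
  also have "\<dots> = Cmp D (fobj F a) (fobj G a) (fobj H b) (Cmp D (fobj G a) (fobj H a) (fobj H b) (fmor H a b f) (\<beta> a)) (\<alpha> a)"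
    using nat_trans_eq[OF \<beta> a b f] by simp
  also have "\<dots> = Cmp D (fobj F a) (fobj H a) (fobj H b) (fmor H a b f) (Cmp D (fobj F a) (fobj G a) (fobj H a) (\<beta> a) (\<alpha> a))"
    using ob mor by (simp add: cat_assoc[OF D])
  finally show "Cmp D (fobj F a) (fobj F b) (fobj H b)
      ((\<lambda>a\<in>Ob C. Cmp D (fobj F a) (fobj G a) (fobj H a) (\<beta> a) (\<alpha> a)) b) (fmor F a b f) =
    Cmp D (fobj F a) (fobj H a) (fobj H b) (fmor H a b f)
      ((\<lambda>a\<in>Ob C. Cmp D (fobj F a) (fobj G a) (fobj H a) (\<beta> a) (\<alpha> a)) a)"
    using a b by simp
qed

lemma nat_trans_id:
  "is_category D \<Longrightarrow> is_functor C D F \<Longrightarrow> nat_trans C D F F (\<lambda>a\<in>Ob C. Idn D (fobj F a))"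
  by (simp add: nat_trans_def functor_ob functor_mor cat_id cat_idl[of D "fobj F _" "fobj F _"]
      cat_idr[of D "fobj F _" "fobj F _"])

lemma is_category_functor_cat:
  assumes C: "is_category C" and D: "is_category D"
  shows "is_category (functor_cat C D)"
proof -
  have 1: "(\<lambda>a\<in>Ob C. Cmp D (fobj F a) (fobj F a) (fobj G a) (\<eta> a) (Idn D (fobj F a))) = \<eta>"
    "(\<lambda>a\<in>Ob C. Cmp D (fobj F a) (fobj G a) (fobj G a) (Idn D (fobj G a)) (\<eta> a)) = \<eta>"
    if "is_functor C D F" "is_functor C D G" "\<eta> \<in> extensional (Ob C)" "nat_trans C D F G \<eta>" for F G \<eta>
    using that D by (auto simp: fun_eq_iff extensional_def functor_ob cat_idl[OF D] cat_idr[OF D] nat_trans_mor)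
  show ?thesis
    unfolding is_category_def[of "functor_cat C D"]
    using C D by (auto simp: nat_trans_id nat_trans_comp 1 functor_ob nat_trans_mor cat_assoc
        intro!: restrict_ext cong: restrict_cong)
qed

section \<open>Equivalences\<close>

text \<open>The quasi-inverse sends d to a chosen object whose image is isomorphic to d, and a
  morphism to the preimage under F of its conjugate. Every law for it is checked after applying F,
  by faithfulness.\<close>

lemma equivalenceI:
  assumes C: "is_category C" and D: "is_category D" and F: "is_functor C D F"
    and faithful: "\<And>a b f g. a \<in> Ob C \<Longrightarrow> b \<in> Ob C \<Longrightarrow> f \<in> Hom C a b \<Longrightarrow> g \<in> Hom C a b
      \<Longrightarrow> fmor F a b f = fmor F a b g \<Longrightarrow> f = g"
    and full: "\<And>a b g. a \<in> Ob C \<Longrightarrow> b \<in> Ob C \<Longrightarrow> g \<in> Hom D (fobj F a) (fobj F b)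
      \<Longrightarrow> \<exists>f\<in>Hom C a b. fmor F a b f = g"
    and ess_surj: "\<And>d. d \<in> Ob D \<Longrightarrow> \<exists>a\<in>Ob C. \<exists>e. is_iso D (fobj F a) d e"
  shows "is_equivalence C D F"
proof -
  have "\<forall>d\<in>Ob D. \<exists>a e e'. a \<in> Ob C \<and> e \<in> Hom D (fobj F a) d \<and> e' \<in> Hom D d (fobj F a) \<and>
      Cmp D (fobj F a) d (fobj F a) e' e = Idn D (fobj F a) \<and> Cmp D d (fobj F a) d e e' = Idn D d"
    using ess_surj unfolding is_iso_def by meson
  then obtain G e e' where G: "\<And>d. d \<in> Ob D \<Longrightarrow> G d \<in> Ob C"
    and e: "\<And>d. d \<in> Ob D \<Longrightarrow> e d \<in> Hom D (fobj F (G d)) d"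
    and e': "\<And>d. d \<in> Ob D \<Longrightarrow> e' d \<in> Hom D d (fobj F (G d))"
    and e'e: "\<And>d. d \<in> Ob D \<Longrightarrow> Cmp D (fobj F (G d)) d (fobj F (G d)) (e' d) (e d) = Idn D (fobj F (G d))"
    and ee': "\<And>d. d \<in> Ob D \<Longrightarrow> Cmp D d (fobj F (G d)) d (e d) (e' d) = Idn D d"
    by metis
  have FG: "fobj F (G d) \<in> Ob D" if "d \<in> Ob D" for d using functor_ob[OF F G[OF that]] .
  have e_e'_cancel: "Cmp D x (fobj F (G d)) d (e d) (Cmp D x d (fobj F (G d)) (e' d) h) = h"
    if "x \<in> Ob D" "d \<in> Ob D" "h \<in> Hom D x d" for x d h
    using that ee'[of d] cat_assoc[OF D that(1,2) FG[OF that(2)] that(2,3) e' e]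
    by (simp add: cat_idl[OF D])
  define lift where "lift a b g = (SOME f. f \<in> Hom C a b \<and> fmor F a b f = g)" for a b g
  have lift: "lift a b g \<in> Hom C a b" "fmor F a b (lift a b g) = g"
    if "a \<in> Ob C" "b \<in> Ob C" "g \<in> Hom D (fobj F a) (fobj F b)" for a b g
    using someI_ex[of "\<lambda>f. f \<in> Hom C a b \<and> fmor F a b f = g"] full[OF that] unfolding lift_def by blast+
  \<comment> \<open>Conjugation of g by the chosen isomorphisms \<open>e d\<close> from F(G d) to
    d.\<close>
  define cg where "cg d d' g = Cmp D (fobj F (G d)) d' (fobj F (G d')) (e' d') (Cmp D (fobj F (G d)) d d' g (e d))"
    for d d' g
  have cg: "cg d d' g \<in> Hom D (fobj F (G d)) (fobj F (G d'))" if "d \<in> Ob D" "d' \<in> Ob D" "g \<in> Hom D d d'" for d d' g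
    using that by (auto simp: cg_def intro!: cat_comp[OF D] FG e e')
  define GG where "GG = \<lparr>fobj = G, fmor = \<lambda>d d' g. lift (G d) (G d') (cg d d' g)\<rparr>"
  have GG_simps [simp]: "fobj GG = G" "fmor GG d d' g = lift (G d) (G d') (cg d d' g)" for d d' g
    by (simp_all add: GG_def)
  have functor_GG: "is_functor D C GG"
    unfolding is_functor_def
  proof (intro conjI ballI)
    fix d assume d: "d \<in> Ob D"
    show "fobj GG d \<in> Ob C" using G d by simp
    show "fmor GG d d (Idn D d) = Idn C (fobj GG d)"
    proof (rule faithful[OF G[OF d] G[OF d]])
      show "fmor F (G d) (G d) (fmor GG d d (Idn D d)) = fmor F (G d) (G d) (Idn C (fobj GG d))"
        using d by (simp add: lift cg cat_id[OF D] functor_id[OF F] G)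
          (simp add: d cg_def cat_idl[OF D FG d e] e'e)
    qed (use d in \<open>auto simp: lift cg G cat_id[OF C] cat_id[OF D]\<close>)
    fix d' assume d': "d' \<in> Ob D"
    { fix g assume g: "g \<in> Hom D d d'"
      show "fmor GG d d' g \<in> Hom C (fobj GG d) (fobj GG d')" using lift cg G g d d' by simp
      fix d'' h assume d'': "d'' \<in> Ob D" and h: "h \<in> Hom D d' d''"
      show "fmor GG d d'' (Cmp D d d' d'' h g) =
          Cmp C (fobj GG d) (fobj GG d') (fobj GG d'') (fmor GG d' d'' h) (fmor GG d d' g)"
      proof (rule faithful[OF G[OF d] G[OF d'']])
        have "cg d d'' (Cmp D d d' d'' h g) = Cmp D (fobj F (G d)) (fobj F (G d')) (fobj F (G d'')) (cg d' d'' h) (cg d d' g)"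
          unfolding cg_def using d d' d'' g h
          by (simp add: cat_assoc[OF D] e e' FG cat_comp[OF D] e_e'_cancel)
        then show "fmor F (G d) (G d'') (fmor GG d d'' (Cmp D d d' d'' h g)) = fmor F (G d) (G d'')
            (Cmp C (fobj GG d) (fobj GG d') (fobj GG d'') (fmor GG d' d'' h) (fmor GG d d' g))"
          using d d' d'' g h by (simp add: cat_comp[OF D] functor_comp[OF F] lift cg G FG)
      qed (use d d' d'' g h in \<open>auto simp: lift cg G cat_comp[OF C] cat_comp[OF D]\<close>) }
  qed
  have nat_FG: "naturally_isomorphic D D (comp_functor F GG) id_functor"
    unfolding naturally_isomorphic_def
  proof (intro conjI exI ballI)
    show "nat_trans D D (comp_functor F GG) id_functor e"
      by (simp add: nat_trans_def e lift cg G) (simp add: cg_def e e_e'_cancel FG cat_comp[OF D])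
    show "is_iso D (fobj (comp_functor F GG) d) (fobj id_functor d) (e d)" if "d \<in> Ob D" for d
      unfolding is_iso_def using that e e' ee' e'e by (simp, blast)
  qed (use functor_GG F is_functor_comp is_functor_id in blast)+
  \<comment> \<open>The other natural isomorphism is lifted from \<open>e\<close> at F a, since F is
    full; its inverse is lifted from \<open>e'\<close>.\<close>
  define k k' where "k a = lift (G (fobj F a)) a (e (fobj F a))"
    and "k' a = lift a (G (fobj F a)) (e' (fobj F a))" for a
  note Fob = functor_ob[OF F]
  have k: "k a \<in> Hom C (G (fobj F a)) a" "fmor F (G (fobj F a)) a (k a) = e (fobj F a)"
    "k' a \<in> Hom C a (G (fobj F a))" "fmor F a (G (fobj F a)) (k' a) = e' (fobj F a)" if "a \<in> Ob C" for a
    using that by (auto simp: k_def k'_def lift G Fob e e')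
  have nat_GF: "naturally_isomorphic C C (comp_functor GG F) id_functor"
    unfolding naturally_isomorphic_def
  proof (intro conjI exI ballI)
    show "nat_trans C C (comp_functor GG F) id_functor k"
      unfolding nat_trans_def
    proof (intro conjI ballI)
      fix a assume a: "a \<in> Ob C"
      show "k a \<in> Hom C (fobj (comp_functor GG F) a) (fobj id_functor a)" using k a by simp
      fix b f assume b: "b \<in> Ob C" and f: "f \<in> Hom C a b"
      have "fmor F (G (fobj F a)) b (Cmp C (G (fobj F a)) (G (fobj F b)) b (k b) (fmor GG (fobj F a) (fobj F b) (fmor F a b f)))
        = fmor F (G (fobj F a)) b (Cmp C (G (fobj F a)) a b f (k a))"
        using a b f by (simp add: functor_comp[OF F] k lift G Fob cg functor_mor[OF F])
          (simp add: cg_def e_e'_cancel cat_comp[OF D] functor_mor[OF F] Fob FG e)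
      then show "Cmp C (fobj (comp_functor GG F) a) (fobj (comp_functor GG F) b) (fobj id_functor b) (k b) (fmor (comp_functor GG F) a b f) =
          Cmp C (fobj (comp_functor GG F) a) (fobj id_functor a) (fobj id_functor b) (fmor id_functor a b f) (k a)"
        using a b f
        by (auto intro!: faithful[of "G (fobj F a)" b] cat_comp[OF C] simp: k G Fob lift cg functor_mor[OF F])
    qed
    fix a assume a: "a \<in> Ob C"
    have "Cmp C (G (fobj F a)) a (G (fobj F a)) (k' a) (k a) = Idn C (G (fobj F a))"
      by (rule faithful[of "G (fobj F a)" "G (fobj F a)"])
        (use a in \<open>auto simp: k G Fob cat_comp[OF C] cat_id[OF C] functor_comp[OF F] functor_id[OF F] e'e\<close>)
    moreover have "Cmp C a (G (fobj F a)) a (k a) (k' a) = Idn C a"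
      by (rule faithful[of a a])
        (use a in \<open>auto simp: k G Fob cat_comp[OF C] cat_id[OF C] functor_comp[OF F] functor_id[OF F] ee'\<close>)
    ultimately show "is_iso C (fobj (comp_functor GG F) a) (fobj id_functor a) (k a)"
      unfolding is_iso_def using k[OF a] by auto
  qed (use functor_GG F is_functor_comp is_functor_id in blast)+
  show ?thesis
    unfolding is_equivalence_def using C D F functor_GG nat_FG nat_GF by blast
qed

section \<open>Set-valued functors\<close>

lemma set_functor_app:
  "is_functor C set_cat F \<Longrightarrow> a \<in> Ob C \<Longrightarrow> b \<in> Ob C \<Longrightarrow> f \<in> Hom C a b \<Longrightarrow> x \<in> fobj F a
    \<Longrightarrow> fmor F a b f x \<in> fobj F b"
  using functor_mor[of C set_cat F a b f] by auto

lemma set_functor_id: "is_functor C set_cat F \<Longrightarrow> a \<in> Ob C \<Longrightarrow> x \<in> fobj F a \<Longrightarrow> fmor F a a (Idn C a) x = x"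
  using functor_id[of C set_cat F a] by simp

lemma set_functor_comp:
  "is_functor C set_cat F \<Longrightarrow> a \<in> Ob C \<Longrightarrow> b \<in> Ob C \<Longrightarrow> c \<in> Ob C \<Longrightarrow> f \<in> Hom C a b \<Longrightarrow> g \<in> Hom C b c
    \<Longrightarrow> x \<in> fobj F a \<Longrightarrow> fmor F a c (Cmp C a b c g f) x = fmor F b c g (fmor F a b f x)"
  using functor_comp[of C set_cat F a b c f g] by (simp add: compose_def)

text \<open>Only elementwise laws remain to be checked: arrows of \<open>set_cat\<close> are
  extensional functions, so agreement on the domain is equality.\<close>

lemma set_functorI:
  assumes "\<And>a b f. a \<in> Ob C \<Longrightarrow> b \<in> Ob C \<Longrightarrow> f \<in> Hom C a b \<Longrightarrow> fmor F a b f \<in> fobj F a \<rightarrow>\<^sub>E fobj F b"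
    and "\<And>a x. a \<in> Ob C \<Longrightarrow> x \<in> fobj F a \<Longrightarrow> fmor F a a (Idn C a) x = x"
    and "\<And>a b c f g x. a \<in> Ob C \<Longrightarrow> b \<in> Ob C \<Longrightarrow> c \<in> Ob C \<Longrightarrow> f \<in> Hom C a b \<Longrightarrow> g \<in> Hom C b c
      \<Longrightarrow> x \<in> fobj F a \<Longrightarrow> fmor F a c (Cmp C a b c g f) x = fmor F b c g (fmor F a b f x)"
    and C: "is_category C"
  shows "is_functor C set_cat F"
  unfolding is_functor_def
proof (intro conjI ballI)
  fix a assume a: "a \<in> Ob C"
  show "fmor F a a (Idn C a) = Idn set_cat (fobj F a)"
    using assms(1)[OF a a cat_id[OF C a]] assms(2)[OF a] by (auto simp: fun_eq_iff PiE_iff extensional_def)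
  fix b c f g assume b: "b \<in> Ob C" and c: "c \<in> Ob C" and f: "f \<in> Hom C a b" and g: "g \<in> Hom C b c"
  show "fmor F a c (Cmp C a b c g f) = Cmp set_cat (fobj F a) (fobj F b) (fobj F c) (fmor F b c g) (fmor F a b f)"
    using assms(1)[OF a c cat_comp[OF C a b c f g]] assms(3)[OF a b c f g]
    by (auto simp: fun_eq_iff PiE_iff extensional_def compose_def)
qed (use assms(1) in auto)

lemma nat_trans_app:
  "nat_trans C set_cat F G \<eta> \<Longrightarrow> a \<in> Ob C \<Longrightarrow> x \<in> fobj F a \<Longrightarrow> \<eta> a x \<in> fobj G a"
  using nat_trans_mor[of C set_cat F G \<eta> a] by auto

lemma nat_trans_natural:
  "nat_trans C set_cat F G \<eta> \<Longrightarrow> a \<in> Ob C \<Longrightarrow> b \<in> Ob C \<Longrightarrow> f \<in> Hom C a b \<Longrightarrow> x \<in> fobj F a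
    \<Longrightarrow> \<eta> b (fmor F a b f x) = fmor G a b f (\<eta> a x)"
  using fun_cong[OF nat_trans_eq[of C set_cat F G \<eta> a b f], of x] by (simp add: compose_def)

lemma nat_trans_set_catI:
  assumes "\<And>a. a \<in> Ob C \<Longrightarrow> \<eta> a \<in> fobj F a \<rightarrow>\<^sub>E fobj G a"
    and "\<And>a b f x. a \<in> Ob C \<Longrightarrow> b \<in> Ob C \<Longrightarrow> f \<in> Hom C a b \<Longrightarrow> x \<in> fobj F a
      \<Longrightarrow> \<eta> b (fmor F a b f x) = fmor G a b f (\<eta> a x)"
  shows "nat_trans C set_cat F G \<eta>"
  using assms by (auto simp: nat_trans_def compose_def intro!: restrict_ext)

lemma yoneda_simps [simp]:
  "fobj (fobj (yoneda C) c) a = Hom C a c"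
  "fmor (fobj (yoneda C) c) a b f = (\<lambda>h\<in>Hom C a c. Cmp C b a c h f)"
  "fmor (yoneda C) c d g = (\<lambda>a\<in>Ob C. \<lambda>h\<in>Hom C a c. Cmp C a c d g h)"
  by (simp_all add: yoneda_def)

lemma is_functor_yoneda_obj:
  assumes C: "is_category C" and c: "c \<in> Ob C"
  shows "is_functor (op_cat C) set_cat (fobj (yoneda C) c)"
  using c by (intro set_functorI is_category_op C) (auto simp: cat_comp[OF C] cat_idr[OF C] cat_assoc[OF C])

lemma is_functor_yoneda:
  assumes C: "is_category C"
  shows "is_functor C (psh C) (yoneda C)"
  unfolding is_functor_def
proof (intro conjI ballI)
  fix a assume a: "a \<in> Ob C"
  then show "fobj (yoneda C) a \<in> Ob (psh C)" by (simp add: is_functor_yoneda_obj C)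
  show "fmor (yoneda C) a a (Idn C a) = Idn (psh C) (fobj (yoneda C) a)"
    using a by (auto simp: cat_idl[OF C] intro!: restrict_ext)
  fix b f assume b: "b \<in> Ob C" and f: "f \<in> Hom C a b"
  show "fmor (yoneda C) a b f \<in> Hom (psh C) (fobj (yoneda C) a) (fobj (yoneda C) b)"
    using a b f by (auto intro!: nat_trans_set_catI simp: cat_comp[OF C] cat_assoc[OF C])
  fix c g assume c: "c \<in> Ob C" and g: "g \<in> Hom C b c"
  show "fmor (yoneda C) a c (Cmp C a b c g f) = Cmp (psh C) (fobj (yoneda C) a) (fobj (yoneda C) b)
      (fobj (yoneda C) c) (fmor (yoneda C) b c g) (fmor (yoneda C) a b f)"
    using a b f c g by (auto simp: compose_def cat_comp[OF C] cat_assoc[OF C] intro!: restrict_ext)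
qed

lemma restriction_simps [simp]:
  "fobj (restriction_functor E H) R = comp_functor R (op_functor H)"
  "fmor (restriction_functor E H) R R' \<alpha> = (\<lambda>e\<in>Ob E. \<alpha> (fobj H e))"
  by (simp_all add: restriction_functor_def)

lemma is_functor_restriction:
  assumes H: "is_functor E C H"
  shows "is_functor (psh C) (psh E) (restriction_functor E H)"
  unfolding is_functor_def
proof (intro conjI ballI)
  fix R assume R: "R \<in> Ob (psh C)"
  then show "fobj (restriction_functor E H) R \<in> Ob (psh E)"
    using is_functor_comp[OF is_functor_op[OF H]] by simp
  show "fmor (restriction_functor E H) R R (Idn (psh C) R) = Idn (psh E) (fobj (restriction_functor E H) R)"
    using functor_ob[OF H] by (auto intro!: restrict_ext)
  fix R' \<alpha> assume \<alpha>: "\<alpha> \<in> Hom (psh C) R R'"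
  then have nt: "nat_trans (op_cat C) set_cat R R' \<alpha>" by simp
  show "fmor (restriction_functor E H) R R' \<alpha> \<in>
      Hom (psh E) (fobj (restriction_functor E H) R) (fobj (restriction_functor E H) R')"
    using nat_trans_mor[OF nt] nat_trans_natural[OF nt] functor_ob[OF H] functor_mor[OF H]
    by (simp, intro nat_trans_set_catI) simp_all
  fix R'' \<beta> assume "\<beta> \<in> Hom (psh C) R' R''"
  show "fmor (restriction_functor E H) R R'' (Cmp (psh C) R R' R'' \<beta> \<alpha>) =
      Cmp (psh E) (fobj (restriction_functor E H) R) (fobj (restriction_functor E H) R')
        (fobj (restriction_functor E H) R'') (fmor (restriction_functor E H) R' R'' \<beta>)
        (fmor (restriction_functor E H) R R' \<alpha>)"
    using functor_ob[OF H] by (auto intro!: restrict_ext)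
qed

lemma uncurry_simps [simp]:
  "fobj (uncurry_functor K) x = fobj (fobj K (snd x)) (fst x)"
  "fmor (uncurry_functor K) x y h = compose (fobj (fobj K (snd x)) (fst x))
     (fmor (fobj K (snd y)) (fst x) (fst y) (fst h)) (fmor K (snd x) (snd y) (snd h) (fst x))"
  by (simp_all add: uncurry_functor_def split_beta)

lemma is_functor_uncurry:
  assumes C: "is_category C" and D: "is_category D" and K: "is_functor D (copsh C) K"
  shows "is_functor (prod_cat C D) set_cat (uncurry_functor K)"
proof (rule set_functorI)
  have Kd: "is_functor C set_cat (fobj K d)" if "d \<in> Ob D" for d
    using functor_ob[OF K that] by simp
  have Kg: "nat_trans C set_cat (fobj K d) (fobj K d') (fmor K d d' g)"
    if "d \<in> Ob D" "d' \<in> Ob D" "g \<in> Hom D d d'" for d d' g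
    using functor_mor[OF K that] by simp
  show "is_category (prod_cat C D)" using C D by (rule is_category_prod)
  show "fmor (uncurry_functor K) a b f \<in> fobj (uncurry_functor K) a \<rightarrow>\<^sub>E fobj (uncurry_functor K) b"
    if "a \<in> Ob (prod_cat C D)" "b \<in> Ob (prod_cat C D)" "f \<in> Hom (prod_cat C D) a b" for a b f
    using that by (auto simp: compose_def intro!: set_functor_app[OF Kd] nat_trans_app[OF Kg])
  show "fmor (uncurry_functor K) a a (Idn (prod_cat C D) a) x = x"
    if "a \<in> Ob (prod_cat C D)" "x \<in> fobj (uncurry_functor K) a" for a x
    using that functor_id[OF K, of "snd a"] by (auto simp: compose_def set_functor_id[OF Kd])
  fix a b c f g x
  assume *: "a \<in> Ob (prod_cat C D)" "b \<in> Ob (prod_cat C D)" "c \<in> Ob (prod_cat C D)"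
    "f \<in> Hom (prod_cat C D) a b" "g \<in> Hom (prod_cat C D) b c" "x \<in> fobj (uncurry_functor K) a"
  obtain a1 a2 b1 b2 c1 c2 f1 f2 g1 g2 where
    eq: "a = (a1, a2)" "b = (b1, b2)" "c = (c1, c2)" "f = (f1, f2)" "g = (g1, g2)"
    by (metis surj_pair)
  note * = *[unfolded eq, simplified]
  \<comment> \<open>Functoriality in the second variable. Naturality of the transformations
    \<open>fmor K\<close> then lets them pass the action of C, which is the interchange law.\<close>
  have "fmor K a2 c2 (Cmp D a2 b2 c2 g2 f2) a1 x = fmor K b2 c2 g2 a1 (fmor K a2 b2 f2 a1 x)"
    using * by (simp add: functor_comp[OF K] compose_def)
  then show "fmor (uncurry_functor K) a c (Cmp (prod_cat C D) a b c g f) x =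
      fmor (uncurry_functor K) b c g (fmor (uncurry_functor K) a b f x)"
    using * unfolding eq
    by (simp add: compose_def set_functor_app[OF Kd] nat_trans_app[OF Kg] set_functor_comp[OF Kd]
        nat_trans_natural[OF Kg])
qed

section \<open>Tensor products\<close>

lemma equiv_gen_equiv: "equiv UNIV (gen_equiv g)"
proof (rule equivI)
  have "sym (g \<union> g\<inverse>)" by (auto simp: sym_def)
  then show "sym (gen_equiv g)" by (simp add: gen_equiv_def sym_rtrancl)
qed (auto simp: gen_equiv_def refl_rtrancl trans_rtrancl)

lemma gen_equiv_respects:
  assumes "(x, y) \<in> gen_equiv g" and "\<And>x y. (x, y) \<in> g \<Longrightarrow> \<phi> x = \<phi> y"
  shows "\<phi> x = \<phi> y"
  using assms(1) unfolding gen_equiv_def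
  by (induction rule: rtrancl_induct) (use assms(2) in auto)

lemma gen_equivI: "(x, y) \<in> g \<Longrightarrow> (x, y) \<in> gen_equiv g"
  by (auto simp: gen_equiv_def)

text \<open>Classes of all triples of the type, not only of those in the disjoint union: the
  generated relation is reflexive everywhere, so equality of two classes means relatedness without
  side conditions.\<close>

definition tensor_class ::
  "('o, 'm) category \<Rightarrow> ('o, 'm, 'r set, 'r \<Rightarrow> 'r) cfunctor \<Rightarrow>
   ('o, 'm, 'x set, 'x \<Rightarrow> 'x) cfunctor \<Rightarrow> 'o \<times> 'r \<times> 'x \<Rightarrow> ('o \<times> 'r \<times> 'x) set" where
  "tensor_class C R F t = tensor_equiv C R F `` {t}"

lemma tensor_class_eq_iff:
  "tensor_class C R F t = tensor_class C R F t' \<longleftrightarrow> (t, t') \<in> tensor_equiv C R F"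
  unfolding tensor_class_def tensor_equiv_def
  by (rule eq_equiv_class_iff[OF equiv_gen_equiv UNIV_I UNIV_I])

lemma tensor_class_self: "t \<in> tensor_class C R F t"
  unfolding tensor_class_def tensor_equiv_def by (simp add: gen_equiv_def)

lemma tensor_class_in:
  "c \<in> Ob C \<Longrightarrow> r \<in> fobj R c \<Longrightarrow> x \<in> fobj F c \<Longrightarrow> tensor_class C R F (c, r, x) \<in> tensor C R F"
  unfolding tensor_class_def tensor_def by (intro quotientI) auto

lemma tensorE:
  assumes "A \<in> tensor C R F"
  obtains c r x where "c \<in> Ob C" "r \<in> fobj R c" "x \<in> fobj F c" "A = tensor_class C R F (c, r, x)"
  using assms unfolding tensor_class_def tensor_def by (auto elim!: quotientE)

lemma tensor_class_move:
  assumes "c \<in> Ob C" "c' \<in> Ob C" "f \<in> Hom C c c'" "r' \<in> fobj R c'" "x \<in> fobj F c"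
  shows "tensor_class C R F (c, fmor R c' c f r', x) = tensor_class C R F (c', r', fmor F c c' f x)"
  unfolding tensor_class_eq_iff tensor_equiv_def using assms by (blast intro: gen_equivI)

text \<open>Well-definedness of maps out of a tensor product, by induction along a zigzag of
  generators.\<close>

lemma tensor_class_respects:
  assumes "t \<in> tensor_class C R F (c, r, x)"
    and "\<And>c c' f r' x. c \<in> Ob C \<Longrightarrow> c' \<in> Ob C \<Longrightarrow> f \<in> Hom C c c' \<Longrightarrow> r' \<in> fobj R c' \<Longrightarrow> x \<in> fobj F c
      \<Longrightarrow> \<phi> (c, fmor R c' c f r', x) = \<phi> (c', r', fmor F c c' f x)"
  shows "\<phi> t = \<phi> (c, r, x)"
proof -
  have "((c, r, x), t) \<in> tensor_equiv C R F" using assms(1) by (simp add: tensor_class_def)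
  then have "\<phi> (c, r, x) = \<phi> t"
    unfolding tensor_equiv_def by (rule gen_equiv_respects) (use assms(2) in auto)
  then show ?thesis ..
qed

lemma UN_tensor_class:
  assumes "\<And>c c' f r' x. c \<in> Ob C \<Longrightarrow> c' \<in> Ob C \<Longrightarrow> f \<in> Hom C c c' \<Longrightarrow> r' \<in> fobj R c' \<Longrightarrow> x \<in> fobj F c
      \<Longrightarrow> \<phi> (c, fmor R c' c f r', x) = \<phi> (c', r', fmor F c c' f x)"
  shows "(\<Union>t\<in>tensor_class C R F (c, r, x). \<phi> t) = \<phi> (c, r, x)"
  using tensor_class_respects[where \<phi> = \<phi>, OF _ assms] tensor_class_self[of "(c, r, x)" C R F] by blast

text \<open>Variant of the preceding evaluation for functions whose values need not be sets, where a
  union over the class makes no sense.\<close>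

lemma the_elem_tensor_class:
  assumes "\<And>c c' f r' x. c \<in> Ob C \<Longrightarrow> c' \<in> Ob C \<Longrightarrow> f \<in> Hom C c c' \<Longrightarrow> r' \<in> fobj R c' \<Longrightarrow> x \<in> fobj F c
      \<Longrightarrow> \<phi> (c, fmor R c' c f r', x) = \<phi> (c', r', fmor F c c' f x)"
  shows "the_elem (\<phi> ` tensor_class C R F (c, r, x)) = \<phi> (c, r, x)"
proof -
  have "\<phi> ` tensor_class C R F (c, r, x) = {\<phi> (c, r, x)}"
    using tensor_class_respects[where \<phi> = \<phi>, OF _ assms] tensor_class_self[of "(c, r, x)" C R F] by blast
  then show ?thesis by simp
qed

lemma tensor_map_class:
  assumes \<alpha>: "nat_trans (op_cat C) set_cat R R' \<alpha>" and \<beta>: "nat_trans C set_cat F F' \<beta>"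
    and crx: "c \<in> Ob C" "r \<in> fobj R c" "x \<in> fobj F c"
  shows "tensor_map C R F R' F' \<alpha> \<beta> (tensor_class C R F (c, r, x)) = tensor_class C R' F' (c, \<alpha> c r, \<beta> c x)"
proof -
  have "(\<Union>t\<in>tensor_class C R F (c, r, x). (\<lambda>(c, r, x). tensor_class C R' F' (c, \<alpha> c r, \<beta> c x)) t)
      = tensor_class C R' F' (c, \<alpha> c r, \<beta> c x)"
  proof (subst UN_tensor_class, goal_cases)
    \<comment> \<open>Naturality of both transformations turns the image of a generator into a
      generator.\<close>
    case (1 c c' f r' x)
    then show ?case
      using nat_trans_natural[OF \<alpha>, of c' c f r'] nat_trans_natural[OF \<beta>, of c c' f x]
      by (simp add: tensor_class_move nat_trans_app[OF \<alpha>] nat_trans_app[OF \<beta>])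
  qed simp
  then show ?thesis
    unfolding tensor_map_def using tensor_class_in[OF crx] by (simp add: split_beta tensor_class_def)
qed

lemma tensor_functor_simps [simp]:
  "fobj (tensor_functor C) x = tensor C (fst x) (snd x)"
  "fmor (tensor_functor C) x y h = tensor_map C (fst x) (snd x) (fst y) (snd y) (fst h) (snd h)"
  by (simp_all add: tensor_functor_def split_beta)

lemma is_functor_tensor:
  assumes C: "is_category C"
  shows "is_functor (prod_cat (psh C) (copsh C)) set_cat (tensor_functor C)"
proof (rule set_functorI)
  show "is_category (prod_cat (psh C) (copsh C))"
    by (intro is_category_prod is_category_functor_cat is_category_set_cat is_category_op C)
  show "fmor (tensor_functor C) a b f \<in> fobj (tensor_functor C) a \<rightarrow>\<^sub>E fobj (tensor_functor C) b"
    if "a \<in> Ob (prod_cat (psh C) (copsh C))" "b \<in> Ob (prod_cat (psh C) (copsh C))"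
      "f \<in> Hom (prod_cat (psh C) (copsh C)) a b" for a b f
  proof (rule PiE_I)
    show "fmor (tensor_functor C) a b f A \<in> fobj (tensor_functor C) b" if "A \<in> fobj (tensor_functor C) a" for A
      using that \<open>f \<in> _\<close>
      by (auto elim!: tensorE simp: tensor_map_class intro!: tensor_class_in)
        (auto intro: nat_trans_app[of "op_cat C", simplified] nat_trans_app)
  qed (simp add: tensor_map_def)
  show "fmor (tensor_functor C) a a (Idn (prod_cat (psh C) (copsh C)) a) A = A"
    if "a \<in> Ob (prod_cat (psh C) (copsh C))" "A \<in> fobj (tensor_functor C) a" for a A
  proof -
    have "nat_trans (op_cat C) set_cat (fst a) (fst a) (\<lambda>c\<in>Ob C. \<lambda>x\<in>fobj (fst a) c. x)"
      "nat_trans C set_cat (snd a) (snd a) (\<lambda>c\<in>Ob C. \<lambda>x\<in>fobj (snd a) c. x)"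
      using that nat_trans_id[OF is_category_set_cat, of "op_cat C" "fst a"] nat_trans_id[OF is_category_set_cat, of C "snd a"]
      by auto
    then show ?thesis using that by (auto elim!: tensorE simp: tensor_map_class)
  qed
  fix a b c f g A
  assume *: "a \<in> Ob (prod_cat (psh C) (copsh C))" "b \<in> Ob (prod_cat (psh C) (copsh C))"
    "c \<in> Ob (prod_cat (psh C) (copsh C))" "f \<in> Hom (prod_cat (psh C) (copsh C)) a b"
    "g \<in> Hom (prod_cat (psh C) (copsh C)) b c" "A \<in> fobj (tensor_functor C) a"
  obtain a1 a2 b1 b2 c1 c2 f1 f2 g1 g2 where
    eq: "a = (a1, a2)" "b = (b1, b2)" "c = (c1, c2)" "f = (f1, f2)" "g = (g1, g2)"
    by (metis surj_pair)
  note * = *[unfolded eq, simplified]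
  have 1: "nat_trans (op_cat C) set_cat a1 c1 (\<lambda>e\<in>Ob C. compose (fobj a1 e) (g1 e) (f1 e))"
    "nat_trans C set_cat a2 c2 (\<lambda>e\<in>Ob C. compose (fobj a2 e) (g2 e) (f2 e))"
    using * nat_trans_comp[OF is_category_op[OF C] is_category_set_cat, of a1 b1 c1 f1 g1]
      nat_trans_comp[OF C is_category_set_cat, of a2 b2 c2 f2 g2] by auto
  obtain e r x where erx: "e \<in> Ob C" "r \<in> fobj a1 e" "x \<in> fobj a2 e" "A = tensor_class C a1 a2 (e, r, x)"
    using * by (auto elim: tensorE)
  have "f1 e r \<in> fobj b1 e" "f2 e x \<in> fobj b2 e"
    using * erx nat_trans_app[of "op_cat C" a1 b1 f1 e r] nat_trans_app[of C a2 b2 f2 e x] by auto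
  then show "fmor (tensor_functor C) a c (Cmp (prod_cat (psh C) (copsh C)) a b c g f) A =
      fmor (tensor_functor C) b c g (fmor (tensor_functor C) a b f A)"
    using * 1 erx unfolding eq by (simp add: tensor_map_class compose_def)
qed


text \<open>If every \<open>P(c)\<close> is the tensor product \<open>Hom(J -, c) \<otimes>\<^sub>E F\<close>, then \<open>P\<close> is the left Kan extension
  of \<open>F\<close> along \<open>J\<close>, and hence \<open>(R \<circ> J) \<otimes>\<^sub>E F\<close> is \<open>R \<otimes>\<^sub>C P\<close> for all presheaves \<open>R\<close>.\<close>

locale tensor_extension =
  fixes E :: "('e, 'k) category" and C :: "('o, 'm) category" and J :: "('e, 'k, 'o, 'm) cfunctor"
    and F :: "('e, 'k, 'x set, 'x \<Rightarrow> 'x) cfunctor" and P :: "('o, 'm, 'y set, 'y \<Rightarrow> 'y) cfunctor"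
    and \<eta> :: "'e \<Rightarrow> 'x \<Rightarrow> 'y"
  assumes E: "is_category E" and C: "is_category C" and J: "is_functor E C J"
    and F: "is_functor E set_cat F" and P: "is_functor C set_cat P"
    and \<eta>_app: "e \<in> Ob E \<Longrightarrow> u \<in> fobj F e \<Longrightarrow> \<eta> e u \<in> fobj P (fobj J e)"
    and \<eta>_natural: "e \<in> Ob E \<Longrightarrow> e' \<in> Ob E \<Longrightarrow> h \<in> Hom E e e' \<Longrightarrow> u \<in> fobj F e
      \<Longrightarrow> \<eta> e' (fmor F e e' h u) = fmor P (fobj J e) (fobj J e') (fmor J e e' h) (\<eta> e u)"
    and surj: "c \<in> Ob C \<Longrightarrow> v \<in> fobj P c
      \<Longrightarrow> \<exists>e\<in>Ob E. \<exists>f\<in>Hom C (fobj J e) c. \<exists>u\<in>fobj F e. v = fmor P (fobj J e) c f (\<eta> e u)"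
    and inj: "c \<in> Ob C \<Longrightarrow> e \<in> Ob E \<Longrightarrow> e' \<in> Ob E
      \<Longrightarrow> f \<in> Hom C (fobj J e) c \<Longrightarrow> f' \<in> Hom C (fobj J e') c \<Longrightarrow> u \<in> fobj F e \<Longrightarrow> u' \<in> fobj F e'
      \<Longrightarrow> fmor P (fobj J e) c f (\<eta> e u) = fmor P (fobj J e') c f' (\<eta> e' u')
      \<Longrightarrow> tensor_class E (comp_functor (fobj (yoneda C) c) (op_functor J)) F (e, f, u)
        = tensor_class E (comp_functor (fobj (yoneda C) c) (op_functor J)) F (e', f', u')"
begin

abbreviation Ecls where "Ecls R \<equiv> tensor_class E (comp_functor R (op_functor J)) F"

lemma Jmor: "e \<in> Ob E \<Longrightarrow> e' \<in> Ob E \<Longrightarrow> h \<in> Hom E e e' \<Longrightarrow> fmor J e e' h \<in> Hom C (fobj J e) (fobj J e')"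
  by (rule functor_mor[OF J])

lemma Job: "e \<in> Ob E \<Longrightarrow> fobj J e \<in> Ob C"
  by (rule functor_ob[OF J])

lemma Ecls_move:
  assumes "e \<in> Ob E" "e' \<in> Ob E" "h \<in> Hom E e e'" "r \<in> fobj R (fobj J e')" "u \<in> fobj F e"
  shows "Ecls R (e, fmor R (fobj J e') (fobj J e) (fmor J e e' h) r, u) = Ecls R (e', r, fmor F e e' h u)"
  using tensor_class_move[of e E e' h r "comp_functor R (op_functor J)" u F] assms by simp

definition extend :: "('o, 'm, 'r set, 'r \<Rightarrow> 'r) cfunctor \<Rightarrow> ('e \<times> 'r \<times> 'x) set \<Rightarrow> ('o \<times> 'r \<times> 'y) set" where
  "extend R A = (\<Union>(e, r, u)\<in>A. tensor_class C R P (fobj J e, r, \<eta> e u))"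

lemma extend_class: "extend R (Ecls R (e, r, u)) = tensor_class C R P (fobj J e, r, \<eta> e u)"
proof -
  have "(\<Union>t\<in>Ecls R (e, r, u). (\<lambda>(e, r, u). tensor_class C R P (fobj J e, r, \<eta> e u)) t)
      = tensor_class C R P (fobj J e, r, \<eta> e u)"
  proof (subst UN_tensor_class, goal_cases)
    case (1 e e' h r u)
    then show ?case by (simp add: \<eta>_natural tensor_class_move Jmor Job \<eta>_app)
  qed simp
  then show ?thesis unfolding extend_def by simp
qed

text \<open>By the Yoneda lemma, an element r of R(c) is a map from the representable presheaf of c
  to R. It induces a map from the tensor product of that representable with F, and by
  \<open>inj\<close> the value of this map depends only on the element of P(c) that is
  presented.\<close>

lemma Ecls_pull:
  assumes R: "is_functor (op_cat C) set_cat R" and c: "c \<in> Ob C" and r: "r \<in> fobj R c"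
    and *: "e \<in> Ob E" "f \<in> Hom C (fobj J e) c" "u \<in> fobj F e"
      "e' \<in> Ob E" "f' \<in> Hom C (fobj J e') c" "u' \<in> fobj F e'"
    and eq: "fmor P (fobj J e) c f (\<eta> e u) = fmor P (fobj J e') c f' (\<eta> e' u')"
  shows "Ecls R (e, fmor R c (fobj J e) f r, u) = Ecls R (e', fmor R c (fobj J e') f' r, u')"
proof -
  let ?\<phi> = "\<lambda>(e, f, u). Ecls R (e, fmor R c (fobj J e) f r, u)"
  have "?\<phi> (e, f, u) = ?\<phi> (e', f', u')"
  proof (rule tensor_class_respects[where \<phi> = ?\<phi> and C = E and F = F])
    show "(e, f, u) \<in> Ecls (fobj (yoneda C) c) (e', f', u')"
      using inj[OF c *(1,4,2,5,3,6) eq] tensor_class_self by blast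
    fix e e' h f' u assume 1: "e \<in> Ob E" "e' \<in> Ob E" "h \<in> Hom E e e'"
      "f' \<in> fobj (comp_functor (fobj (yoneda C) c) (op_functor J)) e'" "u \<in> fobj F e"
    then have "fmor R c (fobj J e) (Cmp C (fobj J e) (fobj J e') c f' (fmor J e e' h)) r
        = fmor R (fobj J e') (fobj J e) (fmor J e e' h) (fmor R c (fobj J e') f' r)"
      using set_functor_comp[OF R, of c "fobj J e'" "fobj J e" f' "fmor J e e' h" r] c r Jmor Job by simp
    moreover have "fmor R c (fobj J e') f' r \<in> fobj R (fobj J e')"
      using set_functor_app[OF R, of c "fobj J e'" f' r] 1 c r Job by simp
    ultimately show "?\<phi> (e, fmor (comp_functor (fobj (yoneda C) c) (op_functor J)) e' e h f', u)
        = ?\<phi> (e', f', fmor F e e' h u)"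
      using 1 by (simp add: Ecls_move)
  qed
  then show ?thesis by simp
qed

text \<open>For surjectivity, \<open>surj\<close> presents v as P(f)(\<eta> u), and the triple is
  moved along f. Injectivity uses the inverse that this suggests.\<close>

lemma bij_extend:
  assumes R: "is_functor (op_cat C) set_cat R"
  shows "bij_betw (extend R) (tensor E (comp_functor R (op_functor J)) F) (tensor C R P)"
proof (rule bij_betwI')
  \<comment> \<open>The candidate inverse: present v as P(f)(\<eta> u) and let f act on r instead.
    The choice of the presentation is harmless by \<open>Ecls_pull\<close>.\<close>
  define pull where "pull = (\<lambda>(c, r, v). SOME A. \<exists>e f u. e \<in> Ob E \<and> f \<in> Hom C (fobj J e) c \<and> u \<in> fobj F e \<and>
      v = fmor P (fobj J e) c f (\<eta> e u) \<and> A = Ecls R (e, fmor R c (fobj J e) f r, u))"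
  have pull: "pull (c, r, fmor P (fobj J e) c f (\<eta> e u)) = Ecls R (e, fmor R c (fobj J e) f r, u)"
    if "c \<in> Ob C" "r \<in> fobj R c" "e \<in> Ob E" "f \<in> Hom C (fobj J e) c" "u \<in> fobj F e" for c r e f u
    unfolding pull_def prod.case by (rule some_equality) (use that Ecls_pull[OF R] in blast)+
  \<comment> \<open>The inverse respects the generators over C, because a presentation of v followed
    by f is a presentation of P(f) v.\<close>
  have pull_move: "pull (c, fmor R c' c f r, v) = pull (c', r, fmor P c c' f v)"
    if *: "c \<in> Ob C" "c' \<in> Ob C" "f \<in> Hom C c c'" "r \<in> fobj R c'" "v \<in> fobj P c" for c c' f r v
  proof -
    obtain e g u where e: "e \<in> Ob E" "g \<in> Hom C (fobj J e) c" "u \<in> fobj F e" "v = fmor P (fobj J e) c g (\<eta> e u)"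
      using surj[OF *(1,5)] by blast
    have "fmor P c c' f v = fmor P (fobj J e) c' (Cmp C (fobj J e) c c' f g) (\<eta> e u)"
      using e * by (simp add: set_functor_comp[OF P] \<eta>_app Job)
    moreover have "fmor R c' (fobj J e) (Cmp C (fobj J e) c c' f g) r = fmor R c (fobj J e) g (fmor R c' c f r)"
      using set_functor_comp[OF R, of c' c "fobj J e" f g r] e * Job by simp
    moreover have "fmor R c' c f r \<in> fobj R c" using set_functor_app[OF R, of c' c f r] * by simp
    ultimately show ?thesis using e * by (simp add: pull cat_comp[OF C] Job)
  qed
  \<comment> \<open>An element in the image of \<eta> is presented by an identity.\<close>
  have pull_\<eta>: "pull (fobj J e, r, \<eta> e u) = Ecls R (e, r, u)"
    if "e \<in> Ob E" "r \<in> fobj R (fobj J e)" "u \<in> fobj F e" for e r u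
    using pull[of "fobj J e" r e "Idn C (fobj J e)" u] that set_functor_id[OF R, of "fobj J e" r]
    by (simp add: Job cat_id[OF C] set_functor_id[OF P] \<eta>_app)
  fix A B assume A: "A \<in> tensor E (comp_functor R (op_functor J)) F"
    and B: "B \<in> tensor E (comp_functor R (op_functor J)) F"
  obtain e r u where e: "e \<in> Ob E" "r \<in> fobj R (fobj J e)" "u \<in> fobj F e" "A = Ecls R (e, r, u)"
    using A by (auto elim: tensorE)
  obtain e' r' u' where e': "e' \<in> Ob E" "r' \<in> fobj R (fobj J e')" "u' \<in> fobj F e'" "B = Ecls R (e', r', u')"
    using B by (auto elim: tensorE)
  show "(extend R A = extend R B) = (A = B)"
  proof
    assume "extend R A = extend R B"
    then have "(fobj J e, r, \<eta> e u) \<in> tensor_class C R P (fobj J e', r', \<eta> e' u')"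
      using e e' tensor_class_self[of "(fobj J e, r, \<eta> e u)" C R P] by (simp add: extend_class)
    then have "pull (fobj J e, r, \<eta> e u) = pull (fobj J e', r', \<eta> e' u')"
      by (rule tensor_class_respects) (rule pull_move)
    then show "A = B" using e e' by (simp add: pull_\<eta>)
  qed simp
next
  fix A assume "A \<in> tensor E (comp_functor R (op_functor J)) F"
  then show "extend R A \<in> tensor C R P"
    by (elim tensorE) (simp add: extend_class tensor_class_in Job \<eta>_app)
next
  fix B assume "B \<in> tensor C R P"
  then obtain c r v where c: "c \<in> Ob C" "r \<in> fobj R c" "v \<in> fobj P c" "B = tensor_class C R P (c, r, v)"
    by (rule tensorE)
  obtain e f u where e: "e \<in> Ob E" "f \<in> Hom C (fobj J e) c" "u \<in> fobj F e" "v = fmor P (fobj J e) c f (\<eta> e u)"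
    using surj[OF c(1,3)] by blast
  have Rf: "fmor R c (fobj J e) f r \<in> fobj R (fobj J e)"
    using set_functor_app[OF R, of c "fobj J e" f r] e c Job by simp
  have "B = tensor_class C R P (fobj J e, fmor R c (fobj J e) f r, \<eta> e u)"
    using tensor_class_move[of "fobj J e" C c f r R "\<eta> e u" P] e c by (simp add: Job \<eta>_app)
  then have "B = extend R (Ecls R (e, fmor R c (fobj J e) f r, u))" by (simp add: extend_class)
  moreover have "Ecls R (e, fmor R c (fobj J e) f r, u) \<in> tensor E (comp_functor R (op_functor J)) F"
    using e Rf by (intro tensor_class_in) simp_all
  ultimately show "\<exists>A\<in>tensor E (comp_functor R (op_functor J)) F. B = extend R A" by blast
qed

text \<open>The co-Yoneda map: tensoring P with a representable presheaf is evaluation of P, seen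
  here on triples that come from E.\<close>

definition collapse :: "'o \<Rightarrow> ('e \<times> 'm \<times> 'x) set \<Rightarrow> 'y" where
  "collapse c A = the_elem ((\<lambda>(e, f, u). fmor P (fobj J e) c f (\<eta> e u)) ` A)"

lemma collapse_class:
  assumes "c \<in> Ob C"
  shows "collapse c (Ecls (fobj (yoneda C) c) (e, f, u)) = fmor P (fobj J e) c f (\<eta> e u)"
  unfolding collapse_def
proof (subst the_elem_tensor_class, goal_cases)
  case (1 e e' h f u)
  then show ?case using assms by (simp add: \<eta>_natural set_functor_comp[OF P] Jmor Job \<eta>_app)
qed simp

text \<open>This is what the locale assumptions \<open>surj\<close> and \<open>inj\<close> express,
  turned into a map on classes.\<close>

lemma bij_collapse:
  assumes c: "c \<in> Ob C"
  shows "bij_betw (collapse c) (tensor E (comp_functor (fobj (yoneda C) c) (op_functor J)) F) (fobj P c)"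
proof (rule bij_betwI')
  fix A B assume A: "A \<in> tensor E (comp_functor (fobj (yoneda C) c) (op_functor J)) F"
    and B: "B \<in> tensor E (comp_functor (fobj (yoneda C) c) (op_functor J)) F"
  obtain e f u where e: "e \<in> Ob E" "f \<in> Hom C (fobj J e) c" "u \<in> fobj F e" "A = Ecls (fobj (yoneda C) c) (e, f, u)"
    using A by (auto elim: tensorE)
  obtain e' f' u' where e': "e' \<in> Ob E" "f' \<in> Hom C (fobj J e') c" "u' \<in> fobj F e'"
    "B = Ecls (fobj (yoneda C) c) (e', f', u')"
    using B by (auto elim: tensorE)
  show "(collapse c A = collapse c B) = (A = B)"
  proof
    assume "collapse c A = collapse c B"
    then show "A = B" unfolding e(4) e'(4) collapse_class[OF c] using e e' by (intro inj c)
  qed simp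
next
  fix A assume "A \<in> tensor E (comp_functor (fobj (yoneda C) c) (op_functor J)) F"
  then show "collapse c A \<in> fobj P c"
    by (elim tensorE) (auto simp: collapse_class c Job \<eta>_app intro!: set_functor_app[OF P])
next
  fix v assume "v \<in> fobj P c"
  from surj[OF c this] obtain e f u where e: "e \<in> Ob E" "f \<in> Hom C (fobj J e) c" "u \<in> fobj F e"
    "v = fmor P (fobj J e) c f (\<eta> e u)" by blast
  then have "Ecls (fobj (yoneda C) c) (e, f, u) \<in> tensor E (comp_functor (fobj (yoneda C) c) (op_functor J)) F"
    by (intro tensor_class_in) simp_all
  with e show "\<exists>A\<in>tensor E (comp_functor (fobj (yoneda C) c) (op_functor J)) F. v = collapse c A"
    by (intro bexI) (simp_all add: collapse_class c)
qed

end

section \<open>Archimedean sets\<close>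

locale arch =
  fixes X :: "'a arch"
  assumes arch: "archimedean_set X"
begin

abbreviation le where "le x y \<equiv> (x, y) \<in> aord X"
abbreviation th where "th \<equiv> theta X"
abbreviation T where "T \<equiv> theta_pow X"

lemma nonempty: "acar X \<noteq> {}"
  and linear: "linear_order_on (acar X) (aord X)"
  and th_bij: "bij_betw th (acar X) (acar X)"
  and th_le_iff: "x \<in> acar X \<Longrightarrow> y \<in> acar X \<Longrightarrow> le (th x) (th y) \<longleftrightarrow> le x y"
  and th_ge: "x \<in> acar X \<Longrightarrow> le x (th x)"
  and th_neq: "x \<in> acar X \<Longrightarrow> th x \<noteq> x"
  and th_cofinal: "x \<in> acar X \<Longrightarrow> y \<in> acar X \<Longrightarrow> \<exists>n. le y ((th ^^ n) x)"
  using arch unfolding archimedean_set_def by auto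

lemma le_refl: "x \<in> acar X \<Longrightarrow> le x x"
  and le_trans: "le x y \<Longrightarrow> le y z \<Longrightarrow> le x z"
  and le_antisym: "le x y \<Longrightarrow> le y x \<Longrightarrow> x = y"
  and le_car: "le x y \<Longrightarrow> x \<in> acar X" "le x y \<Longrightarrow> y \<in> acar X"
  using linear unfolding order_on_defs refl_on_def by (blast dest: transD antisymD)+

lemma le_total: "x \<in> acar X \<Longrightarrow> y \<in> acar X \<Longrightarrow> le x y \<or> le y x"
  using linear le_refl unfolding order_on_defs total_on_def by metis

lemma th_in: "x \<in> acar X \<Longrightarrow> th x \<in> acar X"
  using th_bij bij_betwE by blast

lemma th_inv: "x \<in> acar X \<Longrightarrow> inv_into (acar X) th x \<in> acar X"
  "x \<in> acar X \<Longrightarrow> th (inv_into (acar X) th x) = x"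
  "x \<in> acar X \<Longrightarrow> inv_into (acar X) th (th x) = x"
  using th_bij by (auto simp: bij_betw_def f_inv_into_f inv_into_into)

lemma T_0 [simp]: "T 0 x = x"
  by (simp add: theta_pow_def)

lemma T_1: "T 1 x = th x"
  by (simp add: theta_pow_def)

lemma T_in: "x \<in> acar X \<Longrightarrow> T m x \<in> acar X"
proof -
  assume x: "x \<in> acar X"
  have "(th ^^ n) x \<in> acar X" for n by (induction n) (auto simp: x th_in)
  moreover have "(inv_into (acar X) th ^^ n) x \<in> acar X" for n by (induction n) (auto simp: x th_inv)
  ultimately show ?thesis by (simp add: theta_pow_def)
qed

lemma T_plus_1: "x \<in> acar X \<Longrightarrow> T (m + 1) x = th (T m x)"
proof (cases "0 \<le> m")
  case True
  then have "nat (m + 1) = Suc (nat m)" by simp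
  with True show ?thesis by (simp add: theta_pow_def)
next
  case False
  assume x: "x \<in> acar X"
  have *: "nat (- m) = Suc (nat (- (m + 1)))" using False by simp
  have in_X: "(inv_into (acar X) th ^^ n) x \<in> acar X" for n by (induction n) (auto simp: x th_inv)
  have "th (T m x) = (inv_into (acar X) th ^^ nat (- (m + 1))) x"
    using False unfolding theta_pow_def * by (simp add: th_inv in_X)
  also have "\<dots> = T (m + 1) x" using False by (cases "m = -1") (auto simp: theta_pow_def)
  finally show ?thesis by simp
qed

lemma T_minus_1: "x \<in> acar X \<Longrightarrow> T (m - 1) x = inv_into (acar X) th (T m x)"
  using T_plus_1[of x "m - 1"] T_in[of x "m - 1"] by (simp add: th_inv)

lemma T_add: "x \<in> acar X \<Longrightarrow> T (m + k) x = T m (T k x)"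
proof (induction m rule: int_induct[where k = 0])
  case (step1 i)
  then show ?case using T_plus_1[of x "i + k"] T_plus_1[of "T k x" i] by (simp add: T_in algebra_simps)
next
  case (step2 i)
  then show ?case using T_minus_1[of x "i + k"] T_minus_1[of "T k x" i] by (simp add: T_in algebra_simps)
qed simp

lemma T_th: "x \<in> acar X \<Longrightarrow> T m (th x) = th (T m x)"
  using T_add[of x m 1] T_plus_1[of x m] by (simp add: T_1)

lemma T_minus: "x \<in> acar X \<Longrightarrow> T (- m) (T m x) = x" "x \<in> acar X \<Longrightarrow> T m (T (- m) x) = x"
  using T_add[of x "- m" m] T_add[of x m "- m"] by simp_all

lemma T_commute: "x \<in> acar X \<Longrightarrow> T m (T k x) = T k (T m x)"
  by (metis T_add add.commute)

lemma T_le: "le x y \<Longrightarrow> le (T m x) (T m y)"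
proof (induction m rule: int_induct[where k = 0])
  case (step1 i)
  then show ?case using le_car[OF step1(3)] by (simp add: T_plus_1 th_le_iff T_in)
next
  case (step2 i)
  then show ?case
    using le_car[OF step2(3)] th_le_iff[of "T (i - 1) x" "T (i - 1) y"] T_plus_1[of _ "i - 1"] by (simp add: T_in)
qed simp

lemma T_le_iff: "x \<in> acar X \<Longrightarrow> y \<in> acar X \<Longrightarrow> le (T m x) (T m y) \<longleftrightarrow> le x y"
  using T_le[of x y m] T_le[of "T m x" "T m y" "- m"] by (auto simp: T_minus)

lemma T_incr:
  assumes x: "x \<in> acar X" and "m \<le> k"
  shows "le (T m x) (T k x)"
  using assms(2)
proof (induction k rule: int_ge_induct)
  case (step i)
  then show ?case using le_trans[OF step(2) th_ge] x by (simp add: T_plus_1 T_in)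
qed (simp add: le_refl T_in x)

text \<open>Freeness of the action: for k < m the point \<open>T (k + 1) x\<close> lies below
  \<open>T m x\<close>, and if this were below \<open>T k x\<close>, then \<theta> would not move
  \<open>T k x\<close> up.\<close>

lemma T_le_T_iff: "x \<in> acar X \<Longrightarrow> le (T m x) (T k x) \<longleftrightarrow> m \<le> k"
proof
  assume x: "x \<in> acar X" and le: "le (T m x) (T k x)"
  show "m \<le> k"
  proof (rule ccontr)
    assume "\<not> m \<le> k"
    then have "le (T (k + 1) x) (T m x)" using x by (intro T_incr) auto
    then have "le (th (T k x)) (T k x)" using le_trans[OF _ le] x by (simp add: T_plus_1)
    then show False using le_antisym th_ge th_neq T_in x by metis
  qed
qed (simp add: T_incr)

lemma T_inj: "x \<in> acar X \<Longrightarrow> T m x = T k x \<longleftrightarrow> m = k"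
  using T_le_T_iff[of x m k] T_le_T_iff[of x k m] le_refl[OF T_in[of x k]] by auto

lemma T_fixed: "x \<in> acar X \<Longrightarrow> T m x = x \<longleftrightarrow> m = 0"
  using T_inj[of x m 0] by simp

text \<open>Some translate of x lies above \<open>x0\<close> and some translate lies below it; the
  first one above \<open>x0\<close> is less than one step of \<theta> away from
  \<open>x0\<close>.\<close>

lemma fundamental_domain:
  assumes x0: "x0 \<in> acar X" and x: "x \<in> acar X"
  shows "\<exists>m y. le x0 y \<and> le y (th x0) \<and> y \<noteq> th x0 \<and> x = T m y"
proof -
  obtain n where "le x0 ((th ^^ n) x)" using th_cofinal x0 x by blast
  then have n: "le x0 (T (int n) x)" by (simp add: theta_pow_def)
  obtain n' where "le x ((th ^^ n') x0)" using th_cofinal x0 x by blast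
  then have "le x (T (int n') x0)" by (simp add: theta_pow_def)
  from T_le[OF this, of "- int n'"] have n': "le (T (- int n') x) x0" using x0 by (simp add: T_minus)
  \<comment> \<open>Counting starts at a translate below \<open>x0\<close>, which makes the first
    translate above \<open>x0\<close> a least natural number.\<close>
  define k where "k = (LEAST k. le x0 (T (int k - int n') x))"
  have k: "le x0 (T (int k - int n') x)"
    unfolding k_def by (rule LeastI[of _ "n + n'"]) (use n in simp)
  let ?y = "T (int k - int n') x"
  have "le ?y (th x0) \<and> ?y \<noteq> th x0"
  proof (cases k)
    \<comment> \<open>The starting translate is then both below and above \<open>x0\<close>.\<close>
    case 0
    then have "?y = x0" using k n' le_antisym by simp
    then show ?thesis using th_ge th_neq x0 by metis
  next
    case (Suc j)
    then have "\<not> le x0 (T (int j - int n') x)" using not_less_Least[of j "\<lambda>k. le x0 (T (int k - int n') x)"] unfolding k_def by auto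
    then have "le (T (int j - int n') x) x0" "T (int j - int n') x \<noteq> x0"
      using le_total le_refl x0 x T_in by metis+
    moreover have "?y = th (T (int j - int n') x)"
      using T_plus_1[OF x, of "int j - int n'"] Suc by (simp add: algebra_simps)
    ultimately show ?thesis using th_le_iff T_in x x0 th_inv(3) by metis
  qed
  then show ?thesis using k T_minus(1)[OF x, of "int k - int n'"] by metis
qed

text \<open>The order of X is lexicographic in the number of the copy and the position in it: if the
  copy of the larger point came first, its position would be at least
  \<theta>(\<open>x0\<close>).\<close>

lemma fundamental_domain_mono:
  assumes y: "le y (th x0)" "y \<noteq> th x0" and y': "le x0 y'"
    and le: "le (T m y) (T m' y')" "le x0 y" "le y' (th x0)" "y' \<noteq> th x0"
  shows "m < m' \<or> m = m' \<and> le y y'"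
proof -
  have in_X: "x0 \<in> acar X" "y \<in> acar X" "y' \<in> acar X" using y y' le_car by blast+
  have "m \<le> m'"
  proof (rule ccontr)
    assume "\<not> m \<le> m'"
    then have "le (T (m' + 1) x0) (T m x0)" using in_X by (intro T_incr) auto
    then have "le (T m' (th x0)) (T m x0)" using in_X by (simp add: T_plus_1 T_th)
    also note T_le[OF le(2), of m]
    finally (le_trans) have "le (T m' (th x0)) (T m' y')" using le(1) le_trans by blast
    then have "le (th x0) y'" using in_X T_le_iff th_in by blast
    then show False using le le_antisym by blast
  qed
  then show ?thesis using le(1) in_X by (cases "m = m'") (simp_all add: T_le_iff)
qed

lemma fundamental_domain_unique:
  assumes "le x0 y" "le y (th x0)" "y \<noteq> th x0" "le x0 y'" "le y' (th x0)" "y' \<noteq> th x0" "T m y = T m' y'"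
  shows "m = m'" "y = y'"
proof -
  have "le (T m y) (T m' y')" "le (T m' y') (T m y)" using assms T_in le_car le_refl by metis+
  then show "m = m'" "y = y'"
    using fundamental_domain_mono[of y x0 y' m m'] fundamental_domain_mono[of y' x0 y m' m] assms le_antisym by auto
qed

end

lemma arc_mapsI:
  assumes "\<And>x. x \<in> acar X \<Longrightarrow> f x \<in> acar Y" "\<And>x. x \<notin> acar X \<Longrightarrow> f x = undefined"
    and "\<And>x y. x \<in> acar X \<Longrightarrow> y \<in> acar X \<Longrightarrow> (x, y) \<in> aord X \<Longrightarrow> (f x, f y) \<in> aord Y"
    and "\<And>x. x \<in> acar X \<Longrightarrow> f (theta X x) = theta Y (f x)"
  shows "f \<in> arc_maps X Y"
  using assms by (auto simp: arc_maps_def PiE_iff extensional_def)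

lemma arc_homE:
  assumes "F \<in> arc_hom X Y"
  obtains f where "f \<in> arc_maps X Y" "F = arc_class X Y f"
  using assms by (auto simp: arc_hom_def)

lemma arc_class_in_hom: "f \<in> arc_maps X Y \<Longrightarrow> arc_class X Y f \<in> arc_hom X Y"
  by (auto simp: arc_hom_def)

locale arch_map = X: arch X + Y: arch Y for X :: "'a arch" and Y :: "'b arch" +
  fixes f
  assumes f: "f \<in> arc_maps X Y"
begin

lemma app: "x \<in> acar X \<Longrightarrow> f x \<in> acar Y"
  and outside: "x \<notin> acar X \<Longrightarrow> f x = undefined"
  and mono: "(x, y) \<in> aord X \<Longrightarrow> (f x, f y) \<in> aord Y"
  and commute: "x \<in> acar X \<Longrightarrow> f (theta X x) = theta Y (f x)"
  using f X.le_car unfolding arc_maps_def by (auto simp: PiE_iff extensional_def)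

lemma commute_T: "x \<in> acar X \<Longrightarrow> f (theta_pow X m x) = theta_pow Y m (f x)"
proof (induction m rule: int_induct[where k = 0])
  case (step1 i)
  then show ?case by (simp add: X.T_plus_1 Y.T_plus_1 commute X.T_in app)
next
  case (step2 i)
  have "theta Y (f (theta_pow X (i - 1) x)) = f (theta_pow X i x)"
    using X.T_plus_1[of x "i - 1"] step2(3) by (simp add: commute[symmetric] X.T_in)
  \<comment> \<open>Towards negative powers the equation is proved after applying \<theta>, which is
    injective on the carrier.\<close>
  then have "theta Y (f (theta_pow X (i - 1) x)) = theta Y (theta_pow Y (i - 1) (f x))"
    using step2 Y.T_plus_1[of "f x" "i - 1"] by (simp add: app)
  then show ?case by (metis Y.th_inv(3) app X.T_in Y.T_in step2(3))
qed simp

lemma shift: "(\<lambda>x\<in>acar X. theta_pow Y m (f x)) \<in> arc_maps X Y"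
  by (rule arc_mapsI) (auto simp: app Y.T_in mono Y.T_le commute X.th_in Y.T_th)

lemma class_shift: "arc_class X Y (\<lambda>x\<in>acar X. theta_pow Y m (f x)) = arc_class X Y f"
proof -
  have E: "(\<lambda>x\<in>acar X. theta_pow Y k ((\<lambda>x\<in>acar X. theta_pow Y m (f x)) x)) = (\<lambda>x\<in>acar X. theta_pow Y (k + m) (f x))" for k
    by (rule restrict_ext) (simp add: Y.T_add app)
  have *: "arc_class X Y (\<lambda>x\<in>acar X. theta_pow Y m (f x)) = (\<lambda>k. \<lambda>x\<in>acar X. theta_pow Y k (f x)) ` range (\<lambda>k. k + m)"
    unfolding arc_class_def image_image E ..
  have "range (\<lambda>k. k + m) = UNIV" by (rule surjI[of _ "\<lambda>k. k - m"]) simp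
  then show ?thesis unfolding * by (simp add: arc_class_def)
qed

lemma shift_0: "(\<lambda>x\<in>acar X. theta_pow Y 0 (f x)) = f"
  by (auto simp: outside)

lemma self_in_class: "f \<in> arc_class X Y f"
  unfolding arc_class_def using shift_0 by (metis rangeI)

lemma class_iff: "g \<in> arc_class X Y f \<longleftrightarrow> (\<exists>m. g = (\<lambda>x\<in>acar X. theta_pow Y m (f x)))"
  unfolding arc_class_def by auto

end

lemma arc_class_eqD:
  assumes "archimedean_set X" "archimedean_set Y" "f \<in> arc_maps X Y" "g \<in> arc_maps X Y" "arc_class X Y f = arc_class X Y g"
  shows "\<exists>m. g = (\<lambda>x\<in>acar X. theta_pow Y m (f x))"
proof -
  interpret f: arch_map X Y f using assms by unfold_locales
  interpret g: arch_map X Y g using assms by unfold_locales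
  show ?thesis using f.class_iff g.self_in_class assms(5) by blast
qed

lemma arc_maps_compose:
  assumes "archimedean_set X" "archimedean_set Y" "archimedean_set Z" "f \<in> arc_maps X Y" "g \<in> arc_maps Y Z"
  shows "compose (acar X) g f \<in> arc_maps X Z"
proof -
  interpret f: arch_map X Y f using assms by unfold_locales
  interpret g: arch_map Y Z g using assms by unfold_locales
  show ?thesis
    by (rule arc_mapsI) (auto simp: compose_def f.app g.app f.mono g.mono f.commute g.commute f.X.th_in)
qed

text \<open>The elementwise product of two classes is a single class because equivariant maps let
  powers of \<theta> pass: shifting g by m and f by k shifts the composite by m + k.\<close>

lemma arc_comp_class:
  assumes "archimedean_set X" "archimedean_set Y" "archimedean_set Z" "f \<in> arc_maps X Y" "g \<in> arc_maps Y Z"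
  shows "arc_comp X (arc_class Y Z g) (arc_class X Y f) = arc_class X Z (compose (acar X) g f)"
proof -
  interpret f: arch_map X Y f using assms by unfold_locales
  interpret g: arch_map Y Z g using assms by unfold_locales
  have *: "compose (acar X) (\<lambda>y\<in>acar Y. theta_pow Z m (g y)) (\<lambda>x\<in>acar X. theta_pow Y k (f x))
      = (\<lambda>x\<in>acar X. theta_pow Z (m + k) (compose (acar X) g f x))" for m k
    by (auto simp: fun_eq_iff compose_def f.app g.app f.Y.T_in g.commute_T g.Y.T_add)
  show ?thesis
  proof (rule set_eqI)
    fix h
    have "h \<in> arc_class X Z (compose (acar X) g f) \<longleftrightarrow>
        (\<exists>m k. h = (\<lambda>x\<in>acar X. theta_pow Z (m + k) (compose (acar X) g f x)))"
      unfolding arc_class_def by (auto, metis add.right_neutral)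
    also have "\<dots> \<longleftrightarrow> h \<in> arc_comp X (arc_class Y Z g) (arc_class X Y f)"
      unfolding arc_comp_def arc_class_def by (auto simp: * [symmetric])
    finally show "h \<in> arc_comp X (arc_class Y Z g) (arc_class X Y f) \<longleftrightarrow> h \<in> arc_class X Z (compose (acar X) g f)"
      by simp
  qed
qed

lemma arc_maps_id: "archimedean_set X \<Longrightarrow> (\<lambda>x\<in>acar X. x) \<in> arc_maps X X"
  by (intro arc_mapsI) (auto simp: arch.th_in[OF arch.intro])

lemma Arc_simps [simp]:
  "Ob Arc = {X. archimedean_set X}" "Hom Arc = arc_hom"
  "Idn Arc X = arc_class X X (\<lambda>x\<in>acar X. x)" "Cmp Arc X Y Z G F = arc_comp X G F"
  by (simp_all add: Arc_def)

lemma arc_maps_PiE: "f \<in> arc_maps X Y \<Longrightarrow> f \<in> acar X \<rightarrow>\<^sub>E acar Y"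
  by (simp add: arc_maps_def)

lemma arc_comp_id:
  assumes "archimedean_set X" "archimedean_set Y" "F \<in> arc_hom X Y"
  shows "arc_comp X F (arc_class X X (\<lambda>x\<in>acar X. x)) = F"
    and "arc_comp X (arc_class Y Y (\<lambda>x\<in>acar Y. x)) F = F"
  using assms by (auto elim!: arc_homE simp: arc_comp_class arc_maps_id compose_id_PiE[OF arc_maps_PiE])

lemma arc_comp_in_hom:
  assumes "archimedean_set X" "archimedean_set Y" "archimedean_set Z" "F \<in> arc_hom X Y" "G \<in> arc_hom Y Z"
  shows "arc_comp X G F \<in> arc_hom X Z"
  using assms by (auto elim!: arc_homE simp: arc_comp_class arc_maps_compose intro!: arc_class_in_hom)

lemma arc_comp_assoc:
  assumes "archimedean_set W" "archimedean_set X" "archimedean_set Y" "archimedean_set Z"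
    and "F \<in> arc_hom W X" "G \<in> arc_hom X Y" "H \<in> arc_hom Y Z"
  shows "arc_comp W (arc_comp X H G) F = arc_comp W H (arc_comp W G F)"
  using assms
  by (auto elim!: arc_homE simp: arc_comp_class arc_maps_compose compose_assoc_PiE[OF arc_maps_PiE])

lemma is_category_Arc: "is_category Arc"
  by (auto simp: is_category_def arc_comp_id arc_comp_in_hom arc_comp_assoc arc_maps_id intro!: arc_class_in_hom)

text \<open>Every point is uniquely a translate of a point of the half-open interval from
  \<open>x0\<close> to \<theta>(\<open>x0\<close>), and h is repeated on all translates. The
  condition \<open>h_end\<close> makes successive pieces join up.\<close>

lemma arc_maps_extend:
  assumes "archimedean_set X" "archimedean_set Y" and x0: "x0 \<in> acar X"
    and h: "\<And>x. (x0, x) \<in> aord X \<Longrightarrow> (x, theta X x0) \<in> aord X \<Longrightarrow> h x \<in> acar Y"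
    and h_mono: "\<And>x y. (x0, x) \<in> aord X \<Longrightarrow> (x, y) \<in> aord X \<Longrightarrow> (y, theta X x0) \<in> aord X \<Longrightarrow> (h x, h y) \<in> aord Y"
    and h_end: "h (theta X x0) = theta Y (h x0)"
  shows "\<exists>g\<in>arc_maps X Y. \<forall>x. (x0, x) \<in> aord X \<and> (x, theta X x0) \<in> aord X \<longrightarrow> g x = h x"
proof -
  interpret X: arch X using assms by unfold_locales
  interpret Y: arch Y using assms by unfold_locales
  have "\<forall>x\<in>acar X. \<exists>m y. X.le x0 y \<and> X.le y (X.th x0) \<and> y \<noteq> X.th x0 \<and> x = X.T m y"
    using X.fundamental_domain[OF x0] by blast
  \<comment> \<open>\<open>lv\<close> is the number of the translate and \<open>rp\<close> the
    position in the half-open interval.\<close>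
  then obtain lv rp where lr: "\<And>x. x \<in> acar X \<Longrightarrow> X.le x0 (rp x)" "\<And>x. x \<in> acar X \<Longrightarrow> X.le (rp x) (X.th x0)"
    "\<And>x. x \<in> acar X \<Longrightarrow> rp x \<noteq> X.th x0" "\<And>x. x \<in> acar X \<Longrightarrow> X.T (lv x) (rp x) = x"
    by metis
  have rp_in: "rp x \<in> acar X" if "x \<in> acar X" for x using lr(1)[OF that] X.le_car by blast
  have lr_unique: "lv x = m \<and> rp x = y"
    if "X.le x0 y" "X.le y (X.th x0)" "y \<noteq> X.th x0" "x = X.T m y" for x m y
    using X.fundamental_domain_unique[of x0 "rp x" y "lv x" m] lr[of x] that X.T_in X.le_car by metis
  have hrp: "h (rp x) \<in> acar Y" if "x \<in> acar X" for x using h lr that by blast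
  have hx0: "h x0 \<in> acar Y" using h X.le_refl X.th_ge x0 by blast
  define g where "g = (\<lambda>x\<in>acar X. Y.T (lv x) (h (rp x)))"
  have "g \<in> arc_maps X Y"
  proof (rule arc_mapsI)
    fix x assume x: "x \<in> acar X"
    then show "g x \<in> acar Y" by (simp add: g_def Y.T_in hrp)
    have "lv (X.th x) = lv x + 1 \<and> rp (X.th x) = rp x"
      using lr[OF x] by (intro lr_unique) (simp_all add: X.T_plus_1 rp_in x)
    then show "g (X.th x) = Y.th (g x)" using x by (simp add: g_def X.th_in Y.T_plus_1 hrp)
  next
    fix x y assume x: "x \<in> acar X" and y: "y \<in> acar X" and le: "X.le x y"
    consider "lv x < lv y" | "lv x = lv y" "X.le (rp x) (rp y)"
      using X.fundamental_domain_mono[of "rp x" x0 "rp y" "lv x" "lv y"] lr x y le by auto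
    then show "Y.le (g x) (g y)"
    proof cases
      case 1
      \<comment> \<open>Points of different copies are compared through the upper end of the copy of
        x, which by \<open>h_end\<close> goes to the same point as the lower end of the next
        copy.\<close>
      have "Y.le (g x) (Y.T (lv x) (h (X.th x0)))"
        using Y.T_le[OF h_mono] lr x X.le_refl X.th_in x0 by (simp add: g_def)
      also have "Y.T (lv x) (h (X.th x0)) = Y.T (lv x + 1) (h x0)" by (simp add: h_end Y.T_th Y.T_plus_1 hx0)
      also have "Y.le (Y.T (lv x + 1) (h x0)) (Y.T (lv y) (h x0))" using 1 by (intro Y.T_incr hx0) simp
      finally (Y.le_trans) have "Y.le (g x) (Y.T (lv y) (h x0))" .
      moreover have "Y.le (Y.T (lv y) (h x0)) (g y)"
        using y lr by (simp add: g_def Y.T_le h_mono X.le_refl x0)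
      ultimately show ?thesis by (rule Y.le_trans)
    next
      case 2
      then show ?thesis using x y lr by (simp add: g_def Y.T_le h_mono)
    qed
  qed (simp add: g_def)
  moreover have "g x = h x" if x: "X.le x0 x" "X.le x (X.th x0)" for x
  proof (cases "x = X.th x0")
    case True
    \<comment> \<open>The right end is outside the half-open interval; it counts as
      \<open>x0\<close> in the next copy.\<close>
    have "lv x = 1 \<and> rp x = x0"
      using True X.le_refl X.th_ge X.th_neq[OF x0, symmetric] x0 by (intro lr_unique) (simp_all add: X.T_1)
    then show ?thesis using True x0 hx0 by (simp add: g_def X.th_in Y.T_1 h_end)
  next
    case False
    then have "lv x = 0 \<and> rp x = x" using x by (intro lr_unique) auto
    then show ?thesis using x X.le_car by (simp add: g_def)
  qed
  ultimately show ?thesis by blast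
qed

lemma arc_maps_eqI:
  assumes "archimedean_set X" "archimedean_set Y" and b: "b \<in> acar X"
    and "f \<in> arc_maps X Y" "g \<in> arc_maps X Y"
    and eq: "\<And>x. (b, x) \<in> aord X \<Longrightarrow> (x, theta X b) \<in> aord X \<Longrightarrow> x \<noteq> theta X b \<Longrightarrow> f x = g x"
  shows "f = g"
proof
  fix x
  interpret f: arch_map X Y f using assms by unfold_locales
  interpret g: arch_map X Y g using assms by unfold_locales
  show "f x = g x"
  proof (cases "x \<in> acar X")
    case True
    obtain m y where "f.X.le b y" "f.X.le y (f.X.th b)" "y \<noteq> f.X.th b" "x = f.X.T m y"
      using f.X.fundamental_domain[OF b True] by blast
    then show ?thesis using eq[of y] f.X.le_car f.commute_T g.commute_T by metis
  qed (simp add: f.outside g.outside)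
qed

text \<open>Serves both for unrolling a circle and for X_I. The injection h lets the carrier live in
  any type. Any nonempty linear order A will do, since every point of a higher copy exceeds all
  points of a lower one.\<close>

lemma archimedean_lexI:
  assumes r: "linear_order_on A r" and A: "A \<noteq> {}" and h: "inj_on h (UNIV \<times> A)"
    and car: "acar X = h ` (UNIV \<times> A)"
    and ord: "\<And>n m a b. a \<in> A \<Longrightarrow> b \<in> A \<Longrightarrow>
      (h (n, a), h (m, b)) \<in> aord X \<longleftrightarrow> n < m \<or> n = m \<and> (a, b) \<in> r"
    and ord_car: "aord X \<subseteq> acar X \<times> acar X"
    and theta: "\<And>n a. a \<in> A \<Longrightarrow> theta X (h (n, a)) = h (n + 1 :: int, a)"
  shows "archimedean_set X"
proof -
  have r_refl: "(a, a) \<in> r" if "a \<in> A" for a using r that by (auto simp: order_on_defs refl_on_def)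
  have r_trans: "(a, c) \<in> r" if "(a, b) \<in> r" "(b, c) \<in> r" for a b c using r that by (auto simp: order_on_defs dest: transD)
  have r_anti: "a = b" if "(a, b) \<in> r" "(b, a) \<in> r" for a b using r that by (auto simp: order_on_defs dest: antisymD)
  have r_total: "(a, b) \<in> r \<or> (b, a) \<in> r" if "a \<in> A" "b \<in> A" for a b
    using r that r_refl unfolding order_on_defs total_on_def by (cases "a = b") auto
  have h_eq: "h (n, a) = h (m, b) \<longleftrightarrow> n = m \<and> a = b" if "a \<in> A" "b \<in> A" for n m a b
    using inj_onD[OF h] that by auto
  have linear: "linear_order_on (acar X) (aord X)"
    unfolding order_on_defs
  proof (intro conjI)
    show "refl_on (acar X) (aord X)" using r_refl ord by (auto simp: refl_on_def car)
    show "trans (aord X)"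
    proof (rule transI)
      fix x y z assume xyz: "(x, y) \<in> aord X" "(y, z) \<in> aord X"
      then have "x \<in> acar X" "y \<in> acar X" "z \<in> acar X" using ord_car by auto
      then obtain n a m b k c where "x = h (n, a)" "y = h (m, b)" "z = h (k, c)" "a \<in> A" "b \<in> A" "c \<in> A"
        unfolding car by auto
      then show "(x, z) \<in> aord X" using xyz r_trans[of a b c] by (auto simp: ord)
    qed
    show "antisym (aord X)"
    proof (rule antisymI)
      fix x y assume xy: "(x, y) \<in> aord X" "(y, x) \<in> aord X"
      then have "x \<in> acar X" "y \<in> acar X" using ord_car by auto
      then obtain n a m b where "x = h (n, a)" "y = h (m, b)" "a \<in> A" "b \<in> A"
        unfolding car by auto
      then show "x = y" using xy r_anti[of a b] by (auto simp: ord)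
    qed
    show "total_on (acar X) (aord X)"
    proof (rule total_onI)
      fix x y assume "x \<in> acar X" "y \<in> acar X"
      then obtain n a m b where "x = h (n, a)" "y = h (m, b)" "a \<in> A" "b \<in> A"
        unfolding car by auto
      then show "(x, y) \<in> aord X \<or> (y, x) \<in> aord X" using r_total[of a b] by (auto simp: ord)
    qed
  qed (rule ord_car)
  have pow: "(theta X ^^ k) (h (n, a)) = h (n + int k, a)" if "a \<in> A" for k n a
    by (induction k) (simp_all add: theta that algebra_simps)
  show ?thesis
    unfolding archimedean_set_def
  proof (intro conjI ballI)
    show "bij_betw (theta X) (acar X) (acar X)"
    proof (rule bij_betwI')
      show "(theta X x = theta X y) = (x = y)" if "x \<in> acar X" "y \<in> acar X" for x y
        using that unfolding car by (auto simp: theta h_eq)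
      show "theta X x \<in> acar X" if "x \<in> acar X" for x using that unfolding car by (auto simp: theta)
      fix y assume "y \<in> acar X"
      then obtain n a where y: "y = h (n, a)" "a \<in> A" unfolding car by auto
      then have "theta X (h (n - 1, a)) = y" by (simp add: theta)
      moreover have "h (n - 1, a) \<in> acar X" using y unfolding car by auto
      ultimately show "\<exists>x\<in>acar X. y = theta X x" by blast
    qed
    fix x y assume "x \<in> acar X" "y \<in> acar X"
    then obtain n a m b where xy: "x = h (n, a)" "y = h (m, b)" "a \<in> A" "b \<in> A" unfolding car by auto
    then show "((theta X x, theta X y) \<in> aord X) = ((x, y) \<in> aord X)" by (simp add: theta ord add1_zle_eq)
    show "(x, theta X x) \<in> aord X" "theta X x \<noteq> x" using xy by (simp_all add: theta ord h_eq)
    show "\<exists>k. (y, (theta X ^^ k) x) \<in> aord X"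
    proof (cases "m < n")
      case True
      then show ?thesis using xy by (intro exI[of _ 0]) (simp add: ord)
    next
      case False
      \<comment> \<open>One copy beyond that of y, so that positions in A need not be
        compared.\<close>
      then show ?thesis using xy by (intro exI[of _ "nat (m - n + 1)"]) (simp add: pow ord)
    qed
  qed (use A linear in \<open>simp_all add: car\<close>)
qed

section \<open>The archimedean sets of integers\<close>

lemma Zarc_simps [simp]:
  "acar (Zarc n) = UNIV" "(x, y) \<in> aord (Zarc n) \<longleftrightarrow> x \<le> y" "theta (Zarc n) x = x + int n + 1"
  by (simp_all add: Zarc_def)

lemma archimedean_Zarc: "archimedean_set (Zarc n)"
  unfolding archimedean_set_def
proof (intro conjI ballI)
  show "linear_order_on (acar (Zarc n)) (aord (Zarc n))"
    by (auto simp: order_on_defs refl_on_def total_on_def intro!: transI antisymI)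
  show "bij_betw (theta (Zarc n)) (acar (Zarc n)) (acar (Zarc n))"
    by (rule bij_betw_byWitness[of _ "\<lambda>x. x - int n - 1"]) auto
  have pow: "(theta (Zarc n) ^^ k) x = x + int k * (int n + 1)" for k x
    by (induction k) (simp_all add: algebra_simps)
  fix x y
  \<comment> \<open>A number y - x of steps suffices, as each step has length at least 1.\<close>
  have "y \<le> x + int (nat (y - x)) * (int n + 1)"
  proof (cases "y \<le> x")
    case False
    then have "y - x \<le> (y - x) * (int n + 1)" using mult_left_mono[of 1 "int n + 1" "y - x"] by simp
    moreover have "y \<le> x + z" if "y - x \<le> z" for z using that by linarith
    ultimately have "y \<le> x + (y - x) * (int n + 1)" by blast
    moreover have "int (nat (y - x)) = y - x" using False by simp
    ultimately show ?thesis by (simp only:)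
  qed simp
  then show "\<exists>k. (y, (theta (Zarc n) ^^ k) x) \<in> aord (Zarc n)" unfolding pow Zarc_simps ..
qed auto

interpretation Zarc: arch "Zarc n" for n
  by unfold_locales (rule archimedean_Zarc)

lemma theta_pow_Zarc [simp]: "theta_pow (Zarc n) m x = x + m * (int n + 1)"
proof (induction m rule: int_induct[where k = 0])
  case (step1 i)
  then show ?case using Zarc.T_plus_1[of x n i] by (simp add: algebra_simps)
next
  case (step2 i)
  then show ?case using Zarc.T_plus_1[of x n "i - 1"] by (simp add: algebra_simps)
qed simp

section \<open>Abstract circles\<close>

locale circ =
  fixes K :: "('p, 's) acircle"
  assumes K: "abstract_circle K"
begin

abbreviation S where "S \<equiv> Segs K"
abbreviation P where "P \<equiv> Pts K"
abbreviation d0 where "d0 \<equiv> bd0 K"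
abbreviation d1 where "d1 \<equiv> bd1 K"
abbreviation z where "z \<equiv> zero_seg K"
abbreviation e where "e \<equiv> one_seg K"
abbreviation st where "st \<equiv> star K"
abbreviation u where "u \<equiv> cup K"

lemma axs:
  "d0 ` S \<subseteq> P" "d1 ` S \<subseteq> P" "z ` P \<subseteq> S" "e ` P \<subseteq> S" "st ` S \<subseteq> S"
  "\<forall>a b c. u a b = Some c \<longrightarrow> a \<in> S \<and> b \<in> S \<and> c \<in> S"
  "P \<noteq> {}" "\<forall>x\<in>P. \<forall>y\<in>P. \<exists>a\<in>S. d0 a = x \<and> d1 a = y" "\<forall>x\<in>P. z x \<noteq> e x"
  "\<forall>a\<in>S. st (st a) = a \<and> d0 (st a) = d1 a"
  "\<forall>x\<in>P. d0 (z x) = x \<and> d1 (z x) = x \<and> st (z x) = e x"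
  "\<forall>a\<in>S. \<forall>x\<in>P. d0 a = x \<and> d1 a = x \<longrightarrow> a = z x \<or> a = e x"
  "\<forall>a\<in>S. \<forall>b\<in>S. \<forall>c\<in>S. u a b = Some c \<longrightarrow> d1 a = d0 b \<and> d1 c = d1 b \<and> d0 c = d0 a"
  "\<forall>a\<in>S. \<forall>b\<in>S. \<forall>c\<in>S. u a b = Some c \<longleftrightarrow> u (st c) a = Some (st b)"
  "\<forall>a\<in>S. \<forall>b\<in>S. \<forall>c\<in>S. \<forall>ab\<in>S. \<forall>abc\<in>S. u a b = Some ab \<and> u ab c = Some abc \<longrightarrow>
     (\<exists>bc. u b c = Some bc \<and> u a bc = Some abc)"
  "\<forall>a\<in>S. \<forall>b\<in>S. \<forall>x\<in>P. u a b = Some (z x) \<longrightarrow> a = z x"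
  "\<forall>a\<in>S. \<forall>x\<in>P. d0 a = x \<longrightarrow> u (z x) a = Some a"
  "\<forall>a\<in>S. \<forall>b\<in>S. d1 a = d0 b \<longrightarrow> u a b \<noteq> None \<or> u (st b) (st a) \<noteq> None"
  by (insert K[unfolded abstract_circle_def Let_def], elim conjE, assumption)+

lemma d0_in: "a \<in> S \<Longrightarrow> d0 a \<in> P"
  and d1_in: "a \<in> S \<Longrightarrow> d1 a \<in> P"
  and z_in: "x \<in> P \<Longrightarrow> z x \<in> S"
  and e_in: "x \<in> P \<Longrightarrow> e x \<in> S"
  and st_in: "a \<in> S \<Longrightarrow> st a \<in> S"
  using axs(1-5) by auto

lemma cup_in: "u a b = Some c \<Longrightarrow> a \<in> S" "u a b = Some c \<Longrightarrow> b \<in> S" "u a b = Some c \<Longrightarrow> c \<in> S"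
  using axs(6) by auto

lemma P_nonempty: "P \<noteq> {}"
  and connect: "x \<in> P \<Longrightarrow> y \<in> P \<Longrightarrow> \<exists>a\<in>S. d0 a = x \<and> d1 a = y"
  and z_neq_e: "x \<in> P \<Longrightarrow> z x \<noteq> e x"
  using axs(7-9) by auto

lemma st_st: "a \<in> S \<Longrightarrow> st (st a) = a"
  and d0_st: "a \<in> S \<Longrightarrow> d0 (st a) = d1 a"
  and d0_z: "x \<in> P \<Longrightarrow> d0 (z x) = x"
  and d1_z: "x \<in> P \<Longrightarrow> d1 (z x) = x"
  and st_z: "x \<in> P \<Longrightarrow> st (z x) = e x"
  using axs(10,11) by simp_all

lemma loop: "a \<in> S \<Longrightarrow> d0 a = x \<Longrightarrow> d1 a = x \<Longrightarrow> a = z x \<or> a = e x"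
  using axs(12) d0_in by metis

lemma d1_st: "a \<in> S \<Longrightarrow> d1 (st a) = d0 a"
  by (metis d0_st st_in st_st)

lemma st_e: "x \<in> P \<Longrightarrow> st (e x) = z x"
  by (metis st_z st_st z_in)

lemma d0_e: "x \<in> P \<Longrightarrow> d0 (e x) = x"
  and d1_e: "x \<in> P \<Longrightarrow> d1 (e x) = x"
  by (metis st_z z_in d0_st d1_z, metis st_z z_in d1_st d0_z)

lemma cup_d: "u a b = Some c \<Longrightarrow> d1 a = d0 b" "u a b = Some c \<Longrightarrow> d1 c = d1 b" "u a b = Some c \<Longrightarrow> d0 c = d0 a"
  using axs(13) cup_in[of a b c] by blast+

text \<open>A cyclic symmetry: a, b and the complement of their union close up to one full turn, and
  any of the three may come first.\<close>

lemma cup_rot: "u a b = Some c \<Longrightarrow> u (st c) a = Some (st b)"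
  using axs(14) cup_in[of a b c] by blast

lemma cup_rot': "u a b = Some c \<Longrightarrow> u b (st c) = Some (st a)"
  using cup_rot[OF cup_rot[of a b c]] cup_in[of a b c] by (simp add: st_st)

lemma cup_assoc: "u a b = Some ab \<Longrightarrow> u ab c = Some abc \<Longrightarrow> \<exists>bc. u b c = Some bc \<and> u a bc = Some abc"
  using axs(15) cup_in[of a b ab] cup_in[of ab c abc] by blast

lemma cup_zD: "u a b = Some (z x) \<Longrightarrow> x \<in> P \<Longrightarrow> a = z x"
  using axs(16) cup_in[of a b "z x"] by blast

lemma z_cup: "a \<in> S \<Longrightarrow> u (z (d0 a)) a = Some a"
  using axs(17) d0_in by blast

lemma cup_total: "a \<in> S \<Longrightarrow> b \<in> S \<Longrightarrow> d1 a = d0 b \<Longrightarrow> (\<exists>c. u a b = Some c) \<or> (\<exists>c. u (st b) (st a) = Some c)"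
  using axs(18) by blast

lemma cup_z: "a \<in> S \<Longrightarrow> u a (z (d1 a)) = Some a"
  using cup_rot[OF z_cup[of "st a"]] by (simp add: st_in st_st d0_st)

lemma cup_st: "a \<in> S \<Longrightarrow> u a (st a) = Some (e (d0 a))"
  using cup_rot'[OF z_cup[of a]] by (simp add: st_z d0_in)

text \<open>Apply \<open>cup_total\<close> to the complement of a followed by b; rotating whichever
  union exists exhibits one of the segments as an initial part of the other.\<close>

lemma comparable:
  assumes "a \<in> S" "b \<in> S" "d0 a = d0 b"
  shows "(\<exists>c. u a c = Some b) \<or> (\<exists>c. u b c = Some a)"
proof -
  consider c where "u (st a) b = Some c" | c where "u (st b) a = Some c"
    using cup_total[of "st a" b] assms by (auto simp: st_in d1_st st_st)
  then show ?thesis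
  proof cases
    case 1
    from cup_rot'[OF this] show ?thesis using assms by (auto simp: st_st)
  next
    case 2
    from cup_rot'[OF this] show ?thesis using assms by (auto simp: st_st)
  qed
qed

text \<open>A rotation of \<open>cup_zD\<close>, as complements exchange 0 and 1.\<close>

lemma cup_eD: "u a (e x) = Some b \<Longrightarrow> x \<in> P \<Longrightarrow> b = e x"
proof -
  assume u: "u a (e x) = Some b" and x: "x \<in> P"
  then have "st b = z x" using cup_rot[OF u] by (auto simp: st_e intro: cup_zD)
  then show "b = e x" using cup_in[OF u] x st_st st_z by metis
qed

text \<open>One of the segments continues the other by a loop c. If c is 0, they agree; if c is 1,
  \<open>cup_eD\<close> makes the longer one a full turn, whose ends coincide.\<close>

lemma seg_unique:
  assumes "a \<in> S" "b \<in> S" "d0 a = d0 b" "d1 a = d1 b" and neq: "d0 a \<noteq> d1 a"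
  shows "a = b"
proof -
  have *: "a = b" if ab: "a \<in> S" "d0 a = d0 b" "d1 a = d1 b" "d0 a \<noteq> d1 a" "u a c = Some b" for a b c
  proof -
    have "c \<in> S" "d0 c = d1 a" "d1 c = d1 a" using cup_in[OF ab(5)] cup_d[OF ab(5)] ab by auto
    then consider "c = z (d1 a)" | "c = e (d1 a)" using loop by blast
    then show ?thesis
    proof cases
      case 1
      then show ?thesis using cup_z[OF ab(1)] ab(5) by simp
    next
      case 2
      then have "b = e (d1 a)" using cup_eD ab d1_in by blast
      then show ?thesis using ab d0_e d1_in by metis
    qed
  qed
  show ?thesis using comparable[OF assms(1-3)] *[of a b] *[of b a] assms by metis
qed

text \<open>\<open>cup_total\<close> provides at least one of these unions; both exist only for
  complementary segments. If both exist, \<open>cup_assoc\<close> shows that the complement of c can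
  be followed by 1. Rotating this gives a union equal to 0, hence the complement of c is 0 and c is
  a full turn.\<close>

lemma cup_both:
  assumes ab: "u a b = Some c" and ba: "u (st b) (st a) = Some d"
  shows "b = st a"
proof -
  have S: "a \<in> S" "b \<in> S" "c \<in> S" "d \<in> S" using cup_in ab ba by blast+
  let ?x = "d0 a"
  have "u (st c) a = Some (st b)" using cup_rot[OF ab] .
  from cup_assoc[OF this ba] have 1: "u (st c) (e ?x) = Some d" using cup_st S by simp
  have 2: "u (st d) (st c) = Some (z ?x)" using cup_rot[OF 1] st_e d0_in S by simp
  have 3: "st d = z ?x" using cup_zD[OF 2] d0_in S by simp
  have "d0 (st c) = ?x" using cup_d(1)[OF 2] 3 d1_z d0_in S by simp
  then have "st c = z ?x" using z_cup[of "st c"] 2 3 S by (simp add: st_in)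
  then have "a = st b" using cup_rot[OF ab] z_cup S by simp
  then show ?thesis using S st_st by simp
qed

end

lemma circle_homI:
  assumes "\<And>x. x \<in> Pts K \<Longrightarrow> f x \<in> Pts L" "\<And>a. a \<in> Segs K \<Longrightarrow> g a \<in> Segs L"
    "\<And>x. x \<notin> Pts K \<Longrightarrow> f x = undefined" "\<And>a. a \<notin> Segs K \<Longrightarrow> g a = undefined"
    "\<And>a. a \<in> Segs K \<Longrightarrow> bd0 L (g a) = f (bd0 K a)" "\<And>a. a \<in> Segs K \<Longrightarrow> bd1 L (g a) = f (bd1 K a)"
    "\<And>a. a \<in> Segs K \<Longrightarrow> star L (g a) = g (star K a)"
    "\<And>x. x \<in> Pts K \<Longrightarrow> zero_seg L (f x) = g (zero_seg K x)" "\<And>x. x \<in> Pts K \<Longrightarrow> one_seg L (f x) = g (one_seg K x)"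
    "\<And>a b c. a \<in> Segs K \<Longrightarrow> b \<in> Segs K \<Longrightarrow> c \<in> Segs K \<Longrightarrow> cup K a b = Some c \<Longrightarrow> cup L (g a) (g b) = Some (g c)"
  shows "(f, g) \<in> circle_hom K L"
  unfolding circle_hom_def using assms by (auto simp: PiE_iff extensional_def)

locale circ_hom = K: circ K + L: circ L for K :: "('p, 's) acircle" and L :: "('q, 't) acircle" +
  fixes f g
  assumes fg: "(f, g) \<in> circle_hom K L"
begin

lemma f_in: "x \<in> Pts K \<Longrightarrow> f x \<in> Pts L"
  and g_in: "a \<in> Segs K \<Longrightarrow> g a \<in> Segs L"
  and d0_g: "a \<in> Segs K \<Longrightarrow> bd0 L (g a) = f (bd0 K a)"
  and d1_g: "a \<in> Segs K \<Longrightarrow> bd1 L (g a) = f (bd1 K a)"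
  and st_g: "a \<in> Segs K \<Longrightarrow> star L (g a) = g (star K a)"
  and z_f: "x \<in> Pts K \<Longrightarrow> zero_seg L (f x) = g (zero_seg K x)"
  and e_f: "x \<in> Pts K \<Longrightarrow> one_seg L (f x) = g (one_seg K x)"
  and cup_g: "cup K a b = Some c \<Longrightarrow> cup L (g a) (g b) = Some (g c)"
  using fg K.cup_in[of a b c] unfolding circle_hom_def by (auto simp: PiE_iff extensional_def)

text \<open>Segments with distinct ends are determined by them, and the two loops at a point stay
  distinct because 0 and 1 differ in L.\<close>

lemma inj_segs:
  assumes "inj_on f (Pts K)"
  shows "inj_on g (Segs K)"
proof (rule inj_onI)
  fix a b assume a: "a \<in> Segs K" and b: "b \<in> Segs K" and eq: "g a = g b"
  then have d: "bd0 K a = bd0 K b" "bd1 K a = bd1 K b"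
    using inj_onD[OF assms] d0_g d1_g K.d0_in K.d1_in by metis+
  show "a = b"
  proof (cases "bd0 K a = bd1 K a")
    case True
    let ?x = "bd0 K a"
    have "g (zero_seg K ?x) \<noteq> g (one_seg K ?x)" using L.z_neq_e f_in z_f e_f K.d0_in a by metis
    then show ?thesis using K.loop[of a ?x] K.loop[of b ?x] a b d True eq by metis
  next
    case False
    then show ?thesis using K.seg_unique a b d by blast
  qed
qed

text \<open>A segment of L with distinct ends is the image of any segment of K that joins the
  preimages of these ends, by uniqueness in L.\<close>

lemma surj_segs:
  assumes f: "bij_betw f (Pts K) (Pts L)"
  shows "g ` Segs K = Segs L"
proof (intro equalityI subsetI)
  fix c assume c: "c \<in> Segs L"
  obtain x y where xy: "x \<in> Pts K" "y \<in> Pts K" "bd0 L c = f x" "bd1 L c = f y"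
    using f L.d0_in[OF c] L.d1_in[OF c] unfolding bij_betw_def by (metis imageE)
  show "c \<in> g ` Segs K"
  proof (cases "x = y")
    case True
    then have "c = g (zero_seg K x) \<or> c = g (one_seg K x)" using L.loop[OF c] xy z_f e_f by metis
    then show ?thesis using K.z_in K.e_in xy by blast
  next
    case False
    obtain a where a: "a \<in> Segs K" "bd0 K a = x" "bd1 K a = y" using K.connect xy by blast
    have "f x \<noteq> f y" using f False xy by (auto simp: bij_betw_def inj_on_def)
    then have "g a = c" using L.seg_unique[of "g a" c] a c xy d0_g d1_g g_in by simp
    then show ?thesis using a by blast
  qed
qed (use g_in in blast)

text \<open>The inverse preserves \<open>\<union>\<close>: if \<open>g a \<union> g b\<close> exists but \<open>a \<union> b\<close> does not, then \<open>b\<^sup>* \<union> a\<^sup>*\<close> and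
  hence also \<open>g b\<^sup>* \<union> g a\<^sup>*\<close> exists, which forces \<open>b = a\<^sup>*\<close>; but \<open>a \<union> a\<^sup>*\<close> always exists.\<close>

lemma cup_reflect:
  assumes f: "inj_on f (Pts K)" and abc: "a \<in> Segs K" "b \<in> Segs K" "c \<in> Segs K"
    and cup: "cup L (g a) (g b) = Some (g c)"
  shows "cup K a b = Some c"
proof -
  note inj = inj_onD[OF inj_segs[OF f]]
  have "bd1 K a = bd0 K b"
    using L.cup_d(1)[OF cup] abc d0_g d1_g inj_onD[OF f] K.d0_in K.d1_in by metis
  then have "\<exists>c'. cup K a b = Some c'"
  proof (rule disjE[OF K.cup_total[OF abc(1,2)]])
    assume "\<exists>d. cup K (star K b) (star K a) = Some d"
    then obtain d where "cup L (star L (g b)) (star L (g a)) = Some (g d)" using cup_g abc st_g by metis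
    then have "g b = g (star K a)" using L.cup_both[OF cup] st_g abc by metis
    then have "b = star K a" using inj abc K.st_in by blast
    then show ?thesis using K.cup_st abc by blast
  qed
  then obtain c' where c': "cup K a b = Some c'" by blast
  then have "g c' = g c" using cup_g cup by fastforce
  then show ?thesis using c' inj K.cup_in(3)[OF c'] abc by blast
qed

lemma inverse_hom:
  assumes f: "bij_betw f (Pts K) (Pts L)"
  shows "(\<lambda>x\<in>Pts L. inv_into (Pts K) f x, \<lambda>a\<in>Segs L. inv_into (Segs K) g a) \<in> circle_hom L K"
proof -
  have finj: "inj_on f (Pts K)" and fsurj: "f ` Pts K = Pts L" using f by (auto simp: bij_betw_def)
  note ginj = inj_segs[OF finj] and gsurj = surj_segs[OF f]
  let ?f = "inv_into (Pts K) f" and ?g = "inv_into (Segs K) g"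
  have inv: "\<And>x. x \<in> Pts K \<Longrightarrow> ?f (f x) = x" "\<And>a. a \<in> Segs K \<Longrightarrow> ?g (g a) = a"
    using finj ginj by simp_all
  have segsE: "\<exists>b\<in>Segs K. a = g b" if "a \<in> Segs L" for a using that gsurj by blast
  have ptsE: "\<exists>y\<in>Pts K. x = f y" if "x \<in> Pts L" for x using that fsurj by blast
  show ?thesis
  proof (rule circle_homI, goal_cases)
    \<comment> \<open>Preservation of unions by the inverse is the one condition that is not formal;
      it rests on \<open>cup_reflect\<close>.\<close>
    case (10 a b c)
    then obtain a' b' c' where "a' \<in> Segs K" "b' \<in> Segs K" "c' \<in> Segs K" "a = g a'" "b = g b'" "c = g c'"
      using segsE by metis
    with 10 show ?case using cup_reflect[OF finj, of a' b' c'] by (simp add: inv)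
  next
    case (5 a)
    then obtain b where "b \<in> Segs K" "a = g b" using segsE by blast
    then show ?case by (simp add: inv g_in d0_g d1_g st_g K.d0_in K.d1_in K.st_in f_in)
  next
    case (6 a)
    then obtain b where "b \<in> Segs K" "a = g b" using segsE by blast
    then show ?case by (simp add: inv g_in d0_g d1_g st_g K.d0_in K.d1_in K.st_in f_in)
  next
    case (7 a)
    then obtain b where "b \<in> Segs K" "a = g b" using segsE by blast
    then show ?case by (simp add: inv g_in d0_g d1_g st_g K.d0_in K.d1_in K.st_in f_in)
  next
    case (8 x)
    then obtain y where "y \<in> Pts K" "x = f y" using ptsE by blast
    then show ?case by (simp add: inv g_in f_in z_f e_f K.z_in K.e_in)
  next
    case (9 x)
    then obtain y where "y \<in> Pts K" "x = f y" using ptsE by blast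
    then show ?case by (simp add: inv g_in f_in z_f e_f K.z_in K.e_in)
  qed (use fsurj gsurj in \<open>auto simp: inv_into_into\<close>)
qed

end

lemma Circ_simps [simp]:
  "Ob Circ = {K. abstract_circle K \<and> small_circle K}" "Hom Circ = circle_hom"
  "Idn Circ K = (\<lambda>x\<in>Pts K. x, \<lambda>a\<in>Segs K. a)"
  "Cmp Circ K L M g f = (compose (Pts K) (fst g) (fst f), compose (Segs K) (snd g) (snd f))"
  by (simp_all add: Circ_def)

lemma circle_hom_id: "abstract_circle K \<Longrightarrow> (\<lambda>x\<in>Pts K. x, \<lambda>a\<in>Segs K. a) \<in> circle_hom K K"
  using circ.d0_in[of K] circ.d1_in[of K] circ.z_in[of K] circ.e_in[of K] circ.st_in[of K]
  by (intro circle_homI) (auto simp: circ_def)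

lemma circle_hom_compose:
  assumes "abstract_circle K" "abstract_circle L" "abstract_circle M" "(f, g) \<in> circle_hom K L" "(f', g') \<in> circle_hom L M"
  shows "(compose (Pts K) f' f, compose (Segs K) g' g) \<in> circle_hom K M"
proof -
  interpret A: circ_hom K L f g using assms by unfold_locales
  interpret B: circ_hom L M f' g' using assms by unfold_locales
  show ?thesis
    by (rule circle_homI)
      (auto simp: compose_def A.f_in A.g_in A.d0_g A.d1_g A.st_g A.z_f A.e_f A.cup_g B.f_in B.g_in B.d0_g B.d1_g
        B.st_g B.z_f B.e_f B.cup_g A.K.d0_in A.K.d1_in A.K.st_in A.K.z_in A.K.e_in)
qed

lemma circle_hom_PiE: "h \<in> circle_hom K L \<Longrightarrow> fst h \<in> Pts K \<rightarrow>\<^sub>E Pts L" "h \<in> circle_hom K L \<Longrightarrow> snd h \<in> Segs K \<rightarrow>\<^sub>E Segs L"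
  unfolding circle_hom_def by (auto simp del: PiE_iff)

lemma is_category_Circ: "is_category Circ"
  unfolding is_category_def
proof (intro conjI ballI, goal_cases)
  case (1 K)
  then show ?case by (simp add: circle_hom_id)
next
  case (2 K L M f g)
  then show ?case using circle_hom_compose[of K L M "fst f" "snd f" "fst g" "snd g"] by simp
next
  case (3 K L f)
  then show ?case by (simp add: compose_id_PiE[OF circle_hom_PiE(1)] compose_id_PiE[OF circle_hom_PiE(2)])
next
  case (4 K L f)
  then show ?case by (simp add: compose_id_PiE[OF circle_hom_PiE(1)] compose_id_PiE[OF circle_hom_PiE(2)])
next
  case (5 K L M N f g h)
  then show ?case by (simp add: compose_assoc_PiE[OF circle_hom_PiE(1)] compose_assoc_PiE[OF circle_hom_PiE(2)])
qed

lemma is_iso_CircI: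
  assumes K: "K \<in> Ob Circ" and L: "L \<in> Ob Circ" and hom: "(f, g) \<in> circle_hom K L"
    and f: "bij_betw f (Pts K) (Pts L)"
  shows "is_iso Circ K L (f, g)"
proof -
  interpret circ_hom K L f g using assms by unfold_locales auto
  have finj: "inj_on f (Pts K)" and fsurj: "f ` Pts K = Pts L" using f by (auto simp: bij_betw_def)
  note ginj = inj_segs[OF finj] and gsurj = surj_segs[OF f]
  show ?thesis
    unfolding is_iso_def
  proof (intro conjI bexI)
    show "(\<lambda>x\<in>Pts L. inv_into (Pts K) f x, \<lambda>a\<in>Segs L. inv_into (Segs K) g a) \<in> Hom Circ L K"
      using inverse_hom[OF f] by simp
  qed (use hom finj fsurj ginj gsurj in
      \<open>auto simp: compose_def fun_eq_iff f_in g_in f_inv_into_f inv_into_into\<close>)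
qed

section \<open>The circle of an archimedean set\<close>

context arch
begin

abbreviation orb where "orb \<equiv> orbit X"
abbreviation seg where "seg x y \<equiv> orbit2 X (x, y)"
abbreviation Q where "Q \<equiv> arc_circle X"

lemma mem_orb: "a \<in> orb x \<longleftrightarrow> (\<exists>m. a = T m x)"
  by (auto simp: orbit_def)

lemma mem_seg: "p \<in> seg x y \<longleftrightarrow> (\<exists>m. p = (T m x, T m y))"
  by (auto simp: orbit2_def)

lemma orb_T: "x \<in> acar X \<Longrightarrow> orb (T m x) = orb x"
  unfolding set_eq_iff mem_orb by (metis T_add T_minus(1) T_in)

lemma seg_T:
  assumes x: "x \<in> acar X" and y: "y \<in> acar X"
  shows "seg (T m x) (T m y) = seg x y"
proof (intro set_eqI iffI)
  fix p assume "p \<in> seg (T m x) (T m y)"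
  then obtain k where "p = (T (k + m) x, T (k + m) y)" using x y by (auto simp: mem_seg T_add)
  then show "p \<in> seg x y" by (auto simp: mem_seg)
next
  fix p assume "p \<in> seg x y"
  then obtain k where "p = (T k x, T k y)" by (auto simp: mem_seg)
  then have "p = (T (k - m) (T m x), T (k - m) (T m y))" using x y by (simp flip: T_add)
  then show "p \<in> seg (T m x) (T m y)" by (auto simp: mem_seg)
qed

lemma orb_eq_iff: "x \<in> acar X \<Longrightarrow> orb x = orb y \<longleftrightarrow> (\<exists>m. y = T m x)"
proof
  assume "orb x = orb y"
  moreover have "y \<in> orb y" using mem_orb T_0 by metis
  ultimately have "y \<in> orb x" by simp
  then show "\<exists>m. y = T m x" by (simp add: mem_orb)
qed (auto simp: orb_T)

lemma seg_eq_iff: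
  "x \<in> acar X \<Longrightarrow> y \<in> acar X \<Longrightarrow> seg x y = seg x' y' \<longleftrightarrow> (\<exists>m. x' = T m x \<and> y' = T m y)"
proof
  assume "seg x y = seg x' y'"
  moreover have "(x', y') \<in> seg x' y'" using mem_seg T_0 by metis
  ultimately have "(x', y') \<in> seg x y" by simp
  then show "\<exists>m. x' = T m x \<and> y' = T m y" by (simp add: mem_seg)
qed (auto simp: seg_T)

text \<open>A power of \<theta> that fixes the left end is the identity, so a segment has exactly
  one lift for each lift of its initial point.\<close>

lemma seg_eq_left: "x \<in> acar X \<Longrightarrow> y \<in> acar X \<Longrightarrow> seg x y = seg x y' \<longleftrightarrow> y = y'"
  by (metis T_0 T_fixed seg_eq_iff)

lemma fst_seg: "fst ` seg x y = orb x" and snd_seg: "snd ` seg x y = orb y"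
  by (auto simp: orbit_def orbit2_def image_image)

lemma diag_orb: "(\<lambda>x. (x, x)) ` orb x = seg x x"
  by (auto simp: orbit_def orbit2_def image_image)

lemma graph_orb: "x \<in> acar X \<Longrightarrow> (\<lambda>x. (x, th x)) ` orb x = seg x (th x)"
  by (auto simp: orbit_def orbit2_def image_image T_th)

lemma rotate_seg: "x \<in> acar X \<Longrightarrow> (\<lambda>(x, y). (y, th x)) ` seg x y = seg y (th x)"
  by (auto simp: orbit2_def image_image T_th)

lemma relcomp_seg: "y \<in> acar X \<Longrightarrow> seg x y O seg y z = seg x z"
  by (auto simp: relcomp_unfold mem_seg) (metis T_inj, blast)

lemma quot_segs_iff: "A \<in> quot_segs X \<longleftrightarrow> (\<exists>x y. le x y \<and> le y (th x) \<and> A = seg x y)"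
  unfolding quot_segs_def using le_car by blast

lemma segE: "A \<in> quot_segs X \<Longrightarrow> \<exists>x y. x \<in> acar X \<and> y \<in> acar X \<and> le x y \<and> le y (th x) \<and> A = seg x y"
  using le_car by (auto simp: quot_segs_iff)

lemma circle_simps [simp]:
  "Pts Q = orb ` acar X" "Segs Q = quot_segs X"
  "bd0 Q (seg x y) = orb x" "bd1 Q (seg x y) = orb y" "zero_seg Q (orb x) = seg x x"
  "x \<in> acar X \<Longrightarrow> one_seg Q (orb x) = seg x (th x)"
  "x \<in> acar X \<Longrightarrow> star Q (seg x y) = seg y (th x)"
  by (simp_all add: arc_circle_def fst_seg snd_seg diag_orb graph_orb rotate_seg)

text \<open>In the definition of the union the witnesses are arbitrary members of the orbits.
  Translating them back by the power m that relates them to (x, y) fixes the lift of the left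
  segment.\<close>

lemma cup_iff:
  assumes x: "le x y" "le y (th x)"
  shows "cup Q (seg x y) B = Some C \<longleftrightarrow> (\<exists>z. le y z \<and> le z (th x) \<and> B = seg y z \<and> C = seg x z)"
proof
  have in_X: "x \<in> acar X" "y \<in> acar X" using x le_car by blast+
  assume "cup Q (seg x y) B = Some C"
  then have B: "B \<in> quot_segs X" and C: "C = seg x y O B"
    and *: "\<exists>x' y' z'. (x', y') \<in> seg x y \<and> (y', z') \<in> B \<and> le x' y' \<and> le y' z' \<and> le z' (th x')"
    by (auto simp: arc_circle_def split: if_splits)
  obtain m z' where m: "(T m y, z') \<in> B" "le (T m y) z'" "le z' (th (T m x))"
    using * by (auto simp: mem_seg)
  obtain p q where pq: "B = seg p q" "p \<in> acar X" "q \<in> acar X" using B le_car by (auto simp: quot_segs_iff)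
  have z': "z' \<in> acar X" using m le_car by blast
  have "B = seg (T m y) z'" using m(1) pq by (auto simp: mem_seg seg_T)
  then have "B = seg y (T (- m) z')" using seg_T[of "T m y" z' "- m"] in_X z' T_in by (simp add: T_minus)
  moreover have "le y (T (- m) z')" using T_le[OF m(2), of "- m"] in_X by (simp add: T_minus)
  moreover have "le (T (- m) z') (th x)" using T_le[OF m(3), of "- m"] in_X by (simp add: T_minus T_in T_th)
  ultimately show "\<exists>z. le y z \<and> le z (th x) \<and> B = seg y z \<and> C = seg x z" using C in_X relcomp_seg by metis
next
  have in_X: "x \<in> acar X" "y \<in> acar X" using x le_car by blast+
  assume "\<exists>z. le y z \<and> le z (th x) \<and> B = seg y z \<and> C = seg x z"
  then obtain z where z: "le y z" "le z (th x)" "B = seg y z" "C = seg x z" by blast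
  have "le z (th y)" using z(2) x(1) th_le_iff in_X le_trans by blast
  then have "B \<in> quot_segs X" "seg x y \<in> quot_segs X" using z x by (auto simp: quot_segs_iff)
  moreover have "(x, y) \<in> seg x y" "(y, z) \<in> seg y z" by (auto simp: mem_seg intro: exI[of _ 0])
  ultimately show "cup Q (seg x y) B = Some C"
    using z x relcomp_seg[OF in_X(2)] unfolding arc_circle_def by auto
qed

lemma segI: "le x y \<Longrightarrow> le y (th x) \<Longrightarrow> seg x y \<in> quot_segs X"
  by (auto simp: quot_segs_iff)

lemma le_th: "le x y \<Longrightarrow> le (th x) (th y)"
  using le_car[of x y] th_le_iff by blast

text \<open>Rotation turns x \<le> y \<le> z \<le> \<theta>(x) into z \<le> \<theta>(x) \<le>
  \<theta>(y) \<le> \<theta>(z), and the segment from \<theta>(x) to \<theta>(y) is the orbit of (x,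
  y) again.\<close>

lemma cup_rot_Q: "cup Q a b = Some c \<Longrightarrow> a \<in> quot_segs X \<Longrightarrow> cup Q (star Q c) a = Some (star Q b)"
proof -
  assume cup: "cup Q a b = Some c" and "a \<in> quot_segs X"
  then obtain x y where xy: "le x y" "le y (th x)" "a = seg x y" by (auto simp: quot_segs_iff)
  then obtain z where z: "le y z" "le z (th x)" "b = seg y z" "c = seg x z" using cup cup_iff by auto
  have in_X: "x \<in> acar X" "y \<in> acar X" "z \<in> acar X" using xy z le_car by blast+
  have "cup Q (seg z (th x)) (seg (th x) (th y)) = Some (seg z (th y))"
    using xy z le_th[of x y] le_th[of y z] le_th[of x z] le_trans[of x y z] by (subst cup_iff) auto
  moreover have "seg (th x) (th y) = a" using seg_T[of x y 1] xy in_X by (simp add: T_1)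
  ultimately show ?thesis using z in_X by simp
qed

lemma star_star_Q: "a \<in> quot_segs X \<Longrightarrow> star Q (star Q a) = a"
proof -
  assume "a \<in> quot_segs X"
  then obtain x y where xy: "le x y" "le y (th x)" "a = seg x y" by (auto simp: quot_segs_iff)
  then have "x \<in> acar X" "y \<in> acar X" using le_car by blast+
  then show ?thesis using seg_T[of x y 1] xy by (simp add: T_1 th_in)
qed

lemma star_in_Q: "a \<in> quot_segs X \<Longrightarrow> star Q a \<in> quot_segs X"
proof -
  assume "a \<in> quot_segs X"
  then obtain x y where xy: "le x y" "le y (th x)" "a = seg x y" by (auto simp: quot_segs_iff)
  then have "x \<in> acar X" "y \<in> acar X" using le_car by blast+
  then show ?thesis using xy le_th[of x y] by (auto intro!: segI)
qed

lemma cup_in_Q: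
  assumes "cup Q a b = Some c"
  shows "a \<in> quot_segs X" "b \<in> quot_segs X" "c \<in> quot_segs X"
proof -
  show a: "a \<in> quot_segs X" and b: "b \<in> quot_segs X"
    using assms by (auto simp: arc_circle_def split: if_splits)
  obtain x y where xy: "le x y" "le y (th x)" "a = seg x y" using a by (auto simp: quot_segs_iff)
  then obtain z where "le y z" "le z (th x)" "c = seg x z" using assms cup_iff by auto
  then show "c \<in> quot_segs X" using xy by (auto intro!: segI intro: le_trans)
qed

lemma abstract_circle_Q: "abstract_circle Q"
  unfolding abstract_circle_def Let_def circle_simps(1,2)
proof (intro conjI)
  show "bd0 Q ` quot_segs X \<subseteq> orb ` acar X" "bd1 Q ` quot_segs X \<subseteq> orb ` acar X"
    by (auto dest!: segE)
  show "zero_seg Q ` orb ` acar X \<subseteq> quot_segs X" "one_seg Q ` orb ` acar X \<subseteq> quot_segs X"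
    by (auto intro!: segI le_refl th_ge th_in)
  show "star Q ` quot_segs X \<subseteq> quot_segs X" using star_in_Q by blast
  show "\<forall>a b c. cup Q a b = Some c \<longrightarrow> a \<in> quot_segs X \<and> b \<in> quot_segs X \<and> c \<in> quot_segs X"
    using cup_in_Q by blast
  show "orb ` acar X \<noteq> {}" using nonempty by simp
  show "\<forall>x\<in>orb ` acar X. \<forall>y\<in>orb ` acar X. \<exists>a\<in>quot_segs X. bd0 Q a = x \<and> bd1 Q a = y"
  proof (clarify)
    fix x y assume x: "x \<in> acar X" and y: "y \<in> acar X"
    obtain m y' where y': "le x y'" "le y' (th x)" "y = T m y'" using fundamental_domain[OF x y] by blast
    then have "orb y = orb y'" using orb_T le_car by blast
    then show "\<exists>a\<in>quot_segs X. bd0 Q a = orb x \<and> bd1 Q a = orb y"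
      using segI[OF y'(1,2)] by (intro bexI[of _ "seg x y'"]) auto
  qed
  show "\<forall>x\<in>orb ` acar X. zero_seg Q x \<noteq> one_seg Q x"
    using th_neq[THEN not_sym] by (auto simp: seg_eq_left th_in)
  show "\<forall>a\<in>quot_segs X. star Q (star Q a) = a \<and> bd0 Q (star Q a) = bd1 Q a"
    using star_star_Q by (auto dest!: segE)
  show "\<forall>x\<in>orb ` acar X. bd0 Q (zero_seg Q x) = x \<and> bd1 Q (zero_seg Q x) = x \<and> star Q (zero_seg Q x) = one_seg Q x"
    by auto
  show "\<forall>a\<in>quot_segs X. \<forall>x\<in>orb ` acar X. bd0 Q a = x \<and> bd1 Q a = x \<longrightarrow> a = zero_seg Q x \<or> a = one_seg Q x"
  proof (intro ballI impI)
    fix a p assume "a \<in> quot_segs X" and p: "bd0 Q a = p \<and> bd1 Q a = p"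
    then obtain x y where xy: "x \<in> acar X" "y \<in> acar X" "le x y" "le y (th x)" "a = seg x y" using segE by blast
    then have "orb x = orb y" using p by auto
    then obtain m where m: "y = T m x" using orb_eq_iff[OF xy(1)] by blast
    \<comment> \<open>For a loop, y is a translate of x between x and \<theta>(x), which leaves only
      these two points.\<close>
    then have "0 \<le> m" "m \<le> 1" using xy T_le_T_iff[of x 0 m] T_le_T_iff[of x m 1] by (auto simp: T_1)
    then have "m = 0 \<or> m = 1" by auto
    then show "a = zero_seg Q p \<or> a = one_seg Q p" using m xy p by (auto simp: T_1)
  qed
  show "\<forall>a\<in>quot_segs X. \<forall>b\<in>quot_segs X. \<forall>c\<in>quot_segs X.
      cup Q a b = Some c \<longrightarrow> bd1 Q a = bd0 Q b \<and> bd1 Q c = bd1 Q b \<and> bd0 Q c = bd0 Q a"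
  proof (intro ballI impI)
    fix a b c assume "a \<in> quot_segs X" and "cup Q a b = Some c"
    moreover from this obtain x y where "x \<in> acar X" "y \<in> acar X" "le x y" "le y (th x)" "a = seg x y"
      using segE by blast
    ultimately show "bd1 Q a = bd0 Q b \<and> bd1 Q c = bd1 Q b \<and> bd0 Q c = bd0 Q a"
      by (auto simp: cup_iff)
  qed
  show "\<forall>a\<in>quot_segs X. \<forall>b\<in>quot_segs X. \<forall>c\<in>quot_segs X.
      (cup Q a b = Some c) = (cup Q (star Q c) a = Some (star Q b))"
  proof (intro ballI iffI)
    fix a b c assume abc: "a \<in> quot_segs X" "b \<in> quot_segs X" "c \<in> quot_segs X"
      and "cup Q (star Q c) a = Some (star Q b)"
    \<comment> \<open>The converse needs two further rotations, since three of them are the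
      identity.\<close>
    then have "cup Q (star Q (star Q b)) (star Q c) = Some (star Q a)" using star_in_Q cup_rot_Q by blast
    then have "cup Q b (star Q c) = Some (star Q a)" using abc star_star_Q by simp
    then have "cup Q (star Q (star Q a)) b = Some (star Q (star Q c))" using abc cup_rot_Q by blast
    then show "cup Q a b = Some c" using abc star_star_Q by simp
  qed (use cup_rot_Q in blast)
  show "\<forall>a\<in>quot_segs X. \<forall>b\<in>quot_segs X. \<forall>c\<in>quot_segs X. \<forall>ab\<in>quot_segs X. \<forall>abc\<in>quot_segs X.
      cup Q a b = Some ab \<and> cup Q ab c = Some abc \<longrightarrow> (\<exists>bc. cup Q b c = Some bc \<and> cup Q a bc = Some abc)"
  proof (intro ballI impI, elim conjE)
    fix a b c ab abc assume "a \<in> quot_segs X" and 1: "cup Q a b = Some ab" and 2: "cup Q ab c = Some abc"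
    then obtain x y where xy: "x \<in> acar X" "y \<in> acar X" "le x y" "le y (th x)" "a = seg x y" using segE by blast
    then obtain z where z: "le y z" "le z (th x)" "b = seg y z" "ab = seg x z" using 1 cup_iff by auto
    have xz: "le x z" using xy z le_trans by blast
    obtain w where w: "le z w" "le w (th x)" "c = seg z w" "abc = seg x w"
      using 2 cup_iff[OF xz z(2)] z by auto
    have "le (th x) (th y)" using xy le_th by blast
    then have "le z (th y)" "le w (th y)" "le y w" using z w le_trans by blast+
    then have "cup Q b c = Some (seg y w)" "cup Q a (seg y w) = Some abc"
      using xy z w by (auto simp: cup_iff)
    then show "\<exists>bc. cup Q b c = Some bc \<and> cup Q a bc = Some abc" by blast
  qed
  show "\<forall>a\<in>quot_segs X. \<forall>b\<in>quot_segs X. \<forall>x\<in>orb ` acar X. cup Q a b = Some (zero_seg Q x) \<longrightarrow> a = zero_seg Q x"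
  proof (intro ballI impI)
    fix a b p assume "a \<in> quot_segs X" and p: "p \<in> orb ` acar X" and 1: "cup Q a b = Some (zero_seg Q p)"
    then obtain x y where xy: "x \<in> acar X" "y \<in> acar X" "le x y" "le y (th x)" "a = seg x y" using segE by blast
    then obtain z where z: "le y z" "zero_seg Q p = seg x z" using 1 cup_iff by auto
    obtain w where w: "w \<in> acar X" "p = orb w" using p by blast
    then have "seg w w = seg x z" using z by simp
    then have "z = x" using seg_eq_iff w(1) by auto
    then show "a = zero_seg Q p" using xy z le_antisym by auto
  qed
  show "\<forall>a\<in>quot_segs X. \<forall>x\<in>orb ` acar X. bd0 Q a = x \<longrightarrow> cup Q (zero_seg Q x) a = Some a"
  proof (intro ballI impI)
    fix a p assume "a \<in> quot_segs X" and p: "bd0 Q a = p"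
    then obtain x y where "x \<in> acar X" "y \<in> acar X" "le x y" "le y (th x)" "a = seg x y" using segE by blast
    then show "cup Q (zero_seg Q p) a = Some a" using p by (auto simp: cup_iff le_refl th_ge)
  qed
  show "\<forall>a\<in>quot_segs X. \<forall>b\<in>quot_segs X. bd1 Q a = bd0 Q b \<longrightarrow> cup Q a b \<noteq> None \<or> cup Q (star Q b) (star Q a) \<noteq> None"
  proof (intro ballI impI)
    fix a b assume "a \<in> quot_segs X" "b \<in> quot_segs X" and ab: "bd1 Q a = bd0 Q b"
    then obtain x y y' z' where xy: "x \<in> acar X" "y \<in> acar X" "le x y" "le y (th x)" "a = seg x y"
      and b: "y' \<in> acar X" "z' \<in> acar X" "le y' z'" "le z' (th y')" "b = seg y' z'" using segE by metis
    then obtain m where m: "y' = T m y" using ab orb_eq_iff by auto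
    \<comment> \<open>The end of the lift of b that starts at y. Whether it stays below \<theta>(x)
      decides which union is shown to exist.\<close>
    define z where "z = T (- m) z'"
    have z: "z \<in> acar X" "b = seg y z" "le y z" "le z (th y)"
      using b m xy T_le[OF b(3), of "- m"] T_le[OF b(4), of "- m"] seg_T[of y z m]
      by (auto simp: z_def T_in T_minus T_th[symmetric] th_in)
    show "cup Q a b \<noteq> None \<or> cup Q (star Q b) (star Q a) \<noteq> None"
    proof (cases "le z (th x)")
      case True
      then have "cup Q a b = Some (seg x z)" using xy z by (auto simp: cup_iff)
      then show ?thesis by simp
    next
      case False
      then have "le (th x) z" using le_total z xy th_in by blast
      have 1: "star Q a = seg (th y) (th (th x))" using seg_T[of y "th x" 1] xy by (simp add: T_1 th_in)
      have "le (th (th x)) (th z)" using \<open>le (th x) z\<close> le_th by blast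
      then have "cup Q (star Q b) (star Q a) = Some (seg z (th (th x)))"
        using xy z le_th[of y "th x"] le_th[of y z] unfolding 1 by (auto simp: cup_iff)
      then show ?thesis by simp
    qed
  qed
qed

text \<open>Segments are orbits of pairs, and an infinite \<open>'a\<close> has no more pairs than
  elements.\<close>

lemma small_circle_Q:
  assumes "infinite (UNIV :: 'a set)"
  shows "small_circle Q"
proof -
  have "(UNIV :: 'a set) \<times> (UNIV :: 'a set) \<lesssim> (UNIV :: 'a set)"
    using card_of_Times_same_infinite[OF assms] by (intro eqpoll_imp_lepoll) (simp only: eqpoll_iff_card_of_ordIso)
  moreover have "quot_segs X \<lesssim> (UNIV \<times> UNIV :: ('a \<times> 'a) set)"
    unfolding quot_segs_def by (rule lepoll_trans[OF image_lepoll subset_imp_lepoll]) simp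
  moreover have "orb ` acar X \<lesssim> (UNIV :: 'a set)"
    by (rule lepoll_trans[OF image_lepoll subset_imp_lepoll]) simp
  ultimately show ?thesis by (auto simp: small_circle_def intro: lepoll_trans)
qed

end

section \<open>Functoriality of the circle\<close>

context arch_map
begin

lemma image_orb:
  assumes x: "x \<in> acar X"
  shows "(\<Union>g\<in>arc_class X Y f. g ` X.orb x) = Y.orb (f x)"
proof -
  have "g ` X.orb x = Y.orb (f x)" if g: "g \<in> arc_class X Y f" for g
  proof -
    obtain m where m: "g = (\<lambda>x\<in>acar X. Y.T m (f x))" using g class_iff by blast
    have "g (X.T k x) = Y.T k (Y.T m (f x))" for k
      using x by (simp add: m X.T_in commute_T app Y.T_commute[of "f x" m k])
    then have "g ` X.orb x = Y.orb (Y.T m (f x))" by (simp add: orbit_def image_image)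
    then show ?thesis using x by (simp add: Y.orb_T app)
  qed
  then show ?thesis using self_in_class by blast
qed

lemma image_seg:
  assumes x: "x \<in> acar X" and y: "y \<in> acar X"
  shows "(\<Union>g\<in>arc_class X Y f. map_prod g g ` X.seg x y) = Y.seg (f x) (f y)"
proof -
  have "map_prod g g ` X.seg x y = Y.seg (f x) (f y)" if g: "g \<in> arc_class X Y f" for g
  proof -
    obtain m where m: "g = (\<lambda>x\<in>acar X. Y.T m (f x))" using g class_iff by blast
    have "g (X.T k x) = Y.T k (Y.T m (f x))" "g (X.T k y) = Y.T k (Y.T m (f y))" for k
      using x y by (simp_all add: m X.T_in commute_T app Y.T_commute[of "f _" m k])
    then have "map_prod g g ` X.seg x y = Y.seg (Y.T m (f x)) (Y.T m (f y))" by (simp add: orbit2_def image_image)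
    then show ?thesis using x y by (simp add: Y.seg_T app)
  qed
  then show ?thesis using self_in_class by blast
qed

end

text \<open>\<open>Q_functor\<close> is defined on one category \<open>Arc\<close>, so the two
  carriers share a type.\<close>

locale arch_map_same = arch_map X Y f for X Y :: "'a arch" and f
begin

lemma Q_app:
  "x \<in> acar X \<Longrightarrow> fst (fmor Q_functor X Y (arc_class X Y f)) (X.orb x) = Y.orb (f x)"
  "X.le x y \<Longrightarrow> X.le y (X.th x) \<Longrightarrow> snd (fmor Q_functor X Y (arc_class X Y f)) (X.seg x y) = Y.seg (f x) (f y)"
  using X.segI[of x y] X.le_car[of x y] by (simp_all add: Q_functor_def image_orb image_seg)

lemma Q_hom: "fmor Q_functor X Y (arc_class X Y f) \<in> circle_hom X.Q Y.Q"
proof -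
  let ?F = "fmor Q_functor X Y (arc_class X Y f)"
  have le_f: "Y.le (f y) (Y.th (f x))" if "X.le y (X.th x)" "x \<in> acar X" for x y
    using mono[OF that(1)] that by (simp add: commute)
  have "(fst ?F, snd ?F) \<in> circle_hom X.Q Y.Q"
  proof (rule circle_homI, goal_cases)
    case (1 x) then show ?case by (auto simp: Q_app app)
  next
    case (2 a)
    then show ?case by (auto dest!: X.segE simp: Q_app intro!: Y.segI mono le_f)
  next
    case (10 a b c)
    then obtain x y where xy: "x \<in> acar X" "y \<in> acar X" "X.le x y" "X.le y (X.th x)" "a = X.seg x y" using X.segE[of a] by auto
    then obtain z where z: "X.le y z" "X.le z (X.th x)" "b = X.seg y z" "c = X.seg x z" using 10 X.cup_iff by auto
    have "X.le z (X.th y)" "X.le x z" using xy z X.le_th X.le_trans by blast+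
    then show ?case using xy z by (simp add: Q_app Y.cup_iff mono le_f) (blast intro: mono le_f)
  next
    case (7 a)
    then obtain x y where xy: "x \<in> acar X" "y \<in> acar X" "X.le x y" "X.le y (X.th x)" "a = X.seg x y" using X.segE[of a] by auto
    then show ?case using X.le_th[of x y] by (simp add: Q_app app commute)
  next
    case (9 p)
    then show ?case by (auto simp: Q_app app commute X.th_ge X.le_refl X.th_in)
  next
    case (5 a)
    then obtain x y where "x \<in> acar X" "y \<in> acar X" "X.le x y" "X.le y (X.th x)" "a = X.seg x y" using X.segE[of a] by auto
    then show ?case by (simp add: Q_app)
  next
    case (6 a)
    then obtain x y where "x \<in> acar X" "y \<in> acar X" "X.le x y" "X.le y (X.th x)" "a = X.seg x y" using X.segE[of a] by auto
    then show ?case by (simp add: Q_app)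
  next
    case (8 p)
    then show ?case by (auto simp: Q_app X.th_ge X.le_refl)
  qed (auto simp: Q_functor_def)
  then show ?thesis by simp
qed

end

lemma (in arch) circle_hom_eqI:
  assumes "h \<in> circle_hom Q L" "h' \<in> circle_hom Q L"
    and "\<And>x. x \<in> acar X \<Longrightarrow> fst h (orb x) = fst h' (orb x)"
    and "\<And>x y. le x y \<Longrightarrow> le y (th x) \<Longrightarrow> snd h (seg x y) = snd h' (seg x y)"
  shows "h = h'"
proof (rule prod_eqI)
  show "fst h = fst h'"
    using assms(3) by (intro PiE_ext[OF circle_hom_PiE(1)[OF assms(1)] circle_hom_PiE(1)[OF assms(2)]]) auto
  show "snd h = snd h'"
    using assms(4) by (intro PiE_ext[OF circle_hom_PiE(2)[OF assms(1)] circle_hom_PiE(2)[OF assms(2)]])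
      (auto simp: quot_segs_iff)
qed

lemma is_functor_Q:
  assumes "infinite (UNIV :: 'a set)"
  shows "is_functor (Arc :: ('a arch, ('a \<Rightarrow> 'a) set) category) Circ Q_functor"
  unfolding is_functor_def
proof (intro conjI ballI)
  fix X :: "'a arch" assume X: "X \<in> Ob Arc"
  interpret X: arch X using X by unfold_locales simp
  show "fobj Q_functor X \<in> Ob Circ"
    using X.abstract_circle_Q X.small_circle_Q[OF assms] by (simp add: Q_functor_def)
  interpret I: arch_map_same X X "\<lambda>x\<in>acar X. x" using X by unfold_locales (simp add: arc_maps_id)
  show "fmor Q_functor X X (Idn Arc X) = Idn Circ (fobj Q_functor X)"
    by (rule X.circle_hom_eqI[of _ X.Q])
      (use I.Q_hom circle_hom_id[OF X.abstract_circle_Q] X.le_car in \<open>auto simp: I.Q_app Q_functor_def[THEN arg_cong[of _ _ fobj]] X.segI\<close>)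
  fix Y :: "'a arch" and F assume Y: "Y \<in> Ob Arc" and F: "F \<in> Hom Arc X Y"
  interpret Y: arch Y using Y by unfold_locales simp
  obtain f where f: "f \<in> arc_maps X Y" "F = arc_class X Y f" using F by (auto elim: arc_homE)
  interpret f: arch_map_same X Y f using f by unfold_locales
  show "fmor Q_functor X Y F \<in> Hom Circ (fobj Q_functor X) (fobj Q_functor Y)"
    using f.Q_hom f by (simp add: Q_functor_def)
  fix Z :: "'a arch" and G assume Z: "Z \<in> Ob Arc" and G: "G \<in> Hom Arc Y Z"
  interpret Z: arch Z using Z by unfold_locales simp
  obtain g where g: "g \<in> arc_maps Y Z" "G = arc_class Y Z g" using G by (auto elim: arc_homE)
  interpret g: arch_map_same Y Z g using g by unfold_locales
  interpret gf: arch_map_same X Z "compose (acar X) g f"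
    using arc_maps_compose[OF X.arch Y.arch Z.arch f(1) g(1)] by unfold_locales
  have fob: "fobj Q_functor V = arc_circle V" for V :: "'a arch" by (simp add: Q_functor_def)
  have comp: "Cmp Arc X Y Z G F = arc_class X Z (compose (acar X) g f)"
    using arc_comp_class[OF X.arch Y.arch Z.arch f(1) g(1)] f g by simp
  show "fmor Q_functor X Z (Cmp Arc X Y Z G F) =
      Cmp Circ (fobj Q_functor X) (fobj Q_functor Y) (fobj Q_functor Z) (fmor Q_functor Y Z G) (fmor Q_functor X Y F)"
    unfolding comp fob
  proof (rule X.circle_hom_eqI[OF gf.Q_hom])
    show "Cmp Circ X.Q Y.Q Z.Q (fmor Q_functor Y Z G) (fmor Q_functor X Y F) \<in> circle_hom X.Q Z.Q"
      using circle_hom_compose[OF X.abstract_circle_Q Y.abstract_circle_Q Z.abstract_circle_Q,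
          of "fst (fmor Q_functor X Y F)" "snd (fmor Q_functor X Y F)"] f.Q_hom g.Q_hom f g by simp
    fix x assume x: "x \<in> acar X"
    then show "fst (fmor Q_functor X Z (arc_class X Z (compose (acar X) g f))) (X.orb x)
        = fst (Cmp Circ X.Q Y.Q Z.Q (fmor Q_functor Y Z G) (fmor Q_functor X Y F)) (X.orb x)"
      using f g by (simp add: gf.Q_app f.Q_app g.Q_app f.app compose_eq)
  next
    fix x y assume xy: "X.le x y" "X.le y (X.th x)"
    then have "x \<in> acar X" "y \<in> acar X" using X.le_car by blast+
    then show "snd (fmor Q_functor X Z (arc_class X Z (compose (acar X) g f))) (X.seg x y)
        = snd (Cmp Circ X.Q Y.Q Z.Q (fmor Q_functor Y Z G) (fmor Q_functor X Y F)) (X.seg x y)"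
      using f g xy f.mono[OF xy(1)] f.mono[OF xy(2)]
      by (simp add: gf.Q_app f.Q_app g.Q_app f.app compose_eq X.segI f.commute)
  qed
qed

section \<open>Full faithfulness\<close>

lemma Q_faithful:
  assumes X: "archimedean_set X" and Y: "archimedean_set Y" and FG: "F \<in> arc_hom X Y" "G \<in> arc_hom X Y"
    and eq: "fmor Q_functor X Y F = fmor Q_functor X Y G"
  shows "F = G"
proof -
  obtain f g where f: "f \<in> arc_maps X Y" "F = arc_class X Y f" and g: "g \<in> arc_maps X Y" "G = arc_class X Y g"
    using FG by (auto elim!: arc_homE)
  interpret f: arch_map_same X Y f using X Y f by unfold_locales
  interpret g: arch_map_same X Y g using X Y g by unfold_locales
  obtain x0 where x0: "x0 \<in> acar X" using f.X.nonempty by blast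
  have "f.Y.orb (g x0) = f.Y.orb (f x0)" using eq f.Q_app(1)[OF x0] g.Q_app(1)[OF x0] f g by simp
  \<comment> \<open>The images of the base point may differ by a power of \<theta>; once g is
    shifted by it, both lifts of every segment start at the same point.\<close>
  then obtain m where m: "f x0 = f.Y.T m (g x0)" using f.Y.orb_eq_iff g.app x0 by blast
  have "f = (\<lambda>x\<in>acar X. f.Y.T m (g x))"
  proof (rule arc_maps_eqI[OF X Y x0 f(1) g.shift])
    fix x assume x: "f.X.le x0 x" "f.X.le x (f.X.th x0)"
    then have in_X: "x \<in> acar X" using f.X.le_car by blast
    have "f.Y.seg (f x0) (f x) = f.Y.seg (g x0) (g x)"
      using eq f.Q_app(2)[OF x] g.Q_app(2)[OF x] f g by simp
    also have "\<dots> = f.Y.seg (f x0) (f.Y.T m (g x))" using f.Y.seg_T g.app x0 in_X unfolding m by simp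
    finally show "f x = (\<lambda>x\<in>acar X. f.Y.T m (g x)) x" using f.Y.seg_eq_left f.app x0 in_X by simp
  qed
  then have "arc_class X Y f = arc_class X Y g" using g.class_shift[of m] by simp
  then show ?thesis using f g by simp
qed

lemma Q_full:
  assumes X: "archimedean_set X" and Y: "archimedean_set Y" and hom: "(p, s) \<in> circle_hom (arc_circle X) (arc_circle Y)"
  shows "\<exists>F\<in>arc_hom X Y. fmor Q_functor X Y F = (p, s)"
proof -
  interpret X: arch X using X by unfold_locales
  interpret Y: arch Y using Y by unfold_locales
  interpret ps: circ_hom X.Q Y.Q p s
    using hom X.abstract_circle_Q Y.abstract_circle_Q by unfold_locales
  obtain x0 where x0: "x0 \<in> acar X" using X.nonempty by blast
  obtain y0 where y0: "y0 \<in> acar Y" "p (X.orb x0) = Y.orb y0" using ps.f_in[of "X.orb x0"] x0 by auto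
  let ?D = "\<lambda>x. X.le x0 x \<and> X.le x (X.th x0)"
  have lift: "\<exists>w. Y.le v w \<and> Y.le w (Y.th v) \<and> s (X.seg x x') = Y.seg v w"
    if xx': "X.le x x'" "X.le x' (X.th x)" and v: "v \<in> acar Y" "p (X.orb x) = Y.orb v" for x x' v
  proof -
    have "s (X.seg x x') \<in> quot_segs Y" using ps.g_in X.segI xx' by simp
    then obtain v' w' where v'w': "Y.le v' w'" "Y.le w' (Y.th v')" "s (X.seg x x') = Y.seg v' w'"
      by (auto simp: Y.quot_segs_iff)
    have in_Y: "v' \<in> acar Y" "w' \<in> acar Y" using v'w' Y.le_car by blast+
    have "Y.orb v' = Y.orb v" using ps.d0_g[of "X.seg x x'"] v v'w' X.segI xx' by simp
    then obtain m where m: "v = Y.T m v'" using Y.orb_eq_iff in_Y by blast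
    have "Y.le v (Y.T m w')" "Y.le (Y.T m w') (Y.th v)"
      using Y.T_le[OF v'w'(1)] Y.T_le[OF v'w'(2)] in_Y by (simp_all add: m Y.T_th)
    moreover have "s (X.seg x x') = Y.seg v (Y.T m w')" using v'w' in_Y by (simp add: m Y.seg_T)
    ultimately show ?thesis by blast
  qed
  have "\<forall>x. ?D x \<longrightarrow> (\<exists>w. Y.le y0 w \<and> Y.le w (Y.th y0) \<and> s (X.seg x0 x) = Y.seg y0 w)"
    using lift y0 by blast
  then obtain h where h: "\<And>x. ?D x \<Longrightarrow> Y.le y0 (h x) \<and> Y.le (h x) (Y.th y0) \<and> s (X.seg x0 x) = Y.seg y0 (h x)"
    by metis
  have h_in: "h x \<in> acar Y" if "?D x" for x using h[OF that] Y.le_car by blast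
  have D0: "?D x0" and D1: "?D (X.th x0)" using X.le_refl X.th_ge X.th_in x0 by auto
  have h0: "h x0 = y0"
    using h[OF D0] ps.z_f[of "X.orb x0"] x0 y0 Y.seg_eq_left[of y0 y0] by auto
  \<comment> \<open>The circle morphism preserves 1, which gives the joining condition of
    \<open>arc_maps_extend\<close>.\<close>
  have h1: "h (X.th x0) = Y.th y0"
    using h[OF D1] ps.e_f[of "X.orb x0"] x0 y0 Y.seg_eq_left[of y0 "Y.th y0"] by (auto simp: Y.th_in)
  \<comment> \<open>Monotonicity comes from preservation of unions: the lifted image of the segment
    from \<open>x0\<close> to x' passes through the end of the one from \<open>x0\<close> to
    x.\<close>
  have hseg: "Y.le (h x) (h x') \<and> s (X.seg x x') = Y.seg (h x) (h x')"
    if x: "?D x" "?D x'" "X.le x x'" for x x'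
  proof -
    have "cup X.Q (X.seg x0 x) (X.seg x x') = Some (X.seg x0 x')" using x by (auto simp: X.cup_iff)
    then have "cup Y.Q (Y.seg y0 (h x)) (s (X.seg x x')) = Some (Y.seg y0 (h x'))"
      using ps.cup_g h[OF x(1)] h[OF x(2)] by fastforce
    then obtain w where "Y.le (h x) w" "s (X.seg x x') = Y.seg (h x) w" "Y.seg y0 (h x') = Y.seg y0 w"
      using Y.cup_iff h[OF x(1)] by auto
    then show ?thesis using Y.seg_eq_left y0 h_in[OF x(2)] by metis
  qed
  have "\<exists>g\<in>arc_maps X Y. \<forall>x. ?D x \<longrightarrow> g x = h x"
  proof (rule arc_maps_extend[OF X Y x0])
    fix x x' assume "X.le x0 x" "X.le x x'" "X.le x' (X.th x0)"
    then have "?D x" "?D x'" using X.le_trans by blast+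
    then show "Y.le (h x) (h x')" using hseg \<open>X.le x x'\<close> by blast
  qed (use h_in h0 h1 in auto)
  then obtain g where g: "g \<in> arc_maps X Y" and gh: "\<And>x. ?D x \<Longrightarrow> g x = h x" by blast
  interpret g: arch_map_same X Y g using g by unfold_locales
  have "fmor Q_functor X Y (arc_class X Y g) = (p, s)"
  proof (rule X.circle_hom_eqI[OF g.Q_hom hom])
    fix x assume x: "x \<in> acar X"
    obtain m x' where x': "X.le x0 x'" "X.le x' (X.th x0)" "x = X.T m x'" using X.fundamental_domain[OF x0 x] by blast
    then have "x' \<in> acar X" "X.orb x = X.orb x'" using X.orb_T X.le_car by blast+
    moreover have "p (X.orb x') = Y.orb (h x')"
      using ps.d1_g[of "X.seg x0 x'"] h[of x'] x' X.segI by simp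
    ultimately show "fst (fmor Q_functor X Y (arc_class X Y g)) (X.orb x) = fst (p, s) (X.orb x)"
      using g.Q_app(1)[of x'] gh[of x'] x' by simp
  next
    fix x x' assume xx': "X.le x x'" "X.le x' (X.th x)"
    then have in_X: "x \<in> acar X" "x' \<in> acar X" using X.le_car by blast+
    obtain m a where a: "X.le x0 a" "X.le a (X.th x0)" "x = X.T m a" using X.fundamental_domain[OF x0 in_X(1)] by blast
    define b where "b = X.T (- m) x'"
    have aX: "a \<in> acar X" "b \<in> acar X" using a in_X X.le_car X.T_in unfolding b_def by blast+
    have ab: "X.le a b" "X.le b (X.th a)"
      using X.T_le[OF xx'(1), of "- m"] X.T_le[OF xx'(2), of "- m"] a aX in_X
      by (simp_all add: b_def X.T_minus X.T_th[symmetric] X.th_in)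
    have "x' = X.T m b" using in_X by (simp add: b_def X.T_minus)
    then have seg: "X.seg x x' = X.seg a b" using a aX X.seg_T by simp
    have "s (X.seg a b) = Y.seg (g a) (g b)"
    proof (cases "X.le b (X.th x0)")
      case True
      then have "?D b" using a ab X.le_trans by blast
      then show ?thesis using hseg[of a b] gh a ab by auto
    next
      case False
      \<comment> \<open>The segment crosses the end of the fundamental interval. It is cut at
        \<theta>(\<open>x0\<close>), and its second part is the translate of the segment from
        \<open>x0\<close> to c, where b = \<theta>(c).\<close>
      then have 1: "X.le (X.th x0) b" using X.le_total aX x0 X.th_in by blast
      define c where "c = X.T (-1) b"
      have b: "b = X.th c" using aX X.T_minus(2)[of b 1] by (simp add: c_def X.T_1)
      have cX: "c \<in> acar X" using aX X.T_in by (simp add: c_def)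
      have c: "X.le x0 c" "X.le c a" using 1 ab X.th_le_iff x0 cX aX unfolding b by blast+
      then have Dc: "?D c" using a X.le_trans by blast
      have "X.le b (X.th a)" "X.le (X.th x0) (X.th a)" using ab X.le_th a by blast+
      then have "cup X.Q (X.seg a (X.th x0)) (X.seg (X.th x0) b) = Some (X.seg a b)"
        using a 1 by (auto simp: X.cup_iff)
      then have "cup Y.Q (s (X.seg a (X.th x0))) (s (X.seg (X.th x0) b)) = Some (s (X.seg a b))" by (rule ps.cup_g)
      moreover have 2: "s (X.seg a (X.th x0)) = Y.seg (h a) (Y.th y0)" using hseg[OF _ D1, of a] a h1 by simp
      moreover have "X.seg (X.th x0) b = X.seg x0 c" using X.seg_T[of x0 c 1] x0 cX b by (simp add: X.T_1)
      then have "s (X.seg (X.th x0) b) = Y.seg y0 (h c)" using h[OF Dc] by simp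
      then have "s (X.seg (X.th x0) b) = Y.seg (Y.th y0) (Y.th (h c))"
        using Y.seg_T[of y0 "h c" 1] y0 h_in[OF Dc] by (simp add: Y.T_1)
      ultimately have "cup Y.Q (Y.seg (h a) (Y.th y0)) (Y.seg (Y.th y0) (Y.th (h c))) = Some (s (X.seg a b))" by simp
      moreover have "Y.le (h a) (Y.th y0)" "Y.le (Y.th y0) (Y.th (h a))" using h[of a] a Y.le_th by blast+
      ultimately obtain w where "Y.seg (Y.th y0) (Y.th (h c)) = Y.seg (Y.th y0) w" "s (X.seg a b) = Y.seg (h a) w"
        using Y.cup_iff by auto
      then have "s (X.seg a b) = Y.seg (h a) (Y.th (h c))"
        using Y.seg_eq_left[of "Y.th y0" "Y.th (h c)" w] y0 h_in[OF Dc] Y.th_in by simp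
      then show ?thesis using gh[of a] gh[OF Dc] a b g.commute[OF cX] by simp
    qed
    then show "snd (fmor Q_functor X Y (arc_class X Y g)) (X.seg x x') = snd (p, s) (X.seg x x')"
      using g.Q_app(2)[OF ab] seg by simp
  qed
  then show ?thesis using arc_class_in_hom[OF g] by blast
qed


text \<open>A morphism out of X/\<theta> amounts to \<theta>-invariant data on points and pairs of
  X. Representatives are picked by \<open>SOME\<close>, and invariance under all powers of \<theta>
  makes the choice harmless.\<close>

lemma (in arch) circle_hom_from_orbits:
  assumes \<pi>_in: "\<And>x. x \<in> acar X \<Longrightarrow> \<pi> x \<in> Pts K"
    and \<tau>_in: "\<And>x y. le x y \<Longrightarrow> le y (th x) \<Longrightarrow> \<tau> x y \<in> Segs K"
    and \<pi>_th: "\<And>x. x \<in> acar X \<Longrightarrow> \<pi> (th x) = \<pi> x"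
    and \<tau>_th: "\<And>x y. le x y \<Longrightarrow> le y (th x) \<Longrightarrow> \<tau> (th x) (th y) = \<tau> x y"
    and d: "\<And>x y. le x y \<Longrightarrow> le y (th x) \<Longrightarrow> bd0 K (\<tau> x y) = \<pi> x \<and> bd1 K (\<tau> x y) = \<pi> y"
    and zero: "\<And>x. x \<in> acar X \<Longrightarrow> zero_seg K (\<pi> x) = \<tau> x x"
    and one: "\<And>x. x \<in> acar X \<Longrightarrow> one_seg K (\<pi> x) = \<tau> x (th x)"
    and star: "\<And>x y. le x y \<Longrightarrow> le y (th x) \<Longrightarrow> star K (\<tau> x y) = \<tau> y (th x)"
    and cup: "\<And>x y z. le x y \<Longrightarrow> le y z \<Longrightarrow> le z (th x) \<Longrightarrow> cup K (\<tau> x y) (\<tau> y z) = Some (\<tau> x z)"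
  shows "\<exists>h\<in>circle_hom Q K. \<forall>x\<in>acar X. fst h (orb x) = \<pi> x"
proof -
  have \<pi>_T: "\<pi> (T m x) = \<pi> x" if "x \<in> acar X" for m x
  proof (induction m rule: int_induct[where k = 0])
    case (step1 i)
    then show ?case using that \<pi>_th[of "T i x"] by (simp add: T_plus_1 T_in)
  next
    case (step2 i)
    then show ?case using that \<pi>_th[of "T (i - 1) x"] T_plus_1[of x "i - 1"] by (simp add: T_in)
  qed simp
  have \<tau>_T: "\<tau> (T m x) (T m y) = \<tau> x y" if xy: "le x y" "le y (th x)" for m x y
  proof -
    have in_X: "x \<in> acar X" "y \<in> acar X" using xy le_car by blast+
    have le: "le (T i x) (T i y)" "le (T i y) (th (T i x))" for i
      using T_le[OF xy(1), of i] T_le[OF xy(2), of i] in_X by (simp_all add: T_th)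
    show ?thesis
    proof (induction m rule: int_induct[where k = 0])
      case (step1 i)
      then show ?case using in_X \<tau>_th[OF le[of i]] by (simp add: T_plus_1)
    next
      case (step2 i)
      then show ?case using in_X \<tau>_th[OF le[of "i - 1"]] T_plus_1[of x "i - 1"] T_plus_1[of y "i - 1"] by simp
    qed simp
  qed
  define f where "f = (\<lambda>p\<in>Pts Q. \<pi> (SOME x. x \<in> acar X \<and> p = orb x))"
  define ok where "ok A q \<longleftrightarrow> le (fst q) (snd q) \<and> le (snd q) (th (fst q)) \<and> A = seg (fst q) (snd q)" for A q
  define g where "g = (\<lambda>A\<in>Segs Q. \<tau> (fst (SOME q. ok A q)) (snd (SOME q. ok A q)))"
  have f: "f (orb x) = \<pi> x" if x: "x \<in> acar X" for x
  proof -
    let ?y = "SOME y. y \<in> acar X \<and> orb x = orb y"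
    have "?y \<in> acar X \<and> orb x = orb ?y" by (rule someI[of _ x]) (use x in simp)
    then obtain m where "?y = T m x" using orb_eq_iff[OF x] by blast
    then show ?thesis using x by (simp add: f_def \<pi>_T)
  qed
  have g: "g (seg x y) = \<tau> x y" if xy: "le x y" "le y (th x)" for x y
  proof -
    have in_X: "x \<in> acar X" "y \<in> acar X" using xy le_car by blast+
    let ?q = "SOME q. ok (seg x y) q"
    have "ok (seg x y) ?q" by (rule someI[of _ "(x, y)"]) (use xy in \<open>simp add: ok_def\<close>)
    then have "seg x y = seg (fst ?q) (snd ?q)" by (simp only: ok_def)
    then obtain m where "fst ?q = T m x" "snd ?q = T m y" using seg_eq_iff[OF in_X] by blast
    then show ?thesis using xy by (simp add: g_def \<tau>_T segI)
  qed
  have "(f, g) \<in> circle_hom Q K"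
  proof (rule circle_homI, goal_cases)
    case (1 p)
    then show ?case by (auto simp: f \<pi>_in)
  next
    case (2 a)
    then show ?case by (auto dest!: segE simp: g \<tau>_in)
  next
    case (5 a)
    then obtain x y where "x \<in> acar X" "le x y" "le y (th x)" "a = seg x y" using segE[of a] by auto
    then show ?case by (simp add: f g d)
  next
    case (6 a)
    then obtain x y where "y \<in> acar X" "le x y" "le y (th x)" "a = seg x y" using segE[of a] by auto
    then show ?case by (simp add: f g d)
  next
    case (7 a)
    then obtain x y where "x \<in> acar X" "le x y" "le y (th x)" "a = seg x y" using segE[of a] by auto
    then show ?case by (simp add: g star le_th)
  next
    case (8 p)
    then show ?case by (auto simp: f g zero le_refl th_ge)
  next
    case (9 p)
    then show ?case by (auto simp: f g one le_refl th_ge th_in)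
  next
    case (10 a b c)
    then obtain x y where xy: "le x y" "le y (th x)" "a = seg x y" using segE[of a] by auto
    then obtain z where z: "le y z" "le z (th x)" "b = seg y z" "c = seg x z" using 10 cup_iff by auto
    have "le z (th y)" "le x z" using xy z le_th le_trans by blast+
    then show ?case using xy z by (simp add: g cup)
  qed (auto simp: f_def g_def)
  then show ?thesis using f by (intro bexI[of _ "(f, g)"]) simp_all
qed

section \<open>Unrolling an abstract circle at a base point\<close>

locale based_circ = circ K for K :: "('p, 's) acircle" +
  fixes p0
  assumes p0: "p0 \<in> Pts K"
begin

text \<open>The segment 1 at \<open>p0\<close> has the same end as 0 and belongs to the next copy.
  With it removed, \<open>d1\<close> becomes a bijection onto the points.\<close>

definition A where "A = {a \<in> S. d0 a = p0 \<and> a \<noteq> e p0}"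
definition r where "r = {(a, b). a \<in> A \<and> b \<in> A \<and> (\<exists>c. u a c = Some b)}"
definition dif where "dif a b = (THE c. u a c = Some b)"

text \<open>After one rotation the complement of c is itself a union, namely of the complement of b
  with a.\<close>

lemma cup_right_unique: "u a c = Some b \<Longrightarrow> u a c' = Some b \<Longrightarrow> c = c'"
  using cup_rot[of a c b] cup_rot[of a c' b] st_st cup_in by (metis option.inject)

lemma difI: "u a c = Some b \<Longrightarrow> dif a b = c"
  unfolding dif_def using cup_right_unique by blast

lemma cup_dif: "(a, b) \<in> r \<Longrightarrow> u a (dif a b) = Some b"
  using difI by (auto simp: r_def)

lemma dif: "(a, b) \<in> r \<Longrightarrow> dif a b \<in> S" "(a, b) \<in> r \<Longrightarrow> d0 (dif a b) = d1 a" "(a, b) \<in> r \<Longrightarrow> d1 (dif a b) = d1 b"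
  using cup_dif[of a b] cup_in cup_d by metis+

lemma dif_self: "a \<in> A \<Longrightarrow> dif a a = z (d1 a)"
  using cup_z by (auto simp: A_def intro: difI)

lemma cup_dif_dif: "(a, b) \<in> r \<Longrightarrow> (b, c) \<in> r \<Longrightarrow> u (dif a b) (dif b c) = Some (dif a c)"
  using cup_assoc[OF cup_dif cup_dif, of a b c] difI by metis

lemma r_refl: "a \<in> A \<Longrightarrow> (a, a) \<in> r"
  using cup_z by (auto simp: A_def r_def)

lemma r_trans: "(a, b) \<in> r \<Longrightarrow> (b, c) \<in> r \<Longrightarrow> (a, c) \<in> r"
  using cup_assoc[OF cup_dif cup_dif, of a b c] by (auto simp: r_def)

lemma r_total: "a \<in> A \<Longrightarrow> b \<in> A \<Longrightarrow> (a, b) \<in> r \<or> (b, a) \<in> r"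
  using comparable[of a b] by (auto simp: A_def r_def)

text \<open>The difference is then a loop. If it were 1, then b would be a full turn and hence the
  excluded segment 1 at \<open>p0\<close>.\<close>

lemma r_d1:
  assumes ab: "(a, b) \<in> r" and d1: "d1 a = d1 b"
  shows "a = b"
proof -
  have a: "a \<in> A" and b: "b \<in> A" using ab by (auto simp: r_def)
  consider "dif a b = z (d1 a)" | "dif a b = e (d1 a)"
    using loop[of "dif a b" "d1 a"] dif[OF ab] d1 by auto
  then show ?thesis
  proof cases
    case 1
    then show ?thesis using cup_dif[OF ab] cup_z[of a] a by (simp add: A_def)
  next
    case 2
    then have "b = e (d1 a)" using cup_eD[of a "d1 a" b] cup_dif[OF ab] a d1_in by (simp add: A_def)
    moreover have "d0 (e (d1 a)) = d1 a" using a d1_in d0_e by (simp add: A_def)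
    ultimately show ?thesis using b by (auto simp: A_def)
  qed
qed

text \<open>The two differences have union 0, which by \<open>cup_zD\<close> forces the first of
  them to be 0.\<close>

lemma r_antisym: "(a, b) \<in> r \<Longrightarrow> (b, a) \<in> r \<Longrightarrow> a = b"
proof -
  assume ab: "(a, b) \<in> r" and ba: "(b, a) \<in> r"
  have a: "a \<in> A" using ab by (auto simp: r_def)
  have "u (dif a b) (dif b a) = Some (z (d1 a))" using cup_dif_dif[OF ab ba] dif_self[OF a] by simp
  from cup_zD[OF this] have "dif a b = z (d1 a)" using a d1_in by (simp add: A_def)
  then show "a = b" using cup_dif[OF ab] cup_z[of a] a by (simp add: A_def)
qed

lemma linear_r: "linear_order_on A r"
proof -
  have "r \<subseteq> A \<times> A" by (auto simp: r_def)
  then show ?thesis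
    unfolding order_on_defs
    by (intro conjI refl_onI transI antisymI total_onI) (use r_refl r_trans r_antisym r_total in blast)+
qed

lemma z_in_A: "z p0 \<in> A"
  using p0 z_in d0_z z_neq_e by (simp add: A_def)

lemma bij_d1: "bij_betw d1 A P"
proof (rule bij_betwI')
  show "d1 a \<in> P" if "a \<in> A" for a using that d1_in by (simp add: A_def)
  show "(d1 a = d1 b) = (a = b)" if "a \<in> A" "b \<in> A" for a b
    using r_total[OF that] r_d1[of a b] r_d1[of b a] by auto
  fix x assume x: "x \<in> P"
  obtain a where a: "a \<in> S" "d0 a = p0" "d1 a = x" using connect p0 x by blast
  show "\<exists>a\<in>A. x = d1 a"
  proof (cases "a = e p0")
    case True
    then have "x = d1 (z p0)" using a p0 d1_e d1_z by simp
    then show ?thesis using z_in_A by blast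
  next
    case False
    then show ?thesis using a by (auto simp: A_def)
  qed
qed

text \<open>The injection \<open>h\<close> moves the carrier \<open>\<int> \<times> A\<close> into the type \<open>'a\<close>.\<close>

lemma unrolling:
  fixes h :: "int \<times> 's \<Rightarrow> 'a"
  assumes h: "inj_on h (UNIV \<times> A)"
  shows "\<exists>X::'a arch. archimedean_set X \<and> (\<exists>k\<in>circle_hom (arc_circle X) K. bij_betw (fst k) (Pts (arc_circle X)) P)"
proof -
  define lv where "lv x = fst (inv_into (UNIV \<times> A) h x)" for x
  define co where "co x = snd (inv_into (UNIV \<times> A) h x)" for x
  have lv_h [simp]: "a \<in> A \<Longrightarrow> lv (h (n, a)) = n" and co_h [simp]: "a \<in> A \<Longrightarrow> co (h (n, a)) = a" for n a
    using inv_into_f_f[OF h, of "(n, a)"] by (simp_all add: lv_def co_def)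
  define X where "X = \<lparr>acar = h ` (UNIV \<times> A),
    aord = {(x, y). x \<in> h ` (UNIV \<times> A) \<and> y \<in> h ` (UNIV \<times> A) \<and>
      (lv x < lv y \<or> lv x = lv y \<and> (co x, co y) \<in> r)},
    theta = \<lambda>x. h (lv x + 1, co x)\<rparr>"
  have car: "acar X = h ` (UNIV \<times> A)" and theta: "a \<in> A \<Longrightarrow> theta X (h (n, a)) = h (n + 1, a)" for n a
    by (simp_all add: X_def)
  have le: "(x, y) \<in> aord X \<longleftrightarrow> x \<in> acar X \<and> y \<in> acar X \<and> (lv x < lv y \<or> lv x = lv y \<and> (co x, co y) \<in> r)" for x y
    by (simp add: X_def)
  have X: "archimedean_set X"
  proof (rule archimedean_lexI[OF linear_r _ h car])
    show "A \<noteq> {}" using z_in_A by blast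
    show "((h (n, a), h (m, b)) \<in> aord X) = (n < m \<or> n = m \<and> (a, b) \<in> r)" if "a \<in> A" "b \<in> A" for n m a b
      using that by (auto simp: le car)
    show "aord X \<subseteq> acar X \<times> acar X" by (auto simp: le)
  qed (rule theta)
  interpret X: arch X using X by unfold_locales
  have carE: "\<exists>n a. a \<in> A \<and> x = h (n, a)" if "x \<in> acar X" for x using that by (auto simp: car)
  have lv_th: "lv (X.th x) = lv x + 1" "co (X.th x) = co x" "co x \<in> A" if "x \<in> acar X" for x
    using carE[OF that] by (auto simp: theta)
  \<comment> \<open>A lifted segment stays in its copy of A or crosses to the next one; in the
    latter case the end is at or before the start in the order of A, as it may not pass
    \<theta>(x).\<close>
  have seg_cases: "lv y = lv x \<and> (co x, co y) \<in> r \<or> lv y = lv x + 1 \<and> (co y, co x) \<in> r"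
    if "X.le x y" "X.le y (X.th x)" for x y
  proof -
    have "lv (X.th x) = lv x + 1" "co (X.th x) = co x" using lv_th X.le_car that by blast+
    then show ?thesis using that by (auto simp: le)
  qed
  define \<pi> where "\<pi> x = d1 (co x)" for x
  \<comment> \<open>In the crossing case the segment from x to y is the complement of the one from y
    to \<theta>(x), and the latter does not cross.\<close>
  define \<tau> where "\<tau> x y = (if lv x = lv y then dif (co x) (co y) else st (dif (co y) (co x)))" for x y
  have "\<exists>k\<in>circle_hom X.Q K. \<forall>x\<in>acar X. fst k (X.orb x) = \<pi> x"
  proof (rule X.circle_hom_from_orbits[where \<tau> = \<tau>])
    fix x assume x: "x \<in> acar X"
    note 1 = lv_th[OF x]
    show "\<pi> x \<in> P" using 1 d1_in by (simp add: \<pi>_def A_def)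
    show "\<pi> (X.th x) = \<pi> x" using 1 by (simp add: \<pi>_def)
    show "z (\<pi> x) = \<tau> x x" using 1 by (simp add: \<pi>_def \<tau>_def dif_self)
    show "e (\<pi> x) = \<tau> x (X.th x)" using 1 st_z d1_in by (simp add: \<pi>_def \<tau>_def dif_self A_def)
  next
    fix x y assume xy: "X.le x y" "X.le y (X.th x)"
    have in_X: "x \<in> acar X" "y \<in> acar X" using xy X.le_car by blast+
    note 1 = lv_th[OF in_X(1)] lv_th[OF in_X(2)] seg_cases[OF xy]
    show "\<tau> (X.th x) (X.th y) = \<tau> x y" using 1 by (simp add: \<tau>_def)
    consider "lv y = lv x" "(co x, co y) \<in> r" | "lv y = lv x + 1" "(co y, co x) \<in> r"
      using seg_cases[OF xy] by blast
    then have "\<tau> x y \<in> S \<and> (d0 (\<tau> x y) = \<pi> x \<and> d1 (\<tau> x y) = \<pi> y) \<and> st (\<tau> x y) = \<tau> y (X.th x)"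
      by cases (simp_all add: \<tau>_def \<pi>_def dif st_in d0_st d1_st st_st 1(1-6))
    then show "\<tau> x y \<in> S" "d0 (\<tau> x y) = \<pi> x \<and> d1 (\<tau> x y) = \<pi> y" "st (\<tau> x y) = \<tau> y (X.th x)" by blast+
  next
    fix x y w assume xyw: "X.le x y" "X.le y w" "X.le w (X.th x)"
    have 1: "X.le y (X.th x)" "X.le x w" "X.le w (X.th y)" using xyw X.le_th X.le_trans by blast+
    note 2 = seg_cases[OF xyw(1) 1(1)] seg_cases[OF 1(2) xyw(3)] seg_cases[OF xyw(2) 1(3)]
    have 3: "co y \<in> A" using lv_th X.le_car xyw by blast
    \<comment> \<open>Along x, y, w the next copy is entered never, at w, or at y. The last two
      cases are rotations of \<open>cup_dif_dif\<close>.\<close>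
    consider "lv y = lv x" "lv w = lv x" "(co x, co y) \<in> r" "(co y, co w) \<in> r"
      | "lv y = lv x" "lv w = lv x + 1" "(co x, co y) \<in> r" "(co w, co x) \<in> r"
      | "lv y = lv x + 1" "lv w = lv x + 1" "(co y, co w) \<in> r" "(co w, co x) \<in> r"
      using 2 by fastforce
    then show "u (\<tau> x y) (\<tau> y w) = Some (\<tau> x w)"
    proof cases
      case 1
      then show ?thesis by (simp add: \<tau>_def cup_dif_dif)
    next
      case 2
      then show ?thesis using cup_rot'[OF cup_dif_dif[OF 2(4,3)]] by (simp add: \<tau>_def)
    next
      case 3
      then show ?thesis using cup_rot[OF cup_dif_dif[OF 3(3,4)]] by (simp add: \<tau>_def)
    qed
  qed
  then obtain k where k: "k \<in> circle_hom X.Q K" "\<And>x. x \<in> acar X \<Longrightarrow> fst k (X.orb x) = \<pi> x" by blast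
  have T_h: "X.T m (h (n, a)) = h (n + m, a)" if "a \<in> A" for m n a
  proof (induction m rule: int_induct[where k = 0])
    case (step1 i)
    then show ?case using that X.T_plus_1[of "h (n, a)" i] by (simp add: car theta algebra_simps)
  next
    case (step2 i)
    have "X.th (X.T (i - 1) (h (n, a))) = X.th (h (n + (i - 1), a))"
      using step2 that X.T_plus_1[of "h (n, a)" "i - 1"] by (simp add: car theta)
    then show ?case using X.th_inv(3) X.T_in that by (metis (no_types, lifting) SigmaI UNIV_I car image_eqI)
  qed simp
  \<comment> \<open>Passing to the orbit of (n, a) forgets n, so orbits correspond to A and, through
    \<open>d1\<close>, to the points of the circle.\<close>
  have "bij_betw (fst k) (Pts X.Q) P"
  proof (rule bij_betwI')
    fix p q assume "p \<in> Pts X.Q" "q \<in> Pts X.Q"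
    then obtain n a m b where p: "p = X.orb (h (n, a))" "a \<in> A" and q: "q = X.orb (h (m, b))" "b \<in> A"
      by (auto simp: car)
    have "p = q" if "a = b"
      using p q that X.orb_T[of "h (n, a)" "m - n"] by (simp add: T_h car)
    moreover have "fst k p = d1 a" "fst k q = d1 b" using p q by (simp_all add: k(2) car \<pi>_def)
    moreover have "d1 a = d1 b \<longleftrightarrow> a = b" using p q bij_d1 by (auto simp: bij_betw_def inj_on_eq_iff)
    ultimately show "(fst k p = fst k q) = (p = q)" by metis
  next
    show "fst k p \<in> P" if "p \<in> Pts X.Q" for p using that k(1) circle_hom_PiE(1)[OF k(1)] by auto
    fix x assume "x \<in> P"
    then obtain a where "a \<in> A" "x = d1 a" using bij_d1 by (auto simp: bij_betw_def)
    then have "fst k (X.orb (h (0, a))) = x" "h (0, a) \<in> acar X" by (auto simp: k(2) car \<pi>_def)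
    then show "\<exists>p\<in>Pts X.Q. x = fst k p" by auto
  qed
  then show ?thesis using X k by blast
qed

end

text \<open>Smallness of K and infinity of \<open>'a\<close> provide the injection of \<int>
  \<times> A into \<open>'a\<close> that \<open>unrolling\<close> asks for.\<close>

lemma Q_essentially_surjective:
  fixes K :: "('a set, ('a \<times> 'a) set) acircle"
  assumes inf: "infinite (UNIV :: 'a set)" and Kob: "K \<in> Ob Circ"
  shows "\<exists>X::'a arch. archimedean_set X \<and> (\<exists>k. is_iso Circ (arc_circle X) K k)"
proof -
  have "circ K" using Kob by (simp add: circ_def)
  then obtain p0 where "p0 \<in> Pts K" using circ.P_nonempty by blast
  interpret based_circ K p0 using \<open>circ K\<close> \<open>p0 \<in> Pts K\<close> by (simp add: based_circ_def based_circ_axioms_def)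
  have "(UNIV :: int set) \<lesssim> (UNIV :: nat set)"
    unfolding lepoll_def by (rule exI[of _ to_nat]) simp
  also have "(UNIV :: nat set) \<lesssim> (UNIV :: 'a set)" using inf by (simp add: infinite_le_lepoll)
  finally have "(UNIV :: int set) \<lesssim> (UNIV :: 'a set)" .
  moreover have "A \<lesssim> (UNIV :: 'a set)"
  proof (rule lepoll_trans[OF subset_imp_lepoll])
    show "A \<subseteq> Segs K" by (auto simp: A_def)
    show "Segs K \<lesssim> (UNIV :: 'a set)" using Kob by (simp add: small_circle_def)
  qed
  ultimately have "(UNIV :: int set) \<times> A \<lesssim> (UNIV :: 'a set) \<times> (UNIV :: 'a set)" by (rule times_lepoll_mono)
  also have "(UNIV :: 'a set) \<times> (UNIV :: 'a set) \<lesssim> (UNIV :: 'a set)"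
    using card_of_Times_same_infinite[OF inf] by (intro eqpoll_imp_lepoll) (simp only: eqpoll_iff_card_of_ordIso)
  finally obtain h :: "int \<times> ('a \<times> 'a) set \<Rightarrow> 'a" where "inj_on h (UNIV \<times> A)" unfolding lepoll_def by blast
  from unrolling[OF this] obtain X :: "'a arch" and k where X: "archimedean_set X"
    and k: "k \<in> circle_hom (arc_circle X) K" "bij_betw (fst k) (Pts (arc_circle X)) (Pts K)" by blast
  interpret X: arch X using X by unfold_locales
  have "is_iso Circ X.Q K (fst k, snd k)"
    using Kob X.abstract_circle_Q X.small_circle_Q[OF inf] k by (intro is_iso_CircI) auto
  then show ?thesis using X by blast
qed

theorem Q_equivalence:
  assumes "infinite (UNIV :: 'a set)"
  shows "is_equivalence (Arc :: ('a arch, ('a \<Rightarrow> 'a) set) category) Circ Q_functor"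
proof (rule equivalenceI[OF is_category_Arc is_category_Circ is_functor_Q[OF assms]])
  have fob: "fobj Q_functor V = arc_circle V" for V :: "'a arch" by (simp add: Q_functor_def)
  show "f = g" if "X \<in> Ob Arc" "Y \<in> Ob Arc" "f \<in> Hom Arc X Y" "g \<in> Hom Arc X Y"
    "fmor Q_functor X Y f = fmor Q_functor X Y g" for X Y :: "'a arch" and f g
    using that Q_faithful by simp
  show "\<exists>f\<in>Hom Arc X Y. fmor Q_functor X Y f = g" if "X \<in> Ob Arc" "Y \<in> Ob Arc"
    "g \<in> Hom Circ (fobj Q_functor X) (fobj Q_functor Y)" for X Y :: "'a arch" and g
    using that Q_full[of X Y "fst g" "snd g"] by (simp add: fob)
  show "\<exists>X\<in>Ob Arc. \<exists>k. is_iso Circ (fobj Q_functor X) K k" if "K \<in> Ob Circ" for K :: "('a set, ('a \<times> 'a) set) acircle"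
    using Q_essentially_surjective[OF assms that] by (auto simp: fob)
qed

section \<open>The cyclic category\<close>

declare restrict_UNIV [simp]

lemma Lambda_simps [simp]:
  "Ob Lambda = UNIV" "Hom Lambda n m = arc_hom (Zarc n) (Zarc m)"
  "Idn Lambda n = arc_class (Zarc n) (Zarc n) (\<lambda>x. x)"
  "Cmp Lambda n m k G F = arc_comp (Zarc n) G F"
  by (simp_all add: Lambda_def)

lemma is_category_Lambda: "is_category Lambda"
proof -
  have "arc_class (Zarc n) (Zarc n) (\<lambda>x. x) \<in> arc_hom (Zarc n) (Zarc n)" for n
    using arc_class_in_hom[OF arc_maps_id[OF archimedean_Zarc]] by simp
  then show ?thesis
    unfolding is_category_def Lambda_simps
    using arc_comp_id[OF archimedean_Zarc archimedean_Zarc, simplified]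
    by (auto simp only: arc_comp_in_hom[OF archimedean_Zarc archimedean_Zarc archimedean_Zarc]
        arc_comp_assoc[OF archimedean_Zarc archimedean_Zarc archimedean_Zarc archimedean_Zarc])
qed

lemma Zarc_maps_iff:
  "f \<in> arc_maps (Zarc n) (Zarc m) \<longleftrightarrow> mono f \<and> (\<forall>x. f (x + int n + 1) = f x + int m + 1)"
  by (auto simp: arc_maps_def mono_def)

lemma arc_comp_Zarc:
  assumes "archimedean_set X" "f \<in> arc_maps (Zarc n) (Zarc m)" "u \<in> arc_maps (Zarc m) X"
  shows "arc_comp (Zarc n) (arc_class (Zarc m) X u) (arc_class (Zarc n) (Zarc m) f) = arc_class (Zarc n) X (\<lambda>x. u (f x))"
  using arc_comp_class[OF archimedean_Zarc archimedean_Zarc assms] by (simp add: compose_def)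

lemma Zarc_maps_comp:
  assumes "archimedean_set X" "f \<in> arc_maps (Zarc n) (Zarc m)" "u \<in> arc_maps (Zarc m) X"
  shows "(\<lambda>x. u (f x)) \<in> arc_maps (Zarc n) X"
  using arc_maps_compose[OF archimedean_Zarc archimedean_Zarc assms] by (simp add: compose_def)

text \<open>Up-closed sets of integers other than the empty and the full one have a least element.
  This yields both the transposes and the place where a map crosses the base point.\<close>

lemma int_threshold:
  fixes p :: "int \<Rightarrow> bool"
  assumes up: "\<And>x y. p x \<Longrightarrow> x \<le> y \<Longrightarrow> p y" and "p a" "\<not> p b"
  shows "\<exists>c. \<forall>x. p x \<longleftrightarrow> c \<le> x"
proof -
  define k where "k = (LEAST k. p (b + int k))"
  have "b \<le> a" using up assms(2,3) by (meson linear)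
  then have "p (b + int (nat (a - b)))" using \<open>p a\<close> by simp
  then have k: "p (b + int k)" unfolding k_def by (rule LeastI)
  moreover have "\<not> p x" if "x < b + int k" for x
  proof (cases "x \<le> b")
    case True
    then show ?thesis using up \<open>\<not> p b\<close> by blast
  next
    case False
    then have "nat (x - b) < k" using that by simp
    then have "\<not> p (b + int (nat (x - b)))" unfolding k_def by (rule not_less_Least)
    then show ?thesis using False by simp
  qed
  ultimately show ?thesis using up by (meson linorder_not_le)
qed

abbreviation tr where "tr \<equiv> transpose_map"

locale Zarc_map =
  fixes n m :: nat and f :: "int \<Rightarrow> int"
  assumes f: "f \<in> arc_maps (Zarc n) (Zarc m)"
begin

lemma mono: "x \<le> y \<Longrightarrow> f x \<le> f y"
  and period: "f (x + int n + 1) = f x + int m + 1"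
  using f by (auto simp: Zarc_maps_iff mono_def)

lemma periods: "f (x + k * (int n + 1)) = f x + k * (int m + 1)"
proof -
  interpret arch_map "Zarc n" "Zarc m" f using f archimedean_Zarc by unfold_locales
  show ?thesis using commute_T[of x k] by simp
qed

text \<open>The set of x with y \<le> f(x) is up-closed, and it is neither empty nor everything
  because periodicity makes f unbounded on both sides; its least element is the transpose at
  y.\<close>

lemma galois: "y \<le> f x \<longleftrightarrow> tr f y \<le> x"
proof -
  have "\<exists>c. \<forall>x. y \<le> f x \<longleftrightarrow> c \<le> x" for y
  proof (rule int_threshold)
    \<comment> \<open>Moving by k periods changes f by at least k, and this k exceeds the distance
      between y and f(0).\<close>
    define k where "k = \<bar>y\<bar> + \<bar>f 0\<bar> + 1"
    define w where "w = k * (int m + 1)"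
    have "k * 1 \<le> w" unfolding w_def by (rule mult_left_mono) (auto simp: k_def)
    moreover have "f (0 + k * (int n + 1)) = f 0 + w" "f (0 + (- k) * (int n + 1)) = f 0 - w"
      unfolding periods w_def by simp_all
    ultimately show "y \<le> f (0 + k * (int n + 1))" "\<not> y \<le> f (0 + (- k) * (int n + 1))"
      by (simp_all add: k_def)
  qed (use mono in force)
  then obtain g where g: "\<And>x y. y \<le> f x \<longleftrightarrow> g y \<le> x" by metis
  have "tr f = g"
    unfolding transpose_map_def
  proof (rule the_equality)
    fix h assume "\<forall>x y. (y \<le> f x) = (h y \<le> x)"
    then have "h y \<le> x \<longleftrightarrow> g y \<le> x" for x y using g by simp
    then show "h = g" by (metis eq_iff ext)
  qed (use g in blast)
  then show ?thesis using g by simp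
qed

lemma tr_eqI:
  assumes "\<And>x y. y \<le> f x \<longleftrightarrow> g y \<le> x"
  shows "tr f = g"
  using assms galois by (metis eq_iff ext)

lemma tr_in: "tr f \<in> arc_maps (Zarc m) (Zarc n)"
  unfolding Zarc_maps_iff
proof (intro conjI allI monoI)
  show "tr f y \<le> tr f y'" if "y \<le> y'" for y y' using that galois by (meson order_trans order_refl)
  show "tr f (y + int m + 1) = tr f y + int n + 1" for y
  proof -
    have "tr f (y + int m + 1) \<le> x \<longleftrightarrow> tr f y + int n + 1 \<le> x" for x
      using galois[of "y + int m + 1" x] galois[of y "x - int n - 1"] period[of "x - int n - 1"] by auto
    then show ?thesis by (metis eq_iff)
  qed
qed

text \<open>Translating a map translates its adjoint in the opposite direction; hence transposition
  passes to classes.\<close>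

lemma tr_shift: "tr (\<lambda>x. f x + k * (int m + 1)) = (\<lambda>y. tr f y - k * (int n + 1))"
proof -
  interpret s: Zarc_map n m "\<lambda>x. f x + k * (int m + 1)"
    using f by unfold_locales (auto simp: Zarc_maps_iff mono_def)
  show ?thesis
    by (rule s.tr_eqI) (use galois[of _ "_ + k * (int n + 1)"] periods in \<open>simp add: diff_le_eq\<close>)
qed

lemma class_eq: "arc_class (Zarc n) (Zarc m) f = range (\<lambda>k x. f x + k * (int m + 1))"
  by (simp add: arc_class_def)

lemma transpose_class: "transpose (arc_class (Zarc n) (Zarc m) f) = arc_class (Zarc m) (Zarc n) (tr f)"
proof -
  interpret t: Zarc_map m n "tr f" using tr_in by unfold_locales
  have "transpose (arc_class (Zarc n) (Zarc m) f) = range (\<lambda>k y. tr f y + (- k) * (int n + 1))"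
    unfolding transpose_def class_eq image_image by (simp add: tr_shift)
  also have "\<dots> = (\<lambda>k y. tr f y + k * (int n + 1)) ` range uminus" unfolding image_image ..
  also have "\<dots> = arc_class (Zarc m) (Zarc n) (tr f)" by (simp add: t.class_eq)
  finally show ?thesis .
qed

end

lemma tr_id: "tr (\<lambda>x. x) = (\<lambda>x. x)"
proof -
  have "Zarc_map 0 0 (\<lambda>x. x)" by (simp add: Zarc_map_def Zarc_maps_iff mono_def)
  then show ?thesis by (rule Zarc_map.tr_eqI) simp
qed

text \<open>Left adjoints compose in the reverse order, which is why precomposition with transposes
  is covariant.\<close>

lemma tr_comp:
  assumes f: "f \<in> arc_maps (Zarc n) (Zarc m)" and g: "g \<in> arc_maps (Zarc m) (Zarc k)"
  shows "tr (\<lambda>x. g (f x)) = (\<lambda>y. tr f (tr g y))"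
proof -
  interpret f: Zarc_map n m f using f by unfold_locales
  interpret g: Zarc_map m k g using g by unfold_locales
  interpret gf: Zarc_map n k "\<lambda>x. g (f x)" using Zarc_maps_comp[OF archimedean_Zarc f g] by unfold_locales
  show ?thesis by (rule gf.tr_eqI) (simp add: g.galois f.galois)
qed

lemma tr_inj:
  assumes "f \<in> arc_maps (Zarc n) (Zarc m)" "g \<in> arc_maps (Zarc n) (Zarc m)" "tr f = tr g"
  shows "f = g"
proof -
  interpret f: Zarc_map n m f using assms by unfold_locales
  interpret g: Zarc_map n m g using assms by unfold_locales
  have "y \<le> f x \<longleftrightarrow> y \<le> g x" for x y using assms by (simp add: f.galois g.galois)
  then show ?thesis by (metis eq_iff ext)
qed

text \<open>Reflection at \<open>0\<close> turns right adjoints into left adjoints.\<close>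

lemma tr_surj:
  assumes g: "g \<in> arc_maps (Zarc m) (Zarc n)"
  shows "\<exists>f\<in>arc_maps (Zarc n) (Zarc m). tr f = g"
proof -
  interpret g: Zarc_map m n g using g by unfold_locales
  interpret r: Zarc_map m n "\<lambda>t. - g (- t)"
  proof
    have "g (- x - int m - 1) = g (- x) - int n - 1" for x using g.period[of "- x - int m - 1"] by simp
    then show "(\<lambda>t. - g (- t)) \<in> arc_maps (Zarc m) (Zarc n)"
      by (auto simp: Zarc_maps_iff algebra_simps intro!: monoI g.mono)
  qed
  interpret t: Zarc_map n m "tr (\<lambda>t. - g (- t))" using r.tr_in by unfold_locales
  interpret f: Zarc_map n m "\<lambda>x. - tr (\<lambda>t. - g (- t)) (- x)"
  proof
    have "tr (\<lambda>t. - g (- t)) (- x - int n - 1) = tr (\<lambda>t. - g (- t)) (- x) - int m - 1" for x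
      using t.period[of "- x - int n - 1"] by simp
    then show "(\<lambda>x. - tr (\<lambda>t. - g (- t)) (- x)) \<in> arc_maps (Zarc n) (Zarc m)"
      by (auto simp: Zarc_maps_iff algebra_simps intro!: monoI t.mono)
  qed
  have "y \<le> - tr (\<lambda>t. - g (- t)) (- x) \<longleftrightarrow> g y \<le> x" for x y
    using r.galois[of "- x" "- y"] by auto
  then show ?thesis using f.tr_eqI f.f by blast
qed

section \<open>The points of the cyclic topos\<close>

lemma P_simps [simp]:
  "fobj (fobj P_functor X) n = arc_hom (Zarc n) X"
  "fmor (fobj P_functor X) n m F = (\<lambda>u\<in>arc_hom (Zarc n) X. arc_comp (Zarc m) u (transpose F))"
  "fmor P_functor X Y \<Phi> = (\<lambda>n\<in>UNIV. \<lambda>u\<in>arc_hom (Zarc n) X. arc_comp (Zarc n) \<Phi> u)"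
  by (simp_all add: P_functor_def)

lemma P_app:
  assumes "archimedean_set X" "f \<in> arc_maps (Zarc n) (Zarc m)" "v \<in> arc_maps (Zarc n) X"
  shows "fmor (fobj P_functor X) n m (arc_class (Zarc n) (Zarc m) f) (arc_class (Zarc n) X v)
    = arc_class (Zarc m) X (\<lambda>y. v (tr f y))"
proof -
  interpret Zarc_map n m f using assms by unfold_locales
  show ?thesis using assms tr_in by (simp add: arc_class_in_hom transpose_class arc_comp_Zarc)
qed

lemma is_functor_P_obj:
  assumes X: "archimedean_set X"
  shows "is_functor Lambda set_cat (fobj P_functor X)"
proof (rule set_functorI[OF _ _ _ is_category_Lambda])
  fix n m F assume "F \<in> Hom Lambda n m"
  then obtain f where f: "f \<in> arc_maps (Zarc n) (Zarc m)" "F = arc_class (Zarc n) (Zarc m) f" by (auto elim: arc_homE)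
  interpret f: Zarc_map n m f using f by unfold_locales
  show "fmor (fobj P_functor X) n m F \<in> fobj (fobj P_functor X) n \<rightarrow>\<^sub>E fobj (fobj P_functor X) m"
    using f f.tr_in X by (auto simp: f.transpose_class intro!: arc_comp_in_hom[where Y = "Zarc n"] archimedean_Zarc arc_class_in_hom)
  fix k G u assume "G \<in> Hom Lambda m k" and "u \<in> fobj (fobj P_functor X) n"
  then obtain g v where g: "g \<in> arc_maps (Zarc m) (Zarc k)" "G = arc_class (Zarc m) (Zarc k) g"
    and v: "v \<in> arc_maps (Zarc n) X" "u = arc_class (Zarc n) X v" by (auto elim!: arc_homE)
  have gf: "(\<lambda>x. g (f x)) \<in> arc_maps (Zarc n) (Zarc k)" by (rule Zarc_maps_comp[OF archimedean_Zarc f(1) g(1)])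
  show "fmor (fobj P_functor X) n k (Cmp Lambda n m k G F) u = fmor (fobj P_functor X) m k G (fmor (fobj P_functor X) n m F u)"
    unfolding f(2) g(2) v(2) Lambda_simps arc_comp_Zarc[OF archimedean_Zarc f(1) g(1)]
      P_app[OF X gf v(1)] P_app[OF X f(1) v(1)] P_app[OF X g(1) Zarc_maps_comp[OF X f.tr_in v(1)]]
    by (simp add: tr_comp[OF f(1) g(1)])
next
  fix n u assume "u \<in> fobj (fobj P_functor X) n"
  then obtain v where v: "v \<in> arc_maps (Zarc n) X" "u = arc_class (Zarc n) X v" by (auto elim!: arc_homE)
  have "(\<lambda>x. x) \<in> arc_maps (Zarc n) (Zarc n)" by (simp add: Zarc_maps_iff mono_def)
  then show "fmor (fobj P_functor X) n n (Idn Lambda n) u = u"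
    unfolding v(2) Lambda_simps by (simp only: P_app[OF X _ v(1)] tr_id)
qed

lemma is_functor_P: "is_functor Arc (copsh Lambda) P_functor"
  unfolding is_functor_def
proof (intro conjI ballI)
  fix X :: "'a arch" assume "X \<in> Ob Arc"
  then have X: "archimedean_set X" by simp
  show "fobj P_functor X \<in> Ob (copsh Lambda)" using is_functor_P_obj[OF X] by simp
  show "fmor P_functor X X (Idn Arc X) = Idn (copsh Lambda) (fobj P_functor X)"
    using arc_comp_id(2)[OF archimedean_Zarc X] by (simp cong: restrict_cong)
  fix Y :: "'a arch" and F assume "Y \<in> Ob Arc" "F \<in> Hom Arc X Y"
  then have Y: "archimedean_set Y" and F: "F \<in> arc_hom X Y" by simp_all
  show "fmor P_functor X Y F \<in> Hom (copsh Lambda) (fobj P_functor X) (fobj P_functor Y)"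
  proof (simp only: functor_cat_simps mem_Collect_eq, intro conjI nat_trans_set_catI)
    show "fmor P_functor X Y F n \<in> fobj (fobj P_functor X) n \<rightarrow>\<^sub>E fobj (fobj P_functor Y) n" for n
      using arc_comp_in_hom[OF archimedean_Zarc X Y _ F] by auto
    fix n m G u assume "G \<in> Hom Lambda n m" and "u \<in> fobj (fobj P_functor X) n"
    then obtain g where g: "g \<in> arc_maps (Zarc n) (Zarc m)" "G = arc_class (Zarc n) (Zarc m) g"
      and u: "u \<in> arc_hom (Zarc n) X" by (auto elim!: arc_homE)
    interpret g: Zarc_map n m g using g by unfold_locales
    have "transpose G \<in> arc_hom (Zarc m) (Zarc n)" using g g.tr_in by (simp add: g.transpose_class arc_class_in_hom)
    then show "fmor P_functor X Y F m (fmor (fobj P_functor X) n m G u) = fmor (fobj P_functor Y) n m G (fmor P_functor X Y F n u)"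
      using u F arc_comp_in_hom[OF archimedean_Zarc archimedean_Zarc X] arc_comp_in_hom[OF archimedean_Zarc X Y]
        arc_comp_assoc[OF archimedean_Zarc archimedean_Zarc X Y] by simp
  qed simp
  fix Z :: "'a arch" and G assume "Z \<in> Ob Arc" "G \<in> Hom Arc Y Z"
  then have Z: "archimedean_set Z" and G: "G \<in> arc_hom Y Z" by simp_all
  show "fmor P_functor X Z (Cmp Arc X Y Z G F) = Cmp (copsh Lambda) (fobj P_functor X) (fobj P_functor Y) (fobj P_functor Z)
      (fmor P_functor Y Z G) (fmor P_functor X Y F)"
    using arc_comp_in_hom[OF archimedean_Zarc X Y _ F] arc_comp_assoc[OF archimedean_Zarc X Y Z _ F G]
    by (simp add: compose_def cong: restrict_cong)
qed

section \<open>The simplicial category\<close>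

lemma Delta_simps [simp]:
  "Ob Delta = UNIV" "Hom Delta n m = {f \<in> {0..n} \<rightarrow>\<^sub>E {0..m}. mono_on {0..n} f}"
  "Idn Delta n = (\<lambda>i\<in>{0..n}. i)" "Cmp Delta n m k g f = compose {0..n} g f"
  by (simp_all add: Delta_def)

lemma Delta_app: "f \<in> Hom Delta n m \<Longrightarrow> i \<le> n \<Longrightarrow> f i \<le> m"
  by (auto simp: PiE_iff)

lemma Delta_compose:
  assumes "f \<in> Hom Delta n m" "g \<in> Hom Delta m k"
  shows "compose {0..n} g f \<in> Hom Delta n k"
proof -
  have "mono_on {0..n} (compose {0..n} g f)"
    using assms by (auto simp: compose_def mono_on_def PiE_iff)
  then show ?thesis using assms compose_PiE[of f "{0..n}" "{0..m}" g "{0..k}"] by simp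
qed

lemma is_category_Delta: "is_category Delta"
  unfolding is_category_def
proof (intro conjI ballI)
  show "Idn Delta n \<in> Hom Delta n n" for n by (auto simp: mono_on_def)
  fix n m f assume f: "f \<in> Hom Delta n m"
  then show "Cmp Delta n n m f (Idn Delta n) = f" "Cmp Delta n m m (Idn Delta m) f = f"
    by (simp_all add: compose_id_PiE[where B = "{0..m}"])
  fix k g assume g: "g \<in> Hom Delta m k"
  show "Cmp Delta n m k g f \<in> Hom Delta n k" using Delta_compose[OF f g] by simp
  fix l h assume "h \<in> Hom Delta k l"
  then show "Cmp Delta n k l h (Cmp Delta n m k g f) = Cmp Delta n m l (Cmp Delta m k l h g) f"
    using f by (simp add: compose_assoc_PiE[where B = "{0..m}"])
qed

text \<open>The representative that takes the k-th block of length n + 1 into the k-th block of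
  length m + 1. For these representatives composition is preserved on the nose and not only up to
  translation.\<close>

definition j_map :: "nat \<Rightarrow> nat \<Rightarrow> (nat \<Rightarrow> nat) \<Rightarrow> int \<Rightarrow> int" where
  "j_map n m f x = int (f (nat (x mod (int n + 1)))) + (x div (int n + 1)) * (int m + 1)"

lemma nat_mod_le: "nat (x mod (int n + 1)) \<le> n"
  using pos_mod_bound[of "int n + 1" x] by linarith

text \<open>The source of monotonicity for all periodic extensions below: integers are ordered
  lexicographically by quotient and remainder.\<close>

lemma div_mod_mono:
  fixes x y N :: int
  assumes "x \<le> y" "0 < N"
  shows "x div N < y div N \<or> x div N = y div N \<and> x mod N \<le> y mod N"
proof (cases "x div N = y div N")
  case True
  then show ?thesis using assms div_mult_mod_eq[of x N] div_mult_mod_eq[of y N] by (metis add_le_cancel_left)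
next
  case False
  then show ?thesis using zdiv_mono1[OF assms] by simp
qed

lemma j_map_div_mod:
  assumes "f \<in> Hom Delta n m"
  shows "j_map n m f x div (int m + 1) = x div (int n + 1)"
    "nat (j_map n m f x mod (int m + 1)) = f (nat (x mod (int n + 1)))"
proof -
  have "int (f (nat (x mod (int n + 1)))) < int m + 1"
    using Delta_app[OF assms nat_mod_le, of x] by linarith
  then show "j_map n m f x div (int m + 1) = x div (int n + 1)"
    "nat (j_map n m f x mod (int m + 1)) = f (nat (x mod (int n + 1)))"
    by (simp_all add: j_map_def)
qed

lemma j_map_in:
  assumes f: "f \<in> Hom Delta n m"
  shows "j_map n m f \<in> arc_maps (Zarc n) (Zarc m)"
  unfolding Zarc_maps_iff
proof (intro conjI allI monoI)
  fix x y :: int assume "x \<le> y"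
  then consider "x div (int n + 1) < y div (int n + 1)"
    | "x div (int n + 1) = y div (int n + 1)" "x mod (int n + 1) \<le> y mod (int n + 1)"
    using div_mod_mono[of x y "int n + 1"] by auto
  then show "j_map n m f x \<le> j_map n m f y"
  proof cases
    case 1
    have "j_map n m f x < (x div (int n + 1) + 1) * (int m + 1)"
      using Delta_app[OF f nat_mod_le, of x] by (simp add: j_map_def algebra_simps)
    also have "\<dots> \<le> (y div (int n + 1)) * (int m + 1)" using 1 by (intro mult_right_mono) auto
    also have "\<dots> \<le> j_map n m f y" by (simp add: j_map_def)
    finally show ?thesis by simp
  next
    case 2
    then have "f (nat (x mod (int n + 1))) \<le> f (nat (y mod (int n + 1)))"
      using f nat_mod_le[of x n] nat_mod_le[of y n] by (auto simp: mono_on_def)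
    then show ?thesis using 2 by (simp add: j_map_def)
  qed
next
  fix x
  have "(x + int n + 1) div (int n + 1) = x div (int n + 1) + 1" "(x + int n + 1) mod (int n + 1) = x mod (int n + 1)"
    using div_add_self2[of "int n + 1" x] mod_add_self2[of x "int n + 1"] by (simp_all add: add.assoc)
  then show "j_map n m f (x + int n + 1) = j_map n m f x + int m + 1" by (simp add: j_map_def algebra_simps)
qed

lemma j_map_comp:
  assumes "f \<in> Hom Delta n m" "g \<in> Hom Delta m k"
  shows "j_map n k (compose {0..n} g f) = (\<lambda>x. j_map m k g (j_map n m f x))"
proof
  fix x
  show "j_map n k (compose {0..n} g f) x = j_map m k g (j_map n m f x)"
    using j_map_div_mod[OF assms(1), of x] nat_mod_le[of x n]
    by (simp add: j_map_def[of m k] j_map_def[of n k] compose_eq)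
qed

lemma j_functor_simps [simp]:
  "fobj j_functor n = n" "fmor j_functor n m f = arc_class (Zarc n) (Zarc m) (j_map n m f)"
  by (simp_all add: j_functor_def j_map_def[abs_def])

lemma is_functor_j: "is_functor Delta Lambda j_functor"
  unfolding is_functor_def
proof (intro conjI ballI)
  fix n
  have "j_map n n (\<lambda>i\<in>{0..n}. i) = (\<lambda>x. x)"
    using nat_mod_le[of _ n] by (auto simp: j_map_def fun_eq_iff) (metis add.commute div_mult_mod_eq)
  then show "fmor j_functor n n (Idn Delta n) = Idn Lambda (fobj j_functor n)" by simp
  fix m f assume f: "f \<in> Hom Delta n m"
  show "fmor j_functor n m f \<in> Hom Lambda (fobj j_functor n) (fobj j_functor m)"
    using j_map_in[OF f] by (simp add: arc_class_in_hom)
  fix k g assume g: "g \<in> Hom Delta m k"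
  show "fmor j_functor n k (Cmp Delta n m k g f) = Cmp Lambda (fobj j_functor n) (fobj j_functor m) (fobj j_functor k)
      (fmor j_functor m k g) (fmor j_functor n m f)"
    using j_map_comp[OF f g] arc_comp_Zarc[OF archimedean_Zarc j_map_in[OF f] j_map_in[OF g]] by simp
qed simp

section \<open>Intervals\<close>

lemma ivl_homI:
  assumes "\<And>x. x \<in> icar I \<Longrightarrow> f x \<in> icar J" "\<And>x. x \<notin> icar I \<Longrightarrow> f x = undefined"
    "\<And>x y. x \<in> icar I \<Longrightarrow> y \<in> icar I \<Longrightarrow> (x, y) \<in> iord I \<Longrightarrow> (f x, f y) \<in> iord J"
    "f (ibot I) = ibot J" "f (itop I) = itop J"
  shows "f \<in> ivl_hom I J"
  using assms by (auto simp: ivl_hom_def PiE_iff extensional_def)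

lemma ivl_homD:
  assumes "f \<in> ivl_hom I J"
  shows "x \<in> icar I \<Longrightarrow> f x \<in> icar J" "x \<notin> icar I \<Longrightarrow> f x = undefined"
    "x \<in> icar I \<Longrightarrow> y \<in> icar I \<Longrightarrow> (x, y) \<in> iord I \<Longrightarrow> (f x, f y) \<in> iord J"
    "f (ibot I) = ibot J" "f (itop I) = itop J"
  using assms by (auto simp: ivl_hom_def PiE_iff extensional_def)

lemma ivl_hom_PiE: "f \<in> ivl_hom I J \<Longrightarrow> f \<in> icar I \<rightarrow>\<^sub>E icar J"
  by (simp add: ivl_hom_def)

lemma ivl_hom_compose:
  assumes "ibot I \<in> icar I" "itop I \<in> icar I" "f \<in> ivl_hom I J" "g \<in> ivl_hom J K"
  shows "compose (icar I) g f \<in> ivl_hom I K"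
  by (rule ivl_homI) (use assms ivl_homD[OF assms(3)] ivl_homD[OF assms(4)] in \<open>auto simp: compose_def\<close>)

lemma Intv_simps [simp]:
  "Ob Intv = {I. is_interval I}" "Hom Intv = ivl_hom" "Idn Intv I = (\<lambda>x\<in>icar I. x)"
  "Cmp Intv I J K g f = compose (icar I) g f"
  by (simp_all add: Intv_def)

lemma is_category_Intv: "is_category Intv"
  unfolding is_category_def
proof (intro conjI ballI)
  fix I :: "'i ivl" assume I: "I \<in> Ob Intv"
  then have ends: "ibot I \<in> icar I" "itop I \<in> icar I" by (auto simp: is_interval_def)
  then show "Idn Intv I \<in> Hom Intv I I" by (auto intro!: ivl_homI)
  fix J :: "'i ivl" and f assume f: "f \<in> Hom Intv I J"
  then show "Cmp Intv I I J f (Idn Intv I) = f" "Cmp Intv I J J (Idn Intv J) f = f"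
    by (simp_all add: compose_id_PiE[OF ivl_hom_PiE])
  fix K :: "'i ivl" and g assume g: "g \<in> Hom Intv J K"
  show "Cmp Intv I J K g f \<in> Hom Intv I K" using ends f g by (simp add: ivl_hom_compose)
  fix L :: "'i ivl" and h assume "h \<in> Hom Intv K L"
  then show "Cmp Intv I K L h (Cmp Intv I J K g f) = Cmp Intv I J L (Cmp Intv J K L h g) f"
    using f by (simp add: compose_assoc_PiE[OF ivl_hom_PiE])
qed

lemma fin_ivl_simps [simp]:
  "icar (fin_ivl k) = {0..k}" "(i, j) \<in> iord (fin_ivl k) \<longleftrightarrow> i \<le> j \<and> j \<le> k"
  "ibot (fin_ivl k) = 0" "itop (fin_ivl k) = k"
  by (simp_all add: fin_ivl_def)

text \<open>The dual is a left adjoint of f, with n + 1 as the minimum of the empty set. Together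
  with \<open>dual_map_unique\<close> this gives the duals of identities and composites.\<close>

lemma dual_map_galois:
  assumes f: "f \<in> Hom Delta n m" and i: "i \<le> n" and j: "j \<le> m + 1"
  shows "dual_map n m f j \<le> i \<longleftrightarrow> j \<le> f i"
proof (cases "\<exists>i\<in>{0..n}. j \<le> f i")
  case True
  let ?M = "{i \<in> {0..n}. j \<le> f i}"
  have M: "finite ?M" "?M \<noteq> {}" using True by auto
  have d: "dual_map n m f j = Min ?M" using True j by (simp add: dual_map_def)
  show ?thesis
  proof
    assume "dual_map n m f j \<le> i"
    moreover have "Min ?M \<in> ?M" using M by (rule Min_in)
    ultimately have "j \<le> f (Min ?M)" "f (Min ?M) \<le> f i"
      using f i d by (auto simp: mono_on_def)
    then show "j \<le> f i" by simp
  next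
    assume "j \<le> f i"
    then show "dual_map n m f j \<le> i" unfolding d using i by (intro Min_le) auto
  qed
next
  case False
  then show ?thesis using i j by (auto simp: dual_map_def)
qed

lemma dual_map_le: "j \<le> m + 1 \<Longrightarrow> dual_map n m f j \<le> n + 1"
proof (cases "\<exists>i\<in>{0..n}. j \<le> f i")
  case True
  assume "j \<le> m + 1"
  have "Min {i \<in> {0..n}. j \<le> f i} \<in> {i \<in> {0..n}. j \<le> f i}" using True by (intro Min_in) auto
  then show ?thesis using True \<open>j \<le> m + 1\<close> by (simp add: dual_map_def)
qed (simp add: dual_map_def)

lemma dual_map_unique:
  assumes f: "f \<in> Hom Delta n m" and j: "j \<le> m + 1" and k: "k \<le> n + 1"
    and *: "\<And>i. i \<le> n \<Longrightarrow> k \<le> i \<longleftrightarrow> j \<le> f i"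
  shows "dual_map n m f j = k"
proof -
  have 1: "dual_map n m f j \<le> i \<longleftrightarrow> k \<le> i" if "i \<le> n" for i using dual_map_galois[OF f that j] * that by simp
  have "dual_map n m f j \<le> n + 1" by (rule dual_map_le[OF j])
  show ?thesis
  proof (cases "k \<le> n")
    case True
    then have "dual_map n m f j \<le> k" using 1[of k] by simp
    then show ?thesis using True 1[of "dual_map n m f j"] by auto
  next
    case False
    then show ?thesis using k \<open>dual_map n m f j \<le> n + 1\<close> 1[of "dual_map n m f j"] by (cases "dual_map n m f j \<le> n") auto
  qed
qed

lemma dual_map_hom:
  assumes f: "f \<in> Hom Delta n m"
  shows "dual_map n m f \<in> ivl_hom (fin_ivl (m + 1)) (fin_ivl (n + 1))"
proof (rule ivl_homI)
  fix j j' assume j: "j \<in> icar (fin_ivl (m + 1))" "j' \<in> icar (fin_ivl (m + 1))" "(j, j') \<in> iord (fin_ivl (m + 1))"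
  then have "dual_map n m f j' \<le> n + 1" "dual_map n m f j \<le> n + 1" using dual_map_le by auto
  moreover have "dual_map n m f j \<le> dual_map n m f j'" if "dual_map n m f j' \<le> n"
    using dual_map_galois[OF f that, of j] dual_map_galois[OF f that, of j'] j by auto
  ultimately show "(dual_map n m f j, dual_map n m f j') \<in> iord (fin_ivl (n + 1))" by fastforce
next
  have "m + 1 \<le> f i \<longleftrightarrow> n + 1 \<le> i" if "i \<le> n" for i using Delta_app[OF f that] that by simp
  then show "dual_map n m f (itop (fin_ivl (m + 1))) = itop (fin_ivl (n + 1))"
    by (simp only: fin_ivl_simps) (rule dual_map_unique[OF f], auto)
  show "dual_map n m f (ibot (fin_ivl (m + 1))) = ibot (fin_ivl (n + 1))"
    using dual_map_unique[OF f, of 0 0] by simp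
qed (auto simp: dual_map_le[simplified], simp add: dual_map_def)

lemma dual_map_id: "j \<le> n + 1 \<Longrightarrow> dual_map n n (\<lambda>i\<in>{0..n}. i) j = j"
  by (rule dual_map_unique) (auto simp: mono_on_def)

lemma dual_map_comp:
  assumes f: "f \<in> Hom Delta n m" and g: "g \<in> Hom Delta m k" and j: "j \<le> k + 1"
  shows "dual_map n k (compose {0..n} g f) j = dual_map n m f (dual_map m k g j)"
proof (rule dual_map_unique[OF Delta_compose[OF f g] j dual_map_le[OF dual_map_le[OF j]]])
  show "dual_map n m f (dual_map m k g j) \<le> i \<longleftrightarrow> j \<le> compose {0..n} g f i" if "i \<le> n" for i
    using dual_map_galois[OF f that dual_map_le[OF j]] dual_map_galois[OF g Delta_app[OF f that] j] that
    by (simp add: compose_eq)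
qed

text \<open>Duality between finite ordinals and finite intervals: the right adjoint of d is the
  morphism of \<Delta> whose dual is d.\<close>

lemma dual_map_surj:
  assumes d: "d \<in> ivl_hom (fin_ivl (m + 1)) (fin_ivl (n + 1))"
  shows "\<exists>h\<in>Hom Delta n m. dual_map n m h = d"
proof -
  note d = ivl_homD[OF d, simplified]
  \<comment> \<open>The set contains 0 because d(0) = 0. It suffices to look at j \<le> m because
    d(m + 1) = n + 1 exceeds every i.\<close>
  define h where "h = (\<lambda>i\<in>{0..n}. Max {j \<in> {0..m}. d j \<le> i})"
  have fin: "finite {j \<in> {0..m}. d j \<le> i}" and ne: "{j \<in> {0..m}. d j \<le> i} \<noteq> {}" for i
    using d(4) by auto
  have h_le: "h i \<le> m" if "i \<le> n" for i using Max_in[OF fin ne, of i] that by (simp add: h_def)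
  have galois: "j \<le> h i \<longleftrightarrow> d j \<le> i" if i: "i \<le> n" and j: "j \<le> m + 1" for i j
  proof
    have "h i \<le> m" "d (h i) \<le> i" using Max_in[OF fin ne, of i] i by (auto simp: h_def)
    moreover assume "j \<le> h i"
    ultimately have "d j \<le> d (h i)" using d(3)[of j "h i"] by auto
    then show "d j \<le> i" using \<open>d (h i) \<le> i\<close> by simp
  next
    assume dj: "d j \<le> i"
    have "j \<noteq> m + 1"
    proof
      assume "j = m + 1"
      then show False using d(5) dj i by auto
    qed
    then show "j \<le> h i" using i j dj fin by (auto simp: h_def intro!: Max_ge)
  qed
  have h: "h \<in> Hom Delta n m"
  proof -
    have "h i \<le> h i'" if "i \<le> i'" "i' \<le> n" for i i'
      using galois[of i' "h i"] galois[of i "h i"] h_le[of i] that by auto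
    then have "mono_on {0..n} h" by (auto intro!: mono_onI)
    then show ?thesis using h_le by (auto simp: h_def)
  qed
  have "dual_map n m h j = d j" for j
  proof (cases "j \<le> m + 1")
    case True
    then show ?thesis using d(1)[of j] galois by (intro dual_map_unique[OF h]) auto
  next
    case False
    then show ?thesis using d(2)[of j] by (simp add: dual_map_def)
  qed
  then show ?thesis using h by blast
qed

lemma F_simps [simp]:
  "fobj (fobj F_functor I) n = ivl_hom (fin_ivl (n + 1)) I"
  "fmor (fobj F_functor I) n m f = (\<lambda>u\<in>ivl_hom (fin_ivl (n + 1)) I. compose {0..m + 1} u (dual_map n m f))"
  "fmor F_functor I J \<phi> = (\<lambda>n\<in>UNIV. \<lambda>u\<in>ivl_hom (fin_ivl (n + 1)) I. compose {0..n + 1} \<phi> u)"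
  by (simp_all add: F_functor_def)

lemma compose_dual_hom:
  assumes "f \<in> Hom Delta n m" "u \<in> ivl_hom (fin_ivl (n + 1)) I"
  shows "compose {0..m + 1} u (dual_map n m f) \<in> ivl_hom (fin_ivl (m + 1)) I"
  using ivl_hom_compose[OF _ _ dual_map_hom[OF assms(1)] assms(2)] by simp

lemma compose_ivl_hom:
  assumes "u \<in> ivl_hom (fin_ivl k) I" "\<phi> \<in> ivl_hom I J"
  shows "compose {0..k} \<phi> u \<in> ivl_hom (fin_ivl k) J"
  using ivl_hom_compose[OF _ _ assms] by simp

lemma is_functor_F_obj: "is_functor Delta set_cat (fobj F_functor I)"
proof (rule set_functorI[OF _ _ _ is_category_Delta])
  fix n m f assume f: "f \<in> Hom Delta n m"
  show "fmor (fobj F_functor I) n m f \<in> fobj (fobj F_functor I) n \<rightarrow>\<^sub>E fobj (fobj F_functor I) m"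
    using compose_dual_hom[OF f, where I = I] by auto
  fix k g u assume g: "g \<in> Hom Delta m k" and u: "u \<in> fobj (fobj F_functor I) n"
  have "compose {0..k + 1} u (dual_map n k (compose {0..n} g f))
      = compose {0..k + 1} (compose {0..m + 1} u (dual_map n m f)) (dual_map m k g)"
    using dual_map_comp[OF f g] dual_map_le[of _ k m g] by (auto simp: compose_def fun_eq_iff)
  then show "fmor (fobj F_functor I) n k (Cmp Delta n m k g f) u = fmor (fobj F_functor I) m k g (fmor (fobj F_functor I) n m f u)"
    using u compose_dual_hom[OF f, where I = I] by simp
next
  fix n u assume u: "u \<in> fobj (fobj F_functor I) n"
  then have "u j = undefined" if "\<not> j \<le> n + 1" for j using ivl_homD(2)[of u "fin_ivl (n + 1)" I j] that by simp
  then show "fmor (fobj F_functor I) n n (Idn Delta n) u = u"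
    using u dual_map_id[of _ n] by (auto simp: compose_def fun_eq_iff)
qed

lemma is_functor_F: "is_functor Intv (copsh Delta) F_functor"
  unfolding is_functor_def
proof (intro conjI ballI)
  fix I :: "'i ivl" assume I: "I \<in> Ob Intv"
  show "fobj F_functor I \<in> Ob (copsh Delta)" using is_functor_F_obj[of I] by simp
  have "compose {0..n + 1} (\<lambda>x\<in>icar I. x) u = u" if "u \<in> ivl_hom (fin_ivl (n + 1)) I" for n u
    using compose_id_PiE(2)[OF ivl_hom_PiE[OF that]] by simp
  then show "fmor F_functor I I (Idn Intv I) = Idn (copsh Delta) (fobj F_functor I)"
    by (simp cong: restrict_cong)
  fix J :: "'i ivl" and \<phi> assume J: "J \<in> Ob Intv" and \<phi>: "\<phi> \<in> Hom Intv I J"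
  show "fmor F_functor I J \<phi> \<in> Hom (copsh Delta) (fobj F_functor I) (fobj F_functor J)"
  proof (simp only: functor_cat_simps mem_Collect_eq, intro conjI nat_trans_set_catI)
    show "fmor F_functor I J \<phi> n \<in> fobj (fobj F_functor I) n \<rightarrow>\<^sub>E fobj (fobj F_functor J) n" for n
      using compose_ivl_hom[of _ "n + 1" I \<phi> J] \<phi> by auto
    fix n m f u assume f: "f \<in> Hom Delta n m" and u: "u \<in> fobj (fobj F_functor I) n"
    have "compose {0..m + 1} \<phi> (compose {0..m + 1} u (dual_map n m f)) = compose {0..m + 1} (compose {0..n + 1} \<phi> u) (dual_map n m f)"
      using dual_map_le[of _ m n f] by (auto simp: compose_def fun_eq_iff)
    then show "fmor F_functor I J \<phi> m (fmor (fobj F_functor I) n m f u) = fmor (fobj F_functor J) n m f (fmor F_functor I J \<phi> n u)"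
      using u \<phi> compose_dual_hom[OF f, where I = I] compose_ivl_hom[of u "n + 1" I \<phi> J] by simp
  qed simp
  fix K :: "'i ivl" and \<psi> assume \<psi>: "\<psi> \<in> Hom Intv J K"
  have "compose {0..n + 1} (compose (icar I) \<psi> \<phi>) u = compose {0..n + 1} \<psi> (compose {0..n + 1} \<phi> u)"
    if "u \<in> ivl_hom (fin_ivl (n + 1)) I" for n u
    using ivl_homD(1)[OF that] by (auto simp: compose_def fun_eq_iff)
  then show "fmor F_functor I K (Cmp Intv I J K \<psi> \<phi>) = Cmp (copsh Delta) (fobj F_functor I) (fobj F_functor J) (fobj F_functor K)
      (fmor F_functor J K \<psi>) (fmor F_functor I J \<phi>)"
    using \<phi> compose_ivl_hom[of _ _ I \<phi> J] by (auto simp: compose_def[of "ivl_hom _ _"] cong: restrict_cong)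
qed

section \<open>The archimedean set of an interval\<close>

locale interval =
  fixes I :: "'i ivl"
  assumes I: "is_interval I"
begin

abbreviation ile where "ile x y \<equiv> (x, y) \<in> iord I"
abbreviation bot where "bot \<equiv> ibot I"
abbreviation top where "top \<equiv> itop I"
abbreviation XI where "XI \<equiv> ivl_arch I"

lemma bot_in: "bot \<in> icar I" and top_in: "top \<in> icar I" and bot_neq_top: "bot \<noteq> top"
  and bot_le: "x \<in> icar I \<Longrightarrow> ile bot x" and le_top: "x \<in> icar I \<Longrightarrow> ile x top"
  and linear_I: "linear_order_on (icar I) (iord I)"
  using I by (auto simp: is_interval_def)

lemma ile_refl: "x \<in> icar I \<Longrightarrow> ile x x"
  and ile_antisym: "ile x y \<Longrightarrow> ile y x \<Longrightarrow> x = y"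
  using linear_I unfolding order_on_defs refl_on_def by (blast dest: transD antisymD)+

definition cl :: "int \<Rightarrow> 'i \<Rightarrow> (int \<times> 'i) set" where
  "cl n u = glue_equiv I `` {(n, u)}"

text \<open>Normal form for the gluing: a top element is rewritten as the bottom of the next
  copy.\<close>

definition nf :: "int \<times> 'i \<Rightarrow> int \<times> 'i" where
  "nf p = (if snd p = top then (fst p + 1, bot) else p)"

lemma glue_iff: "(p, q) \<in> glue_equiv I \<longleftrightarrow> nf p = nf q"
proof
  assume "(p, q) \<in> glue_equiv I"
  then show "nf p = nf q"
    unfolding glue_equiv_def by (rule gen_equiv_respects) (use bot_neq_top in \<open>auto simp: nf_def\<close>)
next
  have *: "(p, nf p) \<in> glue_equiv I" for p
  proof (cases "snd p = top")
    case True
    then have "(p, nf p) = ((fst p, top), (fst p + 1, bot))" by (cases p) (auto simp: nf_def)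
    then show ?thesis unfolding glue_equiv_def by (intro gen_equivI) auto
  next
    case False
    then show ?thesis by (simp add: nf_def glue_equiv_def gen_equiv_def)
  qed
  have "equiv UNIV (glue_equiv I)" unfolding glue_equiv_def by (rule equiv_gen_equiv)
  moreover assume "nf p = nf q"
  ultimately show "(p, q) \<in> glue_equiv I" using *[of p] *[of q] by (metis equivE symD transD)
qed

lemma mem_cl: "p \<in> cl n u \<longleftrightarrow> nf p = nf (n, u)"
  by (auto simp: cl_def glue_iff)

lemma cl_eq_iff: "cl n u = cl m v \<longleftrightarrow> nf (n, u) = nf (m, v)"
  by (metis (mono_tags, lifting) mem_cl set_eqI)

lemma cl_top: "cl n top = cl (n + 1) bot"
  using bot_neq_top by (simp add: cl_eq_iff nf_def)

lemma nf_in: "snd (nf p) \<in> icar I \<longleftrightarrow> snd p \<in> icar I"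
  using bot_in top_in by (auto simp: nf_def)

lemma cl_nf: "cl (fst (nf p)) (snd (nf p)) = cl (fst p) (snd p)"
  using bot_neq_top by (auto simp: cl_eq_iff nf_def)

lemma XI_car: "acar XI = {cl n u | n u. u \<in> icar I}"
  by (auto simp: ivl_arch_def cl_def quotient_def)

lemma cl_in: "u \<in> icar I \<Longrightarrow> cl n u \<in> acar XI"
  by (auto simp: XI_car)

lemma XI_carE:
  assumes "x \<in> acar XI"
  obtains n u where "u \<in> icar I" "u \<noteq> top" "x = cl n u"
proof -
  obtain n u where u: "u \<in> icar I" "x = cl n u" using assms by (auto simp: XI_car)
  have "x = cl (fst (nf (n, u))) (snd (nf (n, u)))" using cl_nf[of "(n, u)"] u by simp
  moreover have "snd (nf (n, u)) \<noteq> top" using bot_neq_top by (auto simp: nf_def)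
  moreover have "snd (nf (n, u)) \<in> icar I" using u nf_in by simp
  ultimately show ?thesis using that by blast
qed

text \<open>Nothing lies strictly between (n, top) and (n + 1, bottom), so normalising does not
  upset the lexicographic order. Comparing some representatives is therefore the same as comparing
  normal forms.\<close>

lemma lex_le_nf:
  assumes "lex_le I p q" "snd p \<in> icar I" "snd q \<in> icar I"
  shows "lex_le I (nf p) (nf q)"
  using assms bot_le[of "snd q"] le_top[of "snd p"] ile_antisym[of "snd q" top] le_top[of "snd q"] ile_refl[OF bot_in] bot_le[of "snd p"]
  by (cases p; cases q) (auto simp: lex_le_def nf_def)

lemma ord_cl:
  assumes "u \<in> icar I" "v \<in> icar I"
  shows "(cl n u, cl m v) \<in> aord XI \<longleftrightarrow> lex_le I (nf (n, u)) (nf (m, v))"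
proof
  assume "(cl n u, cl m v) \<in> aord XI"
  then obtain p q where pq: "p \<in> cl n u" "q \<in> cl m v" "lex_le I p q" by (auto simp: ivl_arch_def)
  then have "nf p = nf (n, u)" "nf q = nf (m, v)" by (auto simp: mem_cl)
  then show "lex_le I (nf (n, u)) (nf (m, v))"
    using lex_le_nf[OF pq(3)] assms nf_in[of p] nf_in[of q] nf_in[of "(n, u)"] nf_in[of "(m, v)"] by simp
next
  have idem: "nf (nf p) = nf p" for p using bot_neq_top by (auto simp: nf_def)
  assume "lex_le I (nf (n, u)) (nf (m, v))"
  moreover have "nf (n, u) \<in> cl n u" "nf (m, v) \<in> cl m v" using idem by (simp_all add: mem_cl)
  moreover have "cl n u \<in> acar XI" "cl m v \<in> acar XI" using assms cl_in by auto
  ultimately show "(cl n u, cl m v) \<in> aord XI" by (auto simp: ivl_arch_def)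
qed

lemma ord_clI: "u \<in> icar I \<Longrightarrow> v \<in> icar I \<Longrightarrow> lex_le I (n, u) (m, v) \<Longrightarrow> (cl n u, cl m v) \<in> aord XI"
  by (simp add: ord_cl lex_le_nf)

lemma theta_cl: "theta XI (cl n u) = cl (n + 1) u"
proof -
  have "glue_equiv I `` {(fst p + 1, snd p)} = cl (n + 1) u" if "p \<in> cl n u" for p
  proof -
    have "nf (fst p + 1, snd p) = nf (n + 1, u)"
      using that by (cases p) (auto simp: mem_cl nf_def split: if_splits)
    then show ?thesis using cl_eq_iff by (simp flip: cl_def)
  qed
  moreover have "(n, u) \<in> cl n u" by (simp add: mem_cl)
  ultimately show ?thesis by (auto simp: ivl_arch_def split_beta)
qed

text \<open>On normal forms X_I is the lexicographic product of \<int> with I without its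
  top.\<close>

lemma archimedean_XI: "archimedean_set XI"
proof (rule archimedean_lexI[where A = "icar I - {top}" and h = "\<lambda>(n, u). cl n u" and r = "iord I \<inter> (icar I - {top}) \<times> (icar I - {top})"])
  show "linear_order_on (icar I - {top}) (iord I \<inter> (icar I - {top}) \<times> (icar I - {top}))"
    using linear_I unfolding order_on_defs refl_on_def total_on_def antisym_def trans_def by blast
  show "icar I - {top} \<noteq> {}" using bot_in bot_neq_top by blast
  show "inj_on (\<lambda>(n, u). cl n u) (UNIV \<times> (icar I - {top}))"
    by (auto simp: inj_on_def cl_eq_iff nf_def)
  show "acar XI = (\<lambda>(n, u). cl n u) ` (UNIV \<times> (icar I - {top}))"
    by (auto elim!: XI_carE intro: cl_in)
  show "aord XI \<subseteq> acar XI \<times> acar XI" by (auto simp: ivl_arch_def)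
qed (auto simp: ord_cl nf_def lex_le_def theta_cl)

sublocale XI: arch XI
  using archimedean_XI by unfold_locales

lemma ord_iota: "u \<in> icar I \<Longrightarrow> v \<in> icar I \<Longrightarrow> (cl 0 u, cl 0 v) \<in> aord XI \<longleftrightarrow> ile u v"
  using ile_refl[OF bot_in] ile_antisym[of top v] le_top[of u] le_top[of v] by (auto simp: ord_cl nf_def lex_le_def)

lemma iota_inj: "u \<in> icar I \<Longrightarrow> v \<in> icar I \<Longrightarrow> cl 0 u = cl 0 v \<longleftrightarrow> u = v"
  using bot_neq_top by (auto simp: cl_eq_iff nf_def split: if_splits)

lemma th_base: "XI.th (cl 0 bot) = cl 0 top"
  by (simp add: theta_cl cl_top)

text \<open>With \<open>ord_iota\<close> this identifies I with the interval from x_0 to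
  \<theta>(x_0); the upper end, of normal form (1, bottom), is the image of the top of I.\<close>

lemma base_segment:
  assumes "XI.le (cl 0 bot) x" "XI.le x (cl 0 top)"
  shows "\<exists>u\<in>icar I. x = cl 0 u"
proof -
  obtain n u where u: "u \<in> icar I" "u \<noteq> top" "x = cl n u" using XI_carE XI.le_car(2)[OF assms(1)] by metis
  then have "0 \<le> n" "n < 1 \<or> n = 1 \<and> ile u bot"
    using assms bot_in top_in bot_neq_top by (auto simp: ord_cl nf_def lex_le_def)
  then consider "n = 0" | "n = 1" "u = bot" using ile_antisym[OF _ bot_le[OF u(1)]] by force
  then show ?thesis
  proof cases
    case 2
    then show ?thesis using u top_in cl_top[of 0] by auto
  qed (use u in blast)
qed

end

definition X_map :: "'i ivl \<Rightarrow> 'i ivl \<Rightarrow> ('i \<Rightarrow> 'i) \<Rightarrow> (int \<times> 'i) set \<Rightarrow> (int \<times> 'i) set" where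
  "X_map I J \<phi> = (\<lambda>A\<in>acar (ivl_arch I). \<Union>(n, u)\<in>A. glue_equiv J `` {(n, \<phi> u)})"

lemma X_map_cl:
  assumes I: "is_interval I" and J: "is_interval J" and \<phi>: "\<phi> \<in> ivl_hom I J" and u: "u \<in> icar I"
  shows "X_map I J \<phi> (interval.cl I n u) = interval.cl J n (\<phi> u)"
proof -
  interpret I: interval I using I by unfold_locales
  interpret J: interval J using J by unfold_locales
  have "glue_equiv J `` {(fst p, \<phi> (snd p))} = J.cl n (\<phi> u)" if p: "p \<in> I.cl n u" for p
  proof -
    \<comment> \<open>Both ends are preserved by \<phi>, so it gives the same class whether it is
      applied to a pair or to its normal form.\<close>
    have *: "J.nf (fst q, \<phi> (snd q)) = J.nf (fst (I.nf q), \<phi> (snd (I.nf q)))" for q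
      using J.bot_neq_top ivl_homD(4,5)[OF \<phi>] by (auto simp: I.nf_def J.nf_def)
    have "J.nf (fst p, \<phi> (snd p)) = J.nf (n, \<phi> u)" using *[of p] *[of "(n, u)"] p by (simp add: I.mem_cl)
    then show ?thesis using J.cl_eq_iff by (simp flip: J.cl_def)
  qed
  moreover have "(n, u) \<in> I.cl n u" by (simp add: I.mem_cl)
  ultimately show ?thesis using I.cl_in[OF u] by (auto simp: X_map_def split_beta)
qed

lemma X_map_in:
  assumes I: "is_interval I" and J: "is_interval J" and \<phi>: "\<phi> \<in> ivl_hom I J"
  shows "X_map I J \<phi> \<in> arc_maps (ivl_arch I) (ivl_arch J)"
proof -
  interpret I: interval I using I by unfold_locales
  interpret J: interval J using J by unfold_locales
  note app = X_map_cl[OF I J \<phi>]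
  show ?thesis
  proof (rule arc_mapsI)
    fix x assume x: "x \<in> acar I.XI"
    then obtain n u where u: "u \<in> icar I" "x = I.cl n u" by (auto elim: I.XI_carE)
    then show "X_map I J \<phi> x \<in> acar J.XI" using app ivl_homD(1)[OF \<phi>] J.cl_in by simp
    show "X_map I J \<phi> (I.XI.th x) = J.XI.th (X_map I J \<phi> x)"
      using u app by (simp add: I.theta_cl J.theta_cl)
    fix y assume y: "y \<in> acar I.XI" "I.XI.le x y"
    obtain n u where u: "u \<in> icar I" "u \<noteq> I.top" "x = I.cl n u" using x by (auto elim: I.XI_carE)
    obtain m v where v: "v \<in> icar I" "v \<noteq> I.top" "y = I.cl m v" using y by (auto elim: I.XI_carE)
    have "lex_le I (n, u) (m, v)" using y u v by (simp add: I.ord_cl I.nf_def)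
    then have "lex_le J (n, \<phi> u) (m, \<phi> v)" using ivl_homD(3)[OF \<phi>] u v by (auto simp: lex_le_def)
    then show "J.XI.le (X_map I J \<phi> x) (X_map I J \<phi> y)"
      using u v app ivl_homD(1)[OF \<phi>] by (simp add: J.ord_clI)
  qed (simp add: X_map_def)
qed

lemma X_functor_simps [simp]:
  "fobj X_functor I = ivl_arch I"
  "fmor X_functor I J \<phi> = arc_class (ivl_arch I) (ivl_arch J) (X_map I J \<phi>)"
  by (simp_all add: X_functor_def X_map_def)

lemma is_functor_X: "is_functor Intv Arc X_functor"
  unfolding is_functor_def
proof (intro conjI ballI)
  fix I :: "'i ivl" assume "I \<in> Ob Intv"
  then have I: "is_interval I" by simp
  interpret I: interval I using I by unfold_locales
  show "fobj X_functor I \<in> Ob Arc" using I.archimedean_XI by simp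
  have "(\<lambda>x\<in>icar I. x) \<in> ivl_hom I I" using I.bot_in I.top_in by (auto intro!: ivl_homI)
  then have "X_map I I (\<lambda>x\<in>icar I. x) x = x" if "x \<in> acar I.XI" for x
    using that X_map_cl[OF I I] by (auto elim!: I.XI_carE)
  then have "X_map I I (\<lambda>x\<in>icar I. x) = (\<lambda>x\<in>acar I.XI. x)" by (auto simp: X_map_def fun_eq_iff)
  then show "fmor X_functor I I (Idn Intv I) = Idn Arc (fobj X_functor I)" by simp
  fix J :: "'i ivl" and \<phi> assume "J \<in> Ob Intv" and "\<phi> \<in> Hom Intv I J"
  then have J: "is_interval J" and \<phi>: "\<phi> \<in> ivl_hom I J" by simp_all
  interpret J: interval J using J by unfold_locales
  show "fmor X_functor I J \<phi> \<in> Hom Arc (fobj X_functor I) (fobj X_functor J)"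
    using X_map_in[OF I J \<phi>] by (simp add: arc_class_in_hom)
  fix K :: "'i ivl" and \<psi> assume "K \<in> Ob Intv" and "\<psi> \<in> Hom Intv J K"
  then have K: "is_interval K" and \<psi>: "\<psi> \<in> ivl_hom J K" by simp_all
  interpret K: interval K using K by unfold_locales
  have \<psi>\<phi>: "compose (icar I) \<psi> \<phi> \<in> ivl_hom I K" by (rule ivl_hom_compose[OF I.bot_in I.top_in \<phi> \<psi>])
  have "X_map I K (compose (icar I) \<psi> \<phi>) = compose (acar I.XI) (X_map J K \<psi>) (X_map I J \<phi>)"
  proof
    fix x
    show "X_map I K (compose (icar I) \<psi> \<phi>) x = compose (acar I.XI) (X_map J K \<psi>) (X_map I J \<phi>) x"
    proof (cases "x \<in> acar I.XI")
      case True
      then obtain n u where u: "u \<in> icar I" "x = I.cl n u" by (auto elim: I.XI_carE)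
      then show ?thesis
        using True X_map_cl[OF I K \<psi>\<phi>] X_map_cl[OF I J \<phi>] X_map_cl[OF J K \<psi>] ivl_homD(1)[OF \<phi>]
        by (simp add: compose_eq)
    qed (simp add: compose_def X_map_def)
  qed
  then show "fmor X_functor I K (Cmp Intv I J K \<psi> \<phi>) =
      Cmp Arc (fobj X_functor I) (fobj X_functor J) (fobj X_functor K) (fmor X_functor J K \<psi>) (fmor X_functor I J \<phi>)"
    using arc_comp_class[OF I.archimedean_XI J.archimedean_XI K.archimedean_XI X_map_in[OF I J \<phi>] X_map_in[OF J K \<psi>]]
    by simp
qed

section \<open>The composite point\<close>

text \<open>The transpose of j(h) and the dual of h are left adjoints of the same map, taken over
  \<int> and over a single block. The range includes n + 1, where the next block begins.\<close>

lemma tr_j_map: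
  assumes h: "h \<in> Hom Delta m n" and y: "0 \<le> y" "y \<le> int n + 1"
  shows "tr (j_map m n h) y = int (dual_map m n h (nat y))"
proof -
  interpret j: Zarc_map m n "j_map m n h" using j_map_in[OF h] by unfold_locales
  define d where "d = dual_map m n h (nat y)"
  have d: "d \<le> m + 1" unfolding d_def by (rule dual_map_le) (use y in simp)
  have galois: "d \<le> i \<longleftrightarrow> y \<le> int (h i)" if "i \<le> m" for i
    using dual_map_galois[OF h that, of "nat y"] y unfolding d_def by auto
  have j: "j_map m n h (int i) = int (h i)" if "i \<le> m" for i using that by (simp add: j_map_def)
  have "y \<le> j_map m n h (int d)"
  proof (cases "d \<le> m")
    case True
    then show ?thesis using galois[of d] j by simp
  next
    case False
    \<comment> \<open>The number m + 1 opens the next block, where j(h) is at least n + 1.\<close>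
    then have "d = m + 1" using d by simp
    then show ?thesis using j.period[of 0] j[of 0] y by (simp add: add.commute)
  qed
  moreover have "\<not> y \<le> j_map m n h (int d - 1)"
  proof (cases d)
    case 0
    \<comment> \<open>Just before the block, j(h) is negative.\<close>
    then show ?thesis using j.period[of "-1"] j[of m] Delta_app[OF h, of m] y by simp
  next
    case (Suc i)
    then show ?thesis using galois[of i] j[of i] d by simp
  qed
  ultimately have "tr (j_map m n h) y \<le> int d" "\<not> tr (j_map m n h) y \<le> int d - 1" using j.galois by auto
  then show ?thesis by (simp add: d_def)
qed

text \<open>Write v(0) as the m-th translate of a point y of the fundamental domain at
  \<open>x0\<close>. Going back m periods reaches y, and one more period falls below
  \<open>x0\<close>.\<close>

lemma arc_threshold:
  assumes X: "archimedean_set X" and v: "v \<in> arc_maps (Zarc r) X" and x0: "x0 \<in> acar X"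
  shows "\<exists>c. \<forall>y. (x0, v y) \<in> aord X \<longleftrightarrow> c \<le> y"
proof -
  interpret v: arch_map "Zarc r" X v using X v archimedean_Zarc by unfold_locales
  have vin: "v y \<in> acar X" for y using v.app by simp
  obtain m y where y: "v.Y.le x0 y" "v.Y.le y (v.Y.th x0)" "y \<noteq> v.Y.th x0" "v 0 = v.Y.T m y"
    using v.Y.fundamental_domain[OF x0 vin] by blast
  have yX: "y \<in> acar X" using y v.Y.le_car by blast
  have periods: "v (k * (int r + 1)) = v.Y.T (k + m) y" for k
    using v.commute_T[of 0 k] y yX by (simp add: v.Y.T_add)
  show ?thesis
  proof (rule int_threshold)
    show "v.Y.le x0 (v z')" if "v.Y.le x0 (v z)" "z \<le> z'" for z z'
      using that v.mono[of z z'] v.Y.le_trans by simp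
    show "v.Y.le x0 (v ((- m) * (int r + 1)))" unfolding periods using y by simp
    show "\<not> v.Y.le x0 (v ((- m - 1) * (int r + 1)))"
    proof
      assume "v.Y.le x0 (v ((- m - 1) * (int r + 1)))"
      then have "v.Y.le x0 (v.Y.T (-1) y)" unfolding periods by simp
      from v.Y.T_le[OF this, of 1] have "v.Y.le (v.Y.th x0) y" using v.Y.T_minus(2)[OF yX, of 1] by (simp add: v.Y.T_1)
      then show False using y v.Y.le_antisym by blast
    qed
  qed
qed

text \<open>The increasing injection that sends k, ..., k + r to 1, ..., r + 1 and omits exactly the
  multiples of r + 2, the places where the base point and its translates are inserted. It is the
  transpose of the f of a standard pair.\<close>

definition shift_map :: "int \<Rightarrow> nat \<Rightarrow> int \<Rightarrow> int" where
  "shift_map k r y = (y - k) mod (int r + 1) + 1 + ((y - k) div (int r + 1)) * (int r + 2)"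

lemma shift_map_base: "k \<le> y \<Longrightarrow> y \<le> k + int r \<Longrightarrow> shift_map k r y = y - k + 1"
  by (simp add: shift_map_def)

lemma shift_map_in: "shift_map k r \<in> arc_maps (Zarc r) (Zarc (r + 1))"
  unfolding Zarc_maps_iff
proof (intro conjI allI monoI)
  fix x y :: int assume "x \<le> y"
  then consider "(x - k) div (int r + 1) + 1 \<le> (y - k) div (int r + 1)"
    | "(x - k) div (int r + 1) = (y - k) div (int r + 1)" "(x - k) mod (int r + 1) \<le> (y - k) mod (int r + 1)"
    using div_mod_mono[of "x - k" "y - k" "int r + 1"] by fastforce
  then show "shift_map k r x \<le> shift_map k r y"
  proof cases
    case 1
    have "(x - k) mod (int r + 1) < int r + 1" "0 \<le> (y - k) mod (int r + 1)"
      using pos_mod_bound[of "int r + 1" "x - k"] by simp_all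
    moreover have "((x - k) div (int r + 1) + 1) * (int r + 2) \<le> ((y - k) div (int r + 1)) * (int r + 2)"
      using 1 by (intro mult_right_mono) auto
    \<comment> \<open>The products are abstracted to p and q, which makes the comparison of
      successive blocks linear.\<close>
    moreover have "a + 1 + p \<le> b + 1 + q" if "a < int r + 1" "0 \<le> b" "p + 1 * (int r + 2) \<le> q" for a b p q :: int
      using that by simp
    ultimately show ?thesis unfolding shift_map_def distrib_right by blast
  next
    case 2
    then show ?thesis by (simp add: shift_map_def)
  qed
next
  fix x
  have e: "x + int r + 1 - k = (x - k) + (int r + 1)" by simp
  have "(x + int r + 1 - k) div (int r + 1) = (x - k) div (int r + 1) + 1" unfolding e by (rule div_add_self2) simp
  moreover have "(x + int r + 1 - k) mod (int r + 1) = (x - k) mod (int r + 1)" unfolding e by (rule mod_add_self2)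
  ultimately show "shift_map k r (x + int r + 1) = shift_map k r x + int (r + 1) + 1"
    unfolding shift_map_def by (simp add: distrib_right)
qed

text \<open>The f of a standard pair, recovered from its transpose; existence is
  \<open>tr_surj\<close> and uniqueness \<open>tr_inj\<close>.\<close>

definition shift_adj :: "int \<Rightarrow> nat \<Rightarrow> int \<Rightarrow> int" where
  "shift_adj k r = (SOME f. f \<in> arc_maps (Zarc (r + 1)) (Zarc r) \<and> tr f = shift_map k r)"

lemma shift_adj: "shift_adj k r \<in> arc_maps (Zarc (r + 1)) (Zarc r)" "tr (shift_adj k r) = shift_map k r"
proof -
  have "\<exists>f. f \<in> arc_maps (Zarc (r + 1)) (Zarc r) \<and> tr f = shift_map k r"
    using tr_surj[OF shift_map_in] by blast
  from someI_ex[OF this] show "shift_adj k r \<in> arc_maps (Zarc (r + 1)) (Zarc r)" "tr (shift_adj k r) = shift_map k r"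
    unfolding shift_adj_def by blast+
qed

section \<open>Presentations of the maps to X_I by interval morphisms\<close>

context interval
begin

abbreviation FI where "FI n \<equiv> ivl_hom (fin_ivl (n + 1)) I"

lemma FI_in: "u \<in> FI n \<Longrightarrow> i \<le> n + 1 \<Longrightarrow> u i \<in> icar I"
  and FI_mono: "u \<in> FI n \<Longrightarrow> i \<le> j \<Longrightarrow> j \<le> n + 1 \<Longrightarrow> ile (u i) (u j)"
  and FI_0: "u \<in> FI n \<Longrightarrow> u 0 = bot" and FI_end: "u \<in> FI n \<Longrightarrow> u (Suc n) = top"
  using ivl_homD[of u "fin_ivl (n + 1)" I] by auto

text \<open>A block has length n + 1 although u has n + 2 values, because the top of a copy is glued
  to the bottom of the next: the value at n + 1 is the first one of the next block.\<close>

definition ext :: "nat \<Rightarrow> (nat \<Rightarrow> 'i) \<Rightarrow> int \<Rightarrow> (int \<times> 'i) set" where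
  "ext n u y = cl (y div (int n + 1)) (u (nat (y mod (int n + 1))))"

lemma ext_in:
  assumes u: "u \<in> FI n"
  shows "ext n u \<in> arc_maps (Zarc n) XI"
proof (rule arc_mapsI)
  have u_in: "u (nat (y mod (int n + 1))) \<in> icar I" for y using FI_in[OF u] nat_mod_le[of y n] by simp
  show "ext n u x \<in> acar XI" for x unfolding ext_def using u_in by (rule cl_in)
  fix x y assume "(x, y) \<in> aord (Zarc n)"
  then have "x \<le> y" by simp
  then consider "x div (int n + 1) < y div (int n + 1)"
    | "x div (int n + 1) = y div (int n + 1)" "x mod (int n + 1) \<le> y mod (int n + 1)"
    using div_mod_mono[of x y "int n + 1"] by auto
  then have "lex_le I (x div (int n + 1), u (nat (x mod (int n + 1)))) (y div (int n + 1), u (nat (y mod (int n + 1))))"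
    by cases (use nat_mod_le[of y n] in \<open>auto simp: lex_le_def intro!: FI_mono[OF u]\<close>)
  then show "(ext n u x, ext n u y) \<in> aord XI" unfolding ext_def using u_in by (intro ord_clI)
next
  fix x
  have "(x + int n + 1) div (int n + 1) = x div (int n + 1) + 1" "(x + int n + 1) mod (int n + 1) = x mod (int n + 1)"
    using div_add_self2[of "int n + 1" x] mod_add_self2[of x "int n + 1"] by (simp_all add: add.assoc)
  then show "ext n u (theta (Zarc n) x) = theta XI (ext n u x)" by (simp add: ext_def theta_cl)
qed simp

lemma ext_base:
  assumes u: "u \<in> FI n" and y: "0 \<le> y" "y \<le> int n + 1"
  shows "ext n u y = cl 0 (u (nat y))"
proof (cases "y = int n + 1")
  case True
  then have "nat y = Suc n" by simp
  then show ?thesis using True FI_0[OF u] FI_end[OF u] cl_top[of 0] by (simp add: ext_def)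
qed (use y in \<open>simp add: ext_def\<close>)

text \<open>Both sides are equivariant, so it is enough to compare them on one block, where
  \<open>tr_j_map\<close> applies. This is the naturality of \<eta> over j.\<close>

lemma ext_dual:
  assumes h: "h \<in> Hom Delta m n" and u: "u \<in> FI m"
  shows "ext n (compose {0..n + 1} u (dual_map m n h)) = (\<lambda>y. ext m u (tr (j_map m n h) y))"
proof (rule arc_maps_eqI[OF archimedean_Zarc[of n] archimedean_XI, where b = 0])
  interpret j: Zarc_map m n "j_map m n h" using j_map_in[OF h] by unfold_locales
  have uh: "compose {0..n + 1} u (dual_map m n h) \<in> FI n" by (rule compose_dual_hom[OF h u])
  then show "ext n (compose {0..n + 1} u (dual_map m n h)) \<in> arc_maps (Zarc n) XI" by (rule ext_in)
  show "(\<lambda>y. ext m u (tr (j_map m n h) y)) \<in> arc_maps (Zarc n) XI"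
    by (rule Zarc_maps_comp[OF archimedean_XI j.tr_in ext_in[OF u]])
  fix y assume "(0, y) \<in> aord (Zarc n)" "(y, theta (Zarc n) 0) \<in> aord (Zarc n)"
  then have y: "0 \<le> y" "y \<le> int n + 1" by auto
  have "dual_map m n h (nat y) \<le> m + 1" by (rule dual_map_le) (use y in simp)
  then have "ext m u (tr (j_map m n h) y) = cl 0 (u (dual_map m n h (nat y)))"
    using ext_base[OF u, of "int (dual_map m n h (nat y))"] by (simp add: tr_j_map[OF h y])
  also have "u (dual_map m n h (nat y)) = compose {0..n + 1} u (dual_map m n h) (nat y)"
    using y by (simp add: compose_eq)
  also have "cl 0 \<dots> = ext n (compose {0..n + 1} u (dual_map m n h)) y" by (rule ext_base[OF uh y, symmetric])
  finally show "ext n (compose {0..n + 1} u (dual_map m n h)) y = ext m u (tr (j_map m n h) y)" ..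
qed simp

definition iota_inv :: "(int \<times> 'i) set \<Rightarrow> 'i" where
  "iota_inv x = (SOME u. u \<in> icar I \<and> x = cl 0 u)"

lemma iota_inv_cl: "u \<in> icar I \<Longrightarrow> iota_inv (cl 0 u) = u"
  unfolding iota_inv_def by (rule some_equality) (auto simp: iota_inj)

lemma iota_inv:
  assumes "XI.le (cl 0 bot) x" "XI.le x (cl 0 top)"
  shows "iota_inv x \<in> icar I" "cl 0 (iota_inv x) = x"
  using base_segment[OF assms] iota_inv_cl by auto

lemma iota_inv_mono:
  assumes "XI.le (cl 0 bot) x" "XI.le x y" "XI.le y (cl 0 top)"
  shows "ile (iota_inv x) (iota_inv y)"
proof -
  have "XI.le x (cl 0 top)" "XI.le (cl 0 bot) y" using assms XI.le_trans by blast+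
  then show ?thesis using assms iota_inv[of x] iota_inv[of y] ord_iota[of "iota_inv x" "iota_inv y"] by simp
qed

text \<open>The u of a standard pair. Entry j is v(k + j - 1) read in I; the offset -1 agrees with
  \<open>shift_map\<close>, whose omitted places receive the ends at j = 0 and j = r + 2.\<close>

definition window :: "(int \<Rightarrow> (int \<times> 'i) set) \<Rightarrow> int \<Rightarrow> nat \<Rightarrow> nat \<Rightarrow> 'i" where
  "window v k r = (\<lambda>j\<in>{0..r + 2}. if j = 0 then bot else if j = r + 2 then top else iota_inv (v (k + int j - 1)))"

lemma window_0: "window v k r 0 = bot" and window_end: "window v k r (Suc (Suc r)) = top"
  by (simp_all add: window_def)

abbreviation cls where
  "cls r \<equiv> tensor_class Delta (comp_functor (fobj (yoneda Lambda) r) (op_functor j_functor)) (fobj F_functor I)"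

definition std where
  "std v k r = cls r (r + 1, arc_class (Zarc (r + 1)) (Zarc r) (shift_adj k r), window v k r)"

text \<open>The triple \<open>std v k r\<close> represents \<open>v\<close> as soon as \<open>v(k - 1) \<le> x\<^sub>0 \<le> v(k)\<close>, where \<open>x\<^sub>0\<close> is the class
  of \<open>(0, b)\<close>: then \<open>v(k), \<dots>, v(k + r)\<close> lie in the fundamental interval between \<open>x\<^sub>0\<close> and \<open>\<theta>(x\<^sub>0)\<close>,
  a copy of \<open>I\<close>.\<close>

lemma window_range:
  assumes v: "v \<in> arc_maps (Zarc r) XI" and k: "XI.le (v (k - 1)) (cl 0 bot)" "XI.le (cl 0 bot) (v k)"
    and y: "k \<le> y" "y \<le> k + int r"
  shows "XI.le (cl 0 bot) (v y)" "XI.le (v y) (cl 0 top)"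
proof -
  interpret v: arch_map "Zarc r" XI v using v archimedean_Zarc archimedean_XI by unfold_locales
  show "XI.le (cl 0 bot) (v y)" using XI.le_trans[OF k(2)] v.mono[of k y] y by simp
  \<comment> \<open>By equivariance the last value of the window is the translate of v(k - 1), so
    the condition on v(k - 1) bounds the window from above by \<theta>(x_0).\<close>
  have "v (k + int r) = XI.th (v (k - 1))" using v.commute[of "k - 1"] by (simp add: add.commute)
  then have "XI.le (v (k + int r)) (cl 0 top)" using XI.le_th[OF k(1)] th_base by simp
  then show "XI.le (v y) (cl 0 top)" using XI.le_trans v.mono[of y "k + int r"] y by simp
qed

lemma window_hom:
  assumes v: "v \<in> arc_maps (Zarc r) XI" and k: "XI.le (v (k - 1)) (cl 0 bot)" "XI.le (cl 0 bot) (v k)"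
  shows "window v k r \<in> FI (r + 1)"
proof (rule ivl_homI)
  interpret v: arch_map "Zarc r" XI v using v archimedean_Zarc archimedean_XI by unfold_locales
  note range = window_range[OF v k]
  have in_I: "window v k r j \<in> icar I" if "j \<le> r + 2" for j
    using that bot_in top_in iota_inv(1)[OF range, of "k + int j - 1"] by (auto simp: window_def)
  then show "window v k r j \<in> icar I" if "j \<in> icar (fin_ivl (r + 1 + 1))" for j using that by simp
  fix i j assume "(i, j) \<in> iord (fin_ivl (r + 1 + 1))"
  then have ij: "i \<le> j" "j \<le> r + 2" by auto
  consider "i = 0" | "j = r + 2" | "0 < i" "j < r + 2" using ij by linarith
  then show "ile (window v k r i) (window v k r j)"
  proof cases
    case 1
    then show ?thesis using bot_le in_I ij by (simp add: window_0)
  next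
    case 2
    then show ?thesis using le_top in_I ij by (simp add: window_end)
  next
    case 3
    then have "ile (iota_inv (v (k + int i - 1))) (iota_inv (v (k + int j - 1)))"
      using ij by (intro iota_inv_mono range v.mono) auto
    then show ?thesis using 3 ij by (simp add: window_def)
  qed
qed (auto simp: window_def)

text \<open>Both sides are equivariant and agree at k, ..., k + r, which is one full period. This
  supplies the presentations demanded by \<open>surj\<close>.\<close>

lemma ext_window:
  assumes v: "v \<in> arc_maps (Zarc r) XI" and k: "XI.le (v (k - 1)) (cl 0 bot)" "XI.le (cl 0 bot) (v k)"
  shows "(\<lambda>y. ext (r + 1) (window v k r) (shift_map k r y)) = v"
proof (rule arc_maps_eqI[OF archimedean_Zarc archimedean_XI _ _ v, where b = k])
  note U = window_hom[OF v k]
  show "(\<lambda>y. ext (r + 1) (window v k r) (shift_map k r y)) \<in> arc_maps (Zarc r) XI"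
    by (rule Zarc_maps_comp[OF archimedean_XI shift_map_in ext_in[OF U]])
  fix y assume "(k, y) \<in> aord (Zarc r)" "(y, theta (Zarc r) k) \<in> aord (Zarc r)" "y \<noteq> theta (Zarc r) k"
  then have y: "k \<le> y" "y \<le> k + int r" by auto
  have "ext (r + 1) (window v k r) (y - k + 1) = cl 0 (window v k r (nat (y - k + 1)))"
    using y by (intro ext_base[OF U]) auto
  also have "window v k r (nat (y - k + 1)) = iota_inv (v y)" using y by (auto simp: window_def nat_le_iff)
  also have "cl 0 (iota_inv (v y)) = v y" by (rule iota_inv(2)[OF window_range[OF v k y]])
  finally show "ext (r + 1) (window v k r) (shift_map k r y) = v y" by (simp add: shift_map_base[OF y])
qed simp

text \<open>With \<open>g = f\<^sup>t\<close> and \<open>g(k - 1) \<le> 0 \<le> g(k)\<close>, the values \<open>g(k), \<dots>, g(k + r)\<close> lie in \<open>{0, \<dots>, m + 1}\<close>; they are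
  the interior values of the dual \<open>d\<close> of the morphism of \<open>\<Delta>\<close> that relates the two triples.\<close>

lemma standard_form:
  assumes f: "f \<in> arc_maps (Zarc m) (Zarc r)" and u: "u \<in> FI m"
    and k: "tr f (k - 1) \<le> 0" "0 \<le> tr f k" and v: "v = (\<lambda>y. ext m u (tr f y))"
  shows "cls r (m, arc_class (Zarc m) (Zarc r) f, u) = std v k r"
proof -
  interpret f: Zarc_map m r f using f by unfold_locales
  interpret g: Zarc_map r m "tr f" using f.tr_in by unfold_locales
  have v_in: "v \<in> arc_maps (Zarc r) XI" unfolding v by (rule Zarc_maps_comp[OF archimedean_XI f.tr_in ext_in[OF u]])
  \<comment> \<open>The upper bound comes from the period: the value at k + r is m + 1 more than the
    one at k - 1.\<close>
  have g_range: "0 \<le> tr f y" "tr f y \<le> int m + 1" if "k \<le> y" "y \<le> k + int r" for y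
    using g.mono[OF that(1)] g.mono[OF that(2)] g.period[of "k - 1"] k by (simp_all add: add.commute)
  define d where "d = (\<lambda>j\<in>{0..r + 2}. if j = 0 then 0 else if j = r + 2 then m + 1 else nat (tr f (k + int j - 1)))"
  have "d \<in> ivl_hom (fin_ivl (r + 1 + 1)) (fin_ivl (m + 1))"
  proof (rule ivl_homI)
    have d_le: "d j \<le> m + 1" if "j \<le> r + 2" for j
      using that g_range(2)[of "k + int j - 1"] by (auto simp: d_def)
    have d_end: "d (Suc (Suc r)) = Suc m" by (simp add: d_def)
    show "d j \<in> icar (fin_ivl (m + 1))" if "j \<in> icar (fin_ivl (r + 1 + 1))" for j using d_le that by simp
    fix i j assume "(i, j) \<in> iord (fin_ivl (r + 1 + 1))"
    then have ij: "i \<le> j" "j \<le> r + 2" by auto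
    consider "i = 0" | "j = r + 2" | "0 < i" "j < r + 2" using ij by linarith
    then have "d i \<le> d j"
    proof cases
      case 2
      then show ?thesis using d_le[of i] d_end ij by simp
    next
      case 3
      then show ?thesis using ij by (auto simp: d_def intro!: nat_mono g.mono)
    qed (simp add: d_def)
    then show "(d i, d j) \<in> iord (fin_ivl (m + 1))" using d_le ij by simp
  qed (auto simp: d_def)
  then obtain h where h: "h \<in> Hom Delta m (r + 1)" "dual_map m (r + 1) h = d" using dual_map_surj[of d "r + 1" m] by blast
  interpret j: Zarc_map m "r + 1" "j_map m (r + 1) h" using j_map_in[OF h(1)] by unfold_locales
  \<comment> \<open>That f is j(h) followed by the standard morphism is checked on transposes, whose
    values on one period are explicit.\<close>
  have "(\<lambda>y. tr (j_map m (r + 1) h) (shift_map k r y)) = tr f"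
  proof (rule arc_maps_eqI[OF archimedean_Zarc archimedean_Zarc _ _ f.tr_in, where b = k])
    show "(\<lambda>y. tr (j_map m (r + 1) h) (shift_map k r y)) \<in> arc_maps (Zarc r) (Zarc m)"
      by (rule Zarc_maps_comp[OF archimedean_Zarc shift_map_in j.tr_in])
    fix y assume "(k, y) \<in> aord (Zarc r)" "(y, theta (Zarc r) k) \<in> aord (Zarc r)" "y \<noteq> theta (Zarc r) k"
    then have y: "k \<le> y" "y \<le> k + int r" by auto
    then have "tr (j_map m (r + 1) h) (y - k + 1) = int (d (nat (y - k + 1)))"
      using tr_j_map[OF h(1), of "y - k + 1"] h(2) by simp
    also have "\<dots> = tr f y" using y g_range(1)[OF y] by (auto simp: d_def nat_le_iff)
    finally show "tr (j_map m (r + 1) h) (shift_map k r y) = tr f y" by (simp add: shift_map_base[OF y])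
  qed simp
  then have "tr (\<lambda>x. shift_adj k r (j_map m (r + 1) h x)) = tr f"
    using tr_comp[OF j_map_in[OF h(1)] shift_adj(1)] shift_adj(2) by simp
  then have fh: "(\<lambda>x. shift_adj k r (j_map m (r + 1) h x)) = f"
    by (intro tr_inj[OF Zarc_maps_comp[OF archimedean_Zarc j_map_in[OF h(1)] shift_adj(1)] f])
  have ud: "compose {0..r + 1 + 1} u d = window v k r"
  proof
    fix j
    consider "j = 0" | "j = r + 2" | "0 < j" "j < r + 2" | "r + 2 < j" by linarith
    then show "compose {0..r + 1 + 1} u d j = window v k r j"
    proof cases
      case 3
      define y where "y = k + int j - 1"
      have y: "k \<le> y" "y \<le> k + int r" using 3 by (auto simp: y_def)
      have "v y = cl 0 (u (nat (tr f y)))" unfolding v using ext_base[OF u g_range[OF y]] .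
      moreover have "u (nat (tr f y)) \<in> icar I" using FI_in[OF u] g_range(2)[OF y] by simp
      ultimately have "iota_inv (v y) = u (nat (tr f y))" by (simp add: iota_inv_cl)
      then show ?thesis using 3 by (simp add: compose_def d_def window_def y_def)
    qed (simp_all add: compose_def d_def window_def FI_0[OF u] FI_end[OF u])
  qed
  let ?R = "comp_functor (fobj (yoneda Lambda) r) (op_functor j_functor)"
  let ?f = "arc_class (Zarc (r + 1)) (Zarc r) (shift_adj k r)"
  have "cls r (m, fmor ?R (r + 1) m h ?f, u) = cls r (r + 1, ?f, fmor (fobj F_functor I) m (r + 1) h u)"
    using h(1) u shift_adj(1) by (intro tensor_class_move) (auto simp: arc_class_in_hom simp del: Delta_simps(2))
  moreover have "fmor ?R (r + 1) m h ?f = arc_class (Zarc m) (Zarc r) f"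
    using arc_comp_Zarc[OF archimedean_Zarc j_map_in[OF h(1)] shift_adj(1)] fh shift_adj(1)
    by (simp add: arc_class_in_hom)
  moreover have "fmor (fobj F_functor I) m (r + 1) h u = window v k r" using u h(2) ud by simp
  ultimately show ?thesis by (simp add: std_def)
qed

text \<open>If \<open>v(k) = x\<^sub>0\<close>, then \<open>v(k), \<dots>, v(k + r + 1)\<close> is itself a morphism of intervals, and its triple
  has both \<open>std v k r\<close> and \<open>std v (k + 1) r\<close> as standard forms.\<close>

lemma std_step:
  assumes v: "v \<in> arc_maps (Zarc r) XI" and k: "v k = cl 0 bot"
  shows "std v k r = std v (k + 1) r"
proof -
  interpret v: arch_map "Zarc r" XI v using v archimedean_Zarc archimedean_XI by unfold_locales
  define u where "u = (\<lambda>j\<in>{0..r + 1}. iota_inv (v (k + int j)))"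
  have end_v: "v (k + int r + 1) = cl 0 top" using v.commute[of k] k th_base by simp
  have range: "XI.le (cl 0 bot) (v y)" "XI.le (v y) (cl 0 top)" if "k \<le> y" "y \<le> k + int r + 1" for y
    using v.mono[of k y] v.mono[of y "k + int r + 1"] that k end_v by simp_all
  have u: "u \<in> FI r"
  proof (rule ivl_homI)
    show "u j \<in> icar I" if "j \<in> icar (fin_ivl (r + 1))" for j
      using that by (auto simp: u_def intro!: iota_inv(1) range)
    show "ile (u i) (u j)" if "(i, j) \<in> iord (fin_ivl (r + 1))" for i j
      using that by (auto simp: u_def intro!: iota_inv_mono range v.mono)
    show "u (ibot (fin_ivl (r + 1))) = bot" by (simp add: u_def k iota_inv_cl bot_in)
    show "u (itop (fin_ivl (r + 1))) = top" using end_v by (simp add: u_def iota_inv_cl top_in ac_simps)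
  qed (auto simp: u_def)
  \<comment> \<open>The transpose of translation by k takes the values -1, 0, 1 at k - 1, k, k + 1.
    Hence both k and k + 1 satisfy the hypothesis of \<open>standard_form\<close>.\<close>
  have f: "(\<lambda>x. x + k) \<in> arc_maps (Zarc r) (Zarc r)" by (auto simp: Zarc_maps_iff mono_def)
  interpret f: Zarc_map r r "\<lambda>x. x + k" using f by unfold_locales
  have tr: "tr (\<lambda>x. x + k) = (\<lambda>y. y - k)" by (rule f.tr_eqI) auto
  have "v = (\<lambda>y. ext r u (tr (\<lambda>x. x + k) y))"
  proof (rule arc_maps_eqI[OF archimedean_Zarc archimedean_XI _ v Zarc_maps_comp[OF archimedean_XI f.tr_in ext_in[OF u]], where b = k])
    fix y assume "(k, y) \<in> aord (Zarc r)" "(y, theta (Zarc r) k) \<in> aord (Zarc r)"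
    then have y: "k \<le> y" "y \<le> k + int r + 1" by auto
    then have "ext r u (y - k) = cl 0 (u (nat (y - k)))" by (intro ext_base[OF u]) auto
    also have "u (nat (y - k)) = iota_inv (v y)" using y by (auto simp: u_def nat_le_iff)
    also have "cl 0 (iota_inv (v y)) = v y" by (rule iota_inv(2)[OF range[OF y]])
    finally show "v y = ext r u (tr (\<lambda>x. x + k) y)" by (simp add: tr)
  qed simp
  then have "cls r (r, arc_class (Zarc r) (Zarc r) (\<lambda>x. x + k), u) = std v k' r" if "k' = k \<or> k' = k + 1" for k'
    using that by (intro standard_form[OF f u]) (auto simp: tr)
  from this[of k] this[of "k + 1"] show ?thesis by simp
qed

text \<open>Monotonicity squeezes v to the constant value x_0 from k to l - 1, so
  \<open>std_step\<close> applies at each of these places.\<close>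

lemma std_eq:
  assumes v: "v \<in> arc_maps (Zarc r) XI" and k: "XI.le (cl 0 bot) (v k)" and l: "XI.le (v (l - 1)) (cl 0 bot)"
    and "k \<le> l"
  shows "std v k r = std v l r"
  using \<open>k \<le> l\<close> l
proof (induction l rule: int_ge_induct)
  case (step i)
  interpret v: arch_map "Zarc r" XI v using v archimedean_Zarc archimedean_XI by unfold_locales
  have i: "XI.le (v i) (cl 0 bot)" using step by simp
  have "XI.le (v k) (v i)" "XI.le (v (i - 1)) (v i)" using v.mono step(1) by simp_all
  then have "v i = cl 0 bot" "XI.le (v (i - 1)) (cl 0 bot)" using i k XI.le_antisym XI.le_trans by blast+
  then show ?case using step std_step[OF v] by simp
qed simp

text \<open>Each presentation has its own k, found where the transpose of its f passes 0. Both are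
  admissible for the common v, and \<open>std_eq\<close> links the two standard forms.\<close>

lemma class_eqI:
  assumes f: "f \<in> arc_maps (Zarc m) (Zarc r)" and u: "u \<in> FI m"
    and f': "f' \<in> arc_maps (Zarc m') (Zarc r)" and u': "u' \<in> FI m'"
    and eq: "(\<lambda>y. ext m u (tr f y)) = (\<lambda>y. ext m' u' (tr f' y))"
  shows "cls r (m, arc_class (Zarc m) (Zarc r) f, u) = cls r (m', arc_class (Zarc m') (Zarc r) f', u')"
proof -
  define v where "v = (\<lambda>y. ext m u (tr f y))"
  have key: "\<exists>k. cls r (m, arc_class (Zarc m) (Zarc r) f, u) = std v k r \<and>
      XI.le (v (k - 1)) (cl 0 bot) \<and> XI.le (cl 0 bot) (v k)"
    if f: "f \<in> arc_maps (Zarc m) (Zarc r)" and u: "u \<in> FI m" and v: "v = (\<lambda>y. ext m u (tr f y))" for f m u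
  proof -
    interpret f: Zarc_map m r f using f by unfold_locales
    interpret e: arch_map "Zarc m" XI "ext m u"
      using ext_in[OF u] archimedean_Zarc archimedean_XI by unfold_locales
    \<comment> \<open>The threshold is that of the transpose and not that of v, as
      \<open>standard_form\<close> requires. The inequalities for v follow because the extension of
      u sends 0 to x_0.\<close>
    obtain k where k: "\<And>y. 0 \<le> tr f y \<longleftrightarrow> k \<le> y"
      using arc_threshold[OF archimedean_Zarc f.tr_in, of 0] by auto
    have "\<not> 0 \<le> tr f (k - 1)" "0 \<le> tr f k" using k by auto
    then have "cls r (m, arc_class (Zarc m) (Zarc r) f, u) = std v k r"
      by (intro standard_form[OF f u _ _ v]) auto
    moreover have "ext m u 0 = cl 0 bot" using ext_base[OF u, of 0] FI_0[OF u] by simp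
    then have "XI.le (v (k - 1)) (cl 0 bot)" "XI.le (cl 0 bot) (v k)"
      using e.mono[of "tr f (k - 1)" 0] e.mono[of 0 "tr f k"] \<open>\<not> 0 \<le> tr f (k - 1)\<close> \<open>0 \<le> tr f k\<close> by (simp_all add: v)
    ultimately show ?thesis by blast
  qed
  interpret f: Zarc_map m r f using f by unfold_locales
  have v_in: "v \<in> arc_maps (Zarc r) XI" unfolding v_def by (rule Zarc_maps_comp[OF archimedean_XI f.tr_in ext_in[OF u]])
  obtain k where k: "cls r (m, arc_class (Zarc m) (Zarc r) f, u) = std v k r" "XI.le (v (k - 1)) (cl 0 bot)" "XI.le (cl 0 bot) (v k)"
    using key[OF f u v_def] by blast
  obtain k' where k': "cls r (m', arc_class (Zarc m') (Zarc r) f', u') = std v k' r" "XI.le (v (k' - 1)) (cl 0 bot)" "XI.le (cl 0 bot) (v k')"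
    using key[OF f' u'] eq v_def by blast
  have "std v k r = std v k' r"
  proof (cases "k \<le> k'")
    case True
    then show ?thesis by (rule std_eq[OF v_in k(3) k'(2)])
  next
    case False
    then have "k' \<le> k" by simp
    then show ?thesis by (rule std_eq[OF v_in k'(3) k(2), symmetric])
  qed
  then show ?thesis unfolding k(1) k'(1) .
qed

definition \<eta> :: "nat \<Rightarrow> (nat \<Rightarrow> 'i) \<Rightarrow> (int \<Rightarrow> (int \<times> 'i) set) set" where
  "\<eta> n u = arc_class (Zarc n) XI (ext n u)"

lemma P_\<eta>:
  assumes "f \<in> arc_maps (Zarc m) (Zarc r)" "u \<in> FI m"
  shows "fmor (fobj P_functor XI) m r (arc_class (Zarc m) (Zarc r) f) (\<eta> m u) = arc_class (Zarc r) XI (\<lambda>y. ext m u (tr f y))"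
  unfolding \<eta>_def by (rule P_app[OF archimedean_XI assms(1) ext_in[OF assms(2)]])

sublocale tensor_extension Delta Lambda j_functor "fobj F_functor I" "fobj P_functor XI" \<eta>
proof
  show "\<eta> n u \<in> fobj (fobj P_functor XI) (fobj j_functor n)" if "u \<in> fobj (fobj F_functor I) n" for n u
    using that ext_in[of u n] by (simp add: \<eta>_def arc_class_in_hom)
  show "\<eta> n (fmor (fobj F_functor I) m n h u)
      = fmor (fobj P_functor XI) (fobj j_functor m) (fobj j_functor n) (fmor j_functor m n h) (\<eta> m u)"
    if h: "h \<in> Hom Delta m n" and u: "u \<in> fobj (fobj F_functor I) m" for m n h u
  proof -
    have u: "u \<in> FI m" using u by simp
    have "fmor (fobj F_functor I) m n h u = compose {0..n + 1} u (dual_map m n h)" using u by simp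
    then show ?thesis
      unfolding j_functor_simps P_\<eta>[OF j_map_in[OF h] u] by (simp only: \<eta>_def ext_dual[OF h u])
  qed
  show "\<exists>m\<in>Ob Delta. \<exists>f\<in>Hom Lambda (fobj j_functor m) r. \<exists>u\<in>fobj (fobj F_functor I) m.
      V = fmor (fobj P_functor XI) (fobj j_functor m) r f (\<eta> m u)"
    if V: "V \<in> fobj (fobj P_functor XI) r" for r V
  proof -
    obtain v where v: "v \<in> arc_maps (Zarc r) XI" "V = arc_class (Zarc r) XI v" using V by (auto elim: arc_homE)
    have bot_X: "cl 0 bot \<in> acar XI" by (rule cl_in[OF bot_in])
    obtain k where k: "\<And>y. XI.le (cl 0 bot) (v y) \<longleftrightarrow> k \<le> y"
      using arc_threshold[OF archimedean_XI v(1) bot_X] by blast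
    have vin: "v y \<in> acar XI" for y using v(1) by (auto simp: arc_maps_def)
    have k': "XI.le (v (k - 1)) (cl 0 bot)" "XI.le (cl 0 bot) (v k)"
      using k[of "k - 1"] k[of k] XI.le_total[OF bot_X vin] by auto
    have "V = fmor (fobj P_functor XI) (r + 1) r (arc_class (Zarc (r + 1)) (Zarc r) (shift_adj k r)) (\<eta> (r + 1) (window v k r))"
      unfolding P_\<eta>[OF shift_adj(1) window_hom[OF v(1) k']] shift_adj(2) ext_window[OF v(1) k'] by (rule v(2))
    then show ?thesis
      using window_hom[OF v(1) k'] arc_class_in_hom[OF shift_adj(1)[of k r]]
      by (intro bexI[of _ "r + 1"] bexI[of _ "arc_class (Zarc (r + 1)) (Zarc r) (shift_adj k r)"] bexI[of _ "window v k r"]) simp_all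
  qed
  show "cls r (m, F, u) = cls r (m', F', u')"
    if F: "F \<in> Hom Lambda (fobj j_functor m) r" and F': "F' \<in> Hom Lambda (fobj j_functor m') r"
      and uu': "u \<in> fobj (fobj F_functor I) m" "u' \<in> fobj (fobj F_functor I) m'"
      and eq: "fmor (fobj P_functor XI) (fobj j_functor m) r F (\<eta> m u) = fmor (fobj P_functor XI) (fobj j_functor m') r F' (\<eta> m' u')"
    for r m m' F F' u u'
  proof -
    obtain f where f: "f \<in> arc_maps (Zarc m) (Zarc r)" "F = arc_class (Zarc m) (Zarc r) f" using F by (auto elim: arc_homE)
    obtain f' where f': "f' \<in> arc_maps (Zarc m') (Zarc r)" "F' = arc_class (Zarc m') (Zarc r) f'" using F' by (auto elim: arc_homE)
    have u: "u \<in> FI m" and u': "u' \<in> FI m'" using uu' by simp_all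
    interpret f: Zarc_map m r f using f by unfold_locales
    interpret f': Zarc_map m' r f' using f' by unfold_locales
    have v: "(\<lambda>y. ext m u (tr f y)) \<in> arc_maps (Zarc r) XI" "(\<lambda>y. ext m' u' (tr f' y)) \<in> arc_maps (Zarc r) XI"
      by (rule Zarc_maps_comp[OF archimedean_XI f.tr_in ext_in[OF u]], rule Zarc_maps_comp[OF archimedean_XI f'.tr_in ext_in[OF u']])
    have "arc_class (Zarc r) XI (\<lambda>y. ext m u (tr f y)) = arc_class (Zarc r) XI (\<lambda>y. ext m' u' (tr f' y))"
      using eq unfolding f(2) f'(2) j_functor_simps P_\<eta>[OF f(1) u] P_\<eta>[OF f'(1) u'] .
    \<comment> \<open>Equality of classes determines the maps only up to a power s of \<theta>. It
      is compensated by translating f inside its class, which moves the transpose by s periods in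
      the opposite direction.\<close>
    from arc_class_eqD[OF archimedean_Zarc archimedean_XI v this]
    obtain s where s: "(\<lambda>y. ext m' u' (tr f' y)) = (\<lambda>y. XI.T s (ext m u (tr f y)))" by auto
    define g where "g = (\<lambda>x. f x + (- s) * (int r + 1))"
    have g: "g \<in> arc_maps (Zarc m) (Zarc r)" "arc_class (Zarc m) (Zarc r) g = F"
    proof -
      interpret a: arch_map "Zarc m" "Zarc r" f using f archimedean_Zarc by unfold_locales
      show "g \<in> arc_maps (Zarc m) (Zarc r)" "arc_class (Zarc m) (Zarc r) g = F"
        using a.shift[of "- s"] a.class_shift[of "- s"] f by (simp_all add: g_def)
    qed
    interpret e: arch_map "Zarc m" XI "ext m u" using ext_in[OF u] archimedean_Zarc archimedean_XI by unfold_locales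
    have "tr g = (\<lambda>y. tr f y + s * (int m + 1))" unfolding g_def f.tr_shift by simp
    then have "(\<lambda>y. ext m u (tr g y)) = (\<lambda>y. ext m' u' (tr f' y))"
      unfolding s using e.commute_T[of _ s] by simp
    then show ?thesis using class_eqI[OF g(1) u f'(1) u'] g f' by simp
  qed
qed (auto intro: is_category_Delta is_category_Lambda is_functor_j is_functor_F_obj is_functor_P_obj archimedean_XI)

text \<open>\<open>extend\<close> belongs to the locale of Kan extensions. Naming it here gives a
  family indexed by the interval alone, for which naturality in the interval can be stated.\<close>

definition to_arc_point ::
  "(nat, (int \<Rightarrow> int) set, 'r set, 'r \<Rightarrow> 'r) cfunctor \<Rightarrow> (nat \<times> 'r \<times> (nat \<Rightarrow> 'i)) set
    \<Rightarrow> (nat \<times> 'r \<times> (int \<Rightarrow> (int \<times> 'i) set) set) set" where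
  "to_arc_point R = extend R"

definition to_P :: "nat \<Rightarrow> (nat \<times> (int \<Rightarrow> int) set \<times> (nat \<Rightarrow> 'i)) set \<Rightarrow> (int \<Rightarrow> (int \<times> 'i) set) set" where
  "to_P n = collapse n"

end

section \<open>Naturality in the interval and the presheaf\<close>

lemma X_map_ext:
  assumes I: "is_interval I" and J: "is_interval J" and \<phi>: "\<phi> \<in> ivl_hom I J" and u: "u \<in> ivl_hom (fin_ivl (n + 1)) I"
  shows "X_map I J \<phi> (interval.ext I n u y) = interval.ext J n (compose {0..n + 1} \<phi> u) y"
proof -
  interpret I: interval I using I by unfold_locales
  interpret J: interval J using J by unfold_locales
  show ?thesis
    using X_map_cl[OF I J \<phi> I.FI_in[OF u], of "nat (y mod (int n + 1))"] nat_mod_le[of y n]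
    by (simp add: I.ext_def J.ext_def compose_eq)
qed

text \<open>A morphism of intervals acts on X_I copy by copy, so it may be applied before or after
  the periodic extension.\<close>

lemma \<eta>_natural_ivl:
  assumes I: "is_interval I" and J: "is_interval J" and \<phi>: "\<phi> \<in> ivl_hom I J" and u: "u \<in> ivl_hom (fin_ivl (n + 1)) I"
  shows "fmor P_functor (ivl_arch I) (ivl_arch J) (fmor X_functor I J \<phi>) n (interval.\<eta> I n u)
    = interval.\<eta> J n (fmor F_functor I J \<phi> n u)"
proof -
  interpret I: interval I using I by unfold_locales
  interpret J: interval J using J by unfold_locales
  show ?thesis
    using u I.ext_in[OF u] arc_comp_class[OF archimedean_Zarc I.archimedean_XI J.archimedean_XI I.ext_in[OF u] X_map_in[OF I J \<phi>]]
    by (simp add: I.\<eta>_def J.\<eta>_def arc_class_in_hom compose_def[of UNIV] X_map_ext[OF I J \<phi>, of _ n, simplified])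
qed

lemma is_category_psh: "is_category C \<Longrightarrow> is_category (psh C)"
  by (intro is_category_functor_cat is_category_op is_category_set_cat)

lemma is_functor_composite_point: "is_functor (prod_cat (psh Lambda) Intv) set_cat composite_point"
  unfolding composite_point_def
  by (rule is_functor_comp[OF is_functor_prod[OF is_functor_restriction[OF is_functor_j] is_functor_F]
        is_functor_tensor[OF is_category_Delta]])

lemma is_functor_arc_point: "is_functor (prod_cat (psh Lambda) Arc) set_cat arc_point"
  unfolding arc_point_def
  by (rule is_functor_comp[OF is_functor_prod[OF is_functor_id is_functor_P] is_functor_tensor[OF is_category_Lambda]])

text \<open>The points compared as inverse image functors. For fixed I the bijection is
  \<open>bij_extend\<close>; naturality is checked on a representative triple (n, r, u).\<close>

lemma point_of_X:
  "naturally_bijective (prod_cat (psh Lambda) Intv) composite_point (comp_functor arc_point (prod_functor id_functor X_functor))" (is "naturally_bijective ?C ?F ?G")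
  unfolding naturally_bijective_def
proof (intro conjI exI ballI)
  show "is_category ?C"
    by (intro is_category_prod is_category_psh is_category_Lambda is_category_Intv)
  show "is_functor ?C set_cat ?F" by (rule is_functor_composite_point)
  show "is_functor ?C set_cat ?G"
    by (rule is_functor_comp[OF is_functor_prod[OF is_functor_id is_functor_X] is_functor_arc_point])
  fix x assume x: "x \<in> Ob ?C"
  obtain R I where xRI: "x = (R, I)" by (cases x)
  then have R: "is_functor (op_cat Lambda) set_cat R" and I: "is_interval I" using x by auto
  interpret I: interval I using I by unfold_locales
  show "bij_betw ((\<lambda>(R, I). interval.to_arc_point I R) x) (fobj ?F x)
      (fobj ?G x)"
    using I.bij_extend[OF R, folded I.to_arc_point_def] by (simp add: xRI composite_point_def arc_point_def)
  fix y f A assume y: "y \<in> Ob ?C" and f: "f \<in> Hom ?C x y"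
    and A: "A \<in> fobj ?F x"
  obtain S J \<alpha> \<phi> where yf: "y = (S, J)" "f = (\<alpha>, \<phi>)" by (cases y, cases f)
  then have S: "is_functor (op_cat Lambda) set_cat S" and J: "is_interval J"
    and \<alpha>: "nat_trans (op_cat Lambda) set_cat R S \<alpha>" "\<alpha> \<in> Hom (psh Lambda) R S" and \<phi>: "\<phi> \<in> ivl_hom I J"
    using y f by (auto simp: xRI)
  interpret J: interval J using J by unfold_locales
  let ?\<psi> = "fmor P_functor I.XI J.XI (fmor X_functor I J \<phi>)"
  obtain n r u where nru: "r \<in> fobj R n" "u \<in> fobj (fobj F_functor I) n" "A = I.Ecls R (n, r, u)"
    using A by (auto simp: xRI composite_point_def elim!: tensorE)
  have \<alpha>j: "nat_trans (op_cat Delta) set_cat (comp_functor R (op_functor j_functor)) (comp_functor S (op_functor j_functor)) (\<lambda>n\<in>UNIV. \<alpha> n)"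
    using functor_mor[OF is_functor_restriction[OF is_functor_j], of R S \<alpha>] R S \<alpha> by simp
  have F\<phi>: "nat_trans Delta set_cat (fobj F_functor I) (fobj F_functor J) (fmor F_functor I J \<phi>)"
    using functor_mor[OF is_functor_F, of I J \<phi>] I J \<phi> by simp
  have PX: "nat_trans Lambda set_cat (fobj P_functor I.XI) (fobj P_functor J.XI)
      ?\<psi>"
    using functor_mor[OF is_functor_P, of I.XI J.XI] X_map_in[OF I J \<phi>] I.archimedean_XI J.archimedean_XI
    by (simp add: arc_class_in_hom del: P_simps)
  have "fmor ?F x y f A = J.Ecls S (n, \<alpha> n r, fmor F_functor I J \<phi> n u)"
    using tensor_map_class[OF \<alpha>j F\<phi>, of n r u] nru
    by (simp add: composite_point_def xRI yf del: F_simps)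
  then have "interval.to_arc_point J S (fmor ?F x y f A)
      = tensor_class Lambda S (fobj P_functor J.XI) (n, \<alpha> n r, J.\<eta> n (fmor F_functor I J \<phi> n u))"
    by (simp add: J.to_arc_point_def J.extend_class)
  also have "\<dots> = tensor_class Lambda S (fobj P_functor J.XI)
      (n, \<alpha> n r, ?\<psi> n (I.\<eta> n u))"
    using \<eta>_natural_ivl[OF I J \<phi>, of u n] nru by simp
  also have "\<dots> = tensor_map Lambda R (fobj P_functor I.XI) S (fobj P_functor J.XI) \<alpha>
      ?\<psi> (tensor_class Lambda R (fobj P_functor I.XI) (n, r, I.\<eta> n u))"
    by (rule tensor_map_class[OF \<alpha>(1) PX, symmetric]) (use nru I.\<eta>_app[of n u] in \<open>simp_all\<close>)
  also have "\<dots> = fmor ?G x y f (interval.to_arc_point I R A)"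
    by (simp add: arc_point_def xRI yf nru(3) I.to_arc_point_def I.extend_class del: P_simps X_functor_simps(2))
  finally show "(\<lambda>(R, I). interval.to_arc_point I R) y (fmor ?F x y f A)
      = fmor ?G x y f ((\<lambda>(R, I). interval.to_arc_point I R) x A)"
    by (simp add: xRI yf)
qed

text \<open>The points compared as flat functors, by \<open>bij_collapse\<close>. Naturality in [n]
  is functoriality of P along F after G, and naturality in I is that of \<eta>.\<close>

lemma point_on_representables:
  "naturally_bijective (prod_cat Lambda Intv)
     (comp_functor composite_point (prod_functor (yoneda Lambda) id_functor))
     (uncurry_functor (comp_functor P_functor X_functor))"
  (is "naturally_bijective ?C ?F ?G")
  unfolding naturally_bijective_def
proof (intro conjI exI ballI)
  show "is_category ?C" by (intro is_category_prod is_category_Lambda is_category_Intv)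
  show "is_functor ?C set_cat ?F"
    by (rule is_functor_comp[OF is_functor_prod[OF is_functor_yoneda[OF is_category_Lambda] is_functor_id] is_functor_composite_point])
  show "is_functor ?C set_cat ?G"
    by (rule is_functor_uncurry[OF is_category_Lambda is_category_Intv is_functor_comp[OF is_functor_X is_functor_P]])
  fix x assume x: "x \<in> Ob ?C"
  obtain n I where xnI: "x = (n, I)" by (cases x)
  then have I: "is_interval I" using x by auto
  interpret I: interval I using I by unfold_locales
  show "bij_betw ((\<lambda>(n, I). interval.to_P I n) x)
      (fobj ?F x)
      (fobj ?G x)"
    using I.bij_collapse[of n, folded I.to_P_def] by (simp add: xnI composite_point_def del: P_simps)
  fix y f A assume y: "y \<in> Ob ?C" and f: "f \<in> Hom ?C x y"
    and A: "A \<in> fobj ?F x"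
  obtain m J F \<phi> where yf: "y = (m, J)" "f = (F, \<phi>)" by (cases y, cases f)
  then have J: "is_interval J" and F: "F \<in> Hom Lambda n m" and \<phi>: "\<phi> \<in> ivl_hom I J"
    using y f by (auto simp: xnI)
  interpret J: interval J using J by unfold_locales
  obtain e G u where eGu: "G \<in> Hom Lambda e n" "u \<in> fobj (fobj F_functor I) e" "A = I.Ecls (fobj (yoneda Lambda) n) (e, G, u)"
    using A by (auto simp: xnI composite_point_def elim!: tensorE)
  let ?\<psi> = "fmor P_functor I.XI J.XI (fmor X_functor I J \<phi>)"
  let ?\<alpha> = "fmor (yoneda Lambda) n m F"
  have \<alpha>: "?\<alpha> \<in> Hom (psh Lambda) (fobj (yoneda Lambda) n) (fobj (yoneda Lambda) m)"
    using functor_mor[OF is_functor_yoneda[OF is_category_Lambda], of n m F] F by simp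
  have yo: "fobj (yoneda Lambda) c \<in> Ob (psh Lambda)" for c
    using functor_ob[OF is_functor_yoneda[OF is_category_Lambda], of c] by simp
  have \<alpha>j: "nat_trans (op_cat Delta) set_cat (comp_functor (fobj (yoneda Lambda) n) (op_functor j_functor))
      (comp_functor (fobj (yoneda Lambda) m) (op_functor j_functor)) (\<lambda>e\<in>UNIV. ?\<alpha> e)"
    using functor_mor[OF is_functor_restriction[OF is_functor_j] yo yo \<alpha>] by simp
  have F\<phi>: "nat_trans Delta set_cat (fobj F_functor I) (fobj F_functor J) (fmor F_functor I J \<phi>)"
    using functor_mor[OF is_functor_F, of I J \<phi>] I J \<phi> by simp
  have PX: "nat_trans Lambda set_cat (fobj P_functor I.XI) (fobj P_functor J.XI)
      ?\<psi>"
    using functor_mor[OF is_functor_P, of I.XI J.XI] X_map_in[OF I J \<phi>] I.archimedean_XI J.archimedean_XI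
    by (simp add: arc_class_in_hom del: P_simps)
  have \<eta>u: "I.\<eta> e u \<in> fobj (fobj P_functor I.XI) e" using I.\<eta>_app[of e u] eGu by simp
  have \<psi>\<eta>: "?\<psi> e (I.\<eta> e u) \<in> fobj (fobj P_functor J.XI) e" using nat_trans_app[OF PX _ \<eta>u] by simp
  have "fmor ?F x y f A
      = J.Ecls (fobj (yoneda Lambda) m) (e, ?\<alpha> e G, fmor F_functor I J \<phi> e u)"
    using tensor_map_class[OF \<alpha>j F\<phi>, of e G u] eGu
    by (simp add: composite_point_def xnI yf del: F_simps yoneda_simps(3))
  then have "interval.to_P J m (fmor ?F x y f A)
      = fmor (fobj P_functor J.XI) e m (?\<alpha> e G) (J.\<eta> e (fmor F_functor I J \<phi> e u))"
    using J.collapse_class[of m e "?\<alpha> e G"] by (simp add: J.to_P_def)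
  also have "\<dots> = fmor (fobj P_functor J.XI) e m (Cmp Lambda e n m F G) (?\<psi> e (I.\<eta> e u))"
    using \<eta>_natural_ivl[OF I J \<phi>, of u e] eGu by simp
  also have "\<dots> = fmor (fobj P_functor J.XI) n m F (fmor (fobj P_functor J.XI) e n G (?\<psi> e (I.\<eta> e u)))"
    using set_functor_comp[OF is_functor_P_obj[OF J.archimedean_XI] _ _ _ eGu(1) F \<psi>\<eta>] by simp
  also have "fmor (fobj P_functor J.XI) e n G (?\<psi> e (I.\<eta> e u)) = ?\<psi> n (fmor (fobj P_functor I.XI) e n G (I.\<eta> e u))"
    using nat_trans_natural[OF PX _ _ eGu(1) \<eta>u] by simp
  also have "fmor (fobj P_functor J.XI) n m F (?\<psi> n (fmor (fobj P_functor I.XI) e n G (I.\<eta> e u)))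
      = fmor ?G x y f (interval.to_P I n A)"
    using I.collapse_class[of n e G u] set_functor_app[OF is_functor_P_obj[OF I.archimedean_XI] _ _ eGu(1) \<eta>u]
    by (simp add: xnI yf eGu(3) I.to_P_def compose_eq del: P_simps X_functor_simps(2))
  finally show "(\<lambda>(n, I). interval.to_P I n) y
        (fmor ?F x y f A)
      = fmor ?G x y f ((\<lambda>(n, I). interval.to_P I n) x A)"
    by (simp add: xnI yf)
qed

theorem proposition5p12:
  assumes "infinite (UNIV :: 'a set)"
  shows "is_equivalence (Arc :: ('a arch, ('a \<Rightarrow> 'a) set) category) Circ Q_functor
    \<and> is_functor (Intv :: ('i ivl, 'i \<Rightarrow> 'i) category) Arc X_functor
    \<and> naturally_bijective
         (prod_cat
            (psh Lambda :: ((nat, (int \<Rightarrow> int) set, 'r set, 'r \<Rightarrow> 'r) cfunctor, nat \<Rightarrow> 'r \<Rightarrow> 'r) category)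
            (Intv :: ('i ivl, 'i \<Rightarrow> 'i) category))
         composite_point
         (comp_functor arc_point (prod_functor id_functor X_functor))
    \<and> naturally_bijective
         (prod_cat Lambda (Intv :: ('i ivl, 'i \<Rightarrow> 'i) category))
         (comp_functor composite_point (prod_functor (yoneda Lambda) id_functor))
         (uncurry_functor (comp_functor P_functor X_functor))"
  by (intro conjI Q_equivalence assms is_functor_X point_of_X point_on_representables)

end
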